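(* The Positivity problem is polynomial-time reducible to the following problem (threshold problem of the partial stochastic shortest path problem): given a finite MDP $\mathcal{M}$ with integer weights, initial state $s_{\mathit{init}}$ and a set $\mathit{Goal}$ of terminal states, and a rational $\vartheta$, decide whether $\mathbb{PE}^{\max}_{\mathcal{M}}>\vartheta$.
   Context: Positivity problem: given $k\ge 2$ and rationals $\alpha_1,\dots,\alpha_k,\beta_0,\dots,\beta_{k-1}$, let $u_j=\beta_j$ for $0\le j<k$ and $u_{n+k}=\alpha_1u_{n+k-1}+\dots+\alpha_ku_n$; decide whether $u_n\ge0$ for all $n$. A finite MDP $(S,\mathit{Act},P,s_{\mathit{init}})$ has finite states and actions, rational transition probabilities, and weight function $\mathit{wgt}\colon S\times\mathit{Act}\to\mathbb{Z}$ (binary encoded). Schedulers are randomized history-dependent. The random variable $\oplus\mathit{Goal}$ assigns to a maximal path $\zeta$ its accumulated weight (sum of weights along $\zeta$) if $\zeta$ reaches $\mathit{Goal}$, and $0$ otherwise. $\mathbb{PE}^{\max}_{\mathcal{M}}=\sup_{\mathfrak{S}}\mathbb{E}^{\mathfrak{S}}_{\mathcal{M},s_{\mathit{init}}}(\oplus\mathit{Goal})$ over all schedulers. *)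

theory Defs
  imports
    "HOL-Probability.Probability"
    "HOL-Computational_Algebra.Polynomial"
    "HOL-Library.Log_Nat"
begin

section \<open>Polynomial-time Turing reductions\<close>

text \<open>
  The machine model is the random access machine with the logarithmic cost criterion
  (Aho, Hopcroft and Ullman), extended by an oracle.
  It has infinitely many integer cells, a read-only input tape and a write-only query tape, both
  holding integers. Control flow is structured instead of being given by jumps.
  Every operation is charged the bit length of all cell contents and computed addresses that take
  part in it; cell numbers written in the program contribute at most a constant factor per program
  and are not charged.

  \<^item> Negative computed addresses denote cell 0; division is floor division with \<open>x div 0 = 0\<close>.
  \<^item> Reading past the end of the input yields 0; \<open>EOF\<close> tests for the end.
  \<^item> \<open>QUERY\<close> asks whether the current query tape belongs to the oracle and erases the tape. Its unit
    cost is adequate because every symbol on the query tape has been paid for by a \<open>WRITE\<close>.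
\<close>

datatype arith = ADD | SUB | MULT | DIV

fun arith_val :: "arith \<Rightarrow> int \<Rightarrow> int \<Rightarrow> int" where
  "arith_val ADD x y = x + y"
| "arith_val SUB x y = x - y"
| "arith_val MULT x y = x * y"
| "arith_val DIV x y = x div y"

datatype com =
    IMM nat int
  | ARITH arith nat nat nat
  | LOAD nat nat
  | STORE nat nat
  | READ nat
  | EOF nat
  | WRITE nat
  | QUERY nat
  | SEQ com com
  | IFPOS nat com com
  | WHILEPOS nat com

record config =
  mem :: "nat \<Rightarrow> int"
  inp :: "int list"
  qry :: "int list"

text \<open>Number of binary digits including one for the sign; in particular it is at least 1.\<close>

definition bits :: "int \<Rightarrow> nat" where
  "bits x = Suc (floorlog 2 (nat \<bar>x\<bar>))"

definition word_size :: "int list \<Rightarrow> nat" where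
  "word_size w = (\<Sum>x\<leftarrow>w. bits x)"

definition set_cell :: "nat \<Rightarrow> int \<Rightarrow> config \<Rightarrow> config" where
  "set_cell r x \<sigma> = \<sigma>\<lparr>mem := (mem \<sigma>)(r := x)\<rparr>"

text \<open>\<open>exec B c \<sigma> t \<tau>\<close>: with oracle \<open>B\<close>, program \<open>c\<close> started in \<open>\<sigma>\<close> halts in \<open>\<tau>\<close> at total cost \<open>t\<close>.\<close>

inductive exec :: "int list set \<Rightarrow> com \<Rightarrow> config \<Rightarrow> nat \<Rightarrow> config \<Rightarrow> bool" for B where
  Imm: "exec B (IMM r x) \<sigma> (bits x) (set_cell r x \<sigma>)"
| Arith: "exec B (ARITH f r i j) \<sigma> (bits (mem \<sigma> i) + bits (mem \<sigma> j))
            (set_cell r (arith_val f (mem \<sigma> i) (mem \<sigma> j)) \<sigma>)"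
| Load: "exec B (LOAD r i) \<sigma> (bits (mem \<sigma> i) + bits (mem \<sigma> (nat (mem \<sigma> i))))
            (set_cell r (mem \<sigma> (nat (mem \<sigma> i))) \<sigma>)"
| Store: "exec B (STORE i r) \<sigma> (bits (mem \<sigma> i) + bits (mem \<sigma> r))
            (set_cell (nat (mem \<sigma> i)) (mem \<sigma> r) \<sigma>)"
| Read_Nil: "inp \<sigma> = [] \<Longrightarrow> exec B (READ r) \<sigma> 1 (set_cell r 0 \<sigma>)"
| Read_Cons: "inp \<sigma> = x # w \<Longrightarrow> exec B (READ r) \<sigma> (bits x) (set_cell r x (\<sigma>\<lparr>inp := w\<rparr>))"
| Eof: "exec B (EOF r) \<sigma> 1 (set_cell r (if inp \<sigma> = [] then 1 else 0) \<sigma>)"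
| Write: "exec B (WRITE r) \<sigma> (bits (mem \<sigma> r)) (\<sigma>\<lparr>qry := qry \<sigma> @ [mem \<sigma> r]\<rparr>)"
| Query: "exec B (QUERY r) \<sigma> 1 (set_cell r (if qry \<sigma> \<in> B then 1 else 0) (\<sigma>\<lparr>qry := []\<rparr>))"
| Seq: "exec B c \<sigma> t \<rho> \<Longrightarrow> exec B d \<rho> u \<tau> \<Longrightarrow> exec B (SEQ c d) \<sigma> (t + u) \<tau>"
| If_True: "mem \<sigma> r > 0 \<Longrightarrow> exec B c \<sigma> t \<tau> \<Longrightarrow> exec B (IFPOS r c d) \<sigma> (bits (mem \<sigma> r) + t) \<tau>"
| If_False: "mem \<sigma> r \<le> 0 \<Longrightarrow> exec B d \<sigma> t \<tau> \<Longrightarrow> exec B (IFPOS r c d) \<sigma> (bits (mem \<sigma> r) + t) \<tau>"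
| While_True: "mem \<sigma> r > 0 \<Longrightarrow> exec B c \<sigma> t \<rho> \<Longrightarrow> exec B (WHILEPOS r c) \<rho> u \<tau>
    \<Longrightarrow> exec B (WHILEPOS r c) \<sigma> (bits (mem \<sigma> r) + t + u) \<tau>"
| While_False: "mem \<sigma> r \<le> 0 \<Longrightarrow> exec B (WHILEPOS r c) \<sigma> (bits (mem \<sigma> r)) \<sigma>"

inductive_cases exec_elims:
  "exec B (IMM r x) \<sigma> t \<tau>"
  "exec B (ARITH f r i j) \<sigma> t \<tau>"
  "exec B (LOAD r i) \<sigma> t \<tau>"
  "exec B (STORE i r) \<sigma> t \<tau>"
  "exec B (READ r) \<sigma> t \<tau>"
  "exec B (EOF r) \<sigma> t \<tau>"
  "exec B (WRITE r) \<sigma> t \<tau>"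
  "exec B (QUERY r) \<sigma> t \<tau>"
  "exec B (SEQ c d) \<sigma> t \<tau>"
  "exec B (IFPOS r c d) \<sigma> t \<tau>"
  "exec B (WHILEPOS r c) \<sigma> t \<tau>"

lemma exec_deterministic:
  "exec B c \<sigma> t \<tau> \<Longrightarrow> exec B c \<sigma> t' \<tau>' \<Longrightarrow> t' = t \<and> \<tau>' = \<tau>"
proof (induction arbitrary: t' \<tau>' rule: exec.induct)
  case (Seq c \<sigma> t \<rho> d u \<tau>)
  from Seq.prems obtain t1 \<rho>' t2
    where *: "exec B c \<sigma> t1 \<rho>'" "exec B d \<rho>' t2 \<tau>'" "t' = t1 + t2"
    by (rule exec_elims) blast
  with Seq.IH(1)[OF *(1)] Seq.IH(2) show ?case
    by blast
next
  case (If_True \<sigma> r c t \<tau> d)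
  from If_True.prems If_True.hyps(1) obtain t1
    where *: "exec B c \<sigma> t1 \<tau>'" "t' = bits (mem \<sigma> r) + t1"
    by - (erule exec_elims; simp)
  with If_True.IH[OF *(1)] show ?case
    by blast
next
  case (If_False \<sigma> r d t \<tau> c)
  from If_False.prems If_False.hyps(1) obtain t1
    where *: "exec B d \<sigma> t1 \<tau>'" "t' = bits (mem \<sigma> r) + t1"
    by - (erule exec_elims; simp)
  with If_False.IH[OF *(1)] show ?case
    by blast
next
  case (While_True \<sigma> r c t \<rho> u \<tau>)
  from While_True.prems(1) While_True.hyps(1) obtain t1 \<rho>' t2
    where *: "exec B c \<sigma> t1 \<rho>'" "exec B (WHILEPOS r c) \<rho>' t2 \<tau>'"
      "t' = bits (mem \<sigma> r) + t1 + t2"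
    by - (erule exec_elims; simp)
  with While_True.IH(1)[OF *(1)] While_True.IH(2) show ?case
    by blast
next
  case (While_False \<sigma> r c)
  from While_False.prems While_False.hyps show ?case
    by - (erule exec_elims; simp)
qed (erule exec_elims; simp)+

definition initial_config :: "int list \<Rightarrow> config" where
  "initial_config w = \<lparr>mem = (\<lambda>_. 0), inp = w, qry = []\<rparr>"

text \<open>
  Problems are sets of words over the integers, namely the encodings of the yes-instances. A run
  accepts if cell 0 finally contains 1. Reducibility is by polynomial-time Turing (Cook) reductions:
  in the intended application a violation of positivity corresponds to exceeding the threshold, so
  that answers have to be complemented.
\<close>

definition poly_time_turing_reducible :: "int list set \<Rightarrow> int list set \<Rightarrow> bool" where
  "poly_time_turing_reducible A B \<longleftrightarrow>
     (\<exists>c (p :: nat poly). \<forall>w. \<exists>t \<tau>. exec B c (initial_config w) t \<tau> \<and>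
        t \<le> poly p (word_size w) \<and> (mem \<tau> 0 = 1 \<longleftrightarrow> w \<in> A))"

text \<open>
  A rational is encoded by any two consecutive integers \<open>p\<close>, \<open>q\<close> with \<open>q > 0\<close> and quotient \<open>p / q\<close>;
  the fraction need not be reduced.
\<close>

fun encodes_rats :: "int list \<Rightarrow> rat list \<Rightarrow> bool" where
  "encodes_rats w [] \<longleftrightarrow> w = []"
| "encodes_rats w (r # rs) \<longleftrightarrow>
     (\<exists>p q v. w = p # q # v \<and> q > 0 \<and> r = Rat.Fract p q \<and> encodes_rats v rs)"

section \<open>The Positivity problem\<close>

text \<open>
  In the lists \<open>\<alpha>\<close> and \<open>\<beta>\<close> of length \<open>k\<close>, the entry \<open>\<alpha> ! j\<close> is the coefficient $\alpha_{j+1}$, and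
  \<open>\<beta> ! j\<close> is the initial value $\beta_j$.
\<close>

function lrs :: "rat list \<Rightarrow> rat list \<Rightarrow> nat \<Rightarrow> rat" where
  "lrs \<alpha> \<beta> n = (if n < length \<alpha> then \<beta> ! n
                else \<Sum>j<length \<alpha>. \<alpha> ! j * lrs \<alpha> \<beta> (n - Suc j))"
  by pat_completeness auto
termination
  by (relation "Wellfounded.measure (\<lambda>(\<alpha>, \<beta>, n). n)") auto

declare lrs.simps [simp del]

lemma lrs_initial: "n < length \<alpha> \<Longrightarrow> lrs \<alpha> \<beta> n = \<beta> ! n"
  by (subst lrs.simps) simp

lemma lrs_recurrence:
  "k = length \<alpha> \<Longrightarrow> lrs \<alpha> \<beta> (n + k) = (\<Sum>j=1..k. \<alpha> ! (j - 1) * lrs \<alpha> \<beta> (n + k - j))"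
  by (subst lrs.simps) (auto simp: sum.atLeast1_atMost_eq)

definition positivity_problem :: "int list set" where
  "positivity_problem = {int k # w | k w. \<exists>\<alpha> \<beta>.
     k \<ge> 2 \<and> length \<alpha> = k \<and> length \<beta> = k \<and> encodes_rats w (\<alpha> @ \<beta>) \<and>
     (\<forall>n. lrs \<alpha> \<beta> n \<ge> 0)}"

section \<open>Markov decision processes and partial expectations\<close>

text \<open>States and actions are numbered: the state space is \<open>{..<nstates M}\<close>, the set of actions is
  \<open>{..<nacts M}\<close>. Values of the components outside these ranges are never used.\<close>

record mdp =
  nstates :: nat
  nacts :: nat
  prob :: "nat \<Rightarrow> nat \<Rightarrow> nat \<Rightarrow> rat"
  init :: nat
  wgt :: "nat \<Rightarrow> nat \<Rightarrow> int"

definition enabled :: "mdp \<Rightarrow> nat \<Rightarrow> nat set" where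
  "enabled M s = {a. a < nacts M \<and> (\<Sum>t<nstates M. prob M s a t) = 1}"

definition wf_mdp :: "mdp \<Rightarrow> bool" where
  "wf_mdp M \<longleftrightarrow> init M < nstates M \<and>
     (\<forall>s<nstates M. \<forall>a<nacts M.
        (\<forall>t<nstates M. prob M s a t \<ge> 0) \<and> (\<Sum>t<nstates M. prob M s a t) \<in> {0, 1})"

definition terminal :: "mdp \<Rightarrow> nat \<Rightarrow> bool" where
  "terminal M s \<longleftrightarrow> enabled M s = {}"

text \<open>A finite path $s_0\,a_0\,s_1\ldots a_{n-1}\,s_n$ from a given \<open>s\<^sub>0\<close> is represented by the list
  of the pairs $(a_i, s_{i+1})$.\<close>

type_synonym path = "(nat \<times> nat) list"

fun path_from :: "mdp \<Rightarrow> nat \<Rightarrow> path \<Rightarrow> bool" where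
  "path_from M s [] \<longleftrightarrow> True"
| "path_from M s ((a, t) # h) \<longleftrightarrow>
     a \<in> enabled M s \<and> t < nstates M \<and> prob M s a t > 0 \<and> path_from M t h"

fun path_weight :: "mdp \<Rightarrow> nat \<Rightarrow> path \<Rightarrow> int" where
  "path_weight M s [] = 0"
| "path_weight M s ((a, t) # h) = wgt M s a + path_weight M t h"

definition last_state :: "mdp \<Rightarrow> path \<Rightarrow> nat" where
  "last_state M h = (if h = [] then init M else snd (last h))"

type_synonym scheduler = "path \<Rightarrow> nat pmf"

definition is_scheduler :: "mdp \<Rightarrow> scheduler \<Rightarrow> bool" where
  "is_scheduler M \<SS> \<longleftrightarrow>
     (\<forall>h. path_from M (init M) h \<longrightarrow> \<not> terminal M (last_state M h) \<longrightarrow>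
        set_pmf (\<SS> h) \<subseteq> enabled M (last_state M h))"

definition trans_pmf :: "mdp \<Rightarrow> nat \<Rightarrow> nat \<Rightarrow> nat pmf" where
  "trans_pmf M s a = embed_pmf (\<lambda>t. if t < nstates M then real_of_rat (prob M s a t) else 0)"

lemma pmf_trans_pmf:
  assumes "wf_mdp M" "s < nstates M" "a \<in> enabled M s"
  shows "pmf (trans_pmf M s a) t = (if t < nstates M then real_of_rat (prob M s a t) else 0)"
  unfolding trans_pmf_def
proof (rule pmf_embed_pmf)
  let ?f = "\<lambda>t. if t < nstates M then real_of_rat (prob M s a t) else 0"
  show nonneg: "0 \<le> ?f t" for t
    using assms by (auto simp: wf_mdp_def enabled_def)
  have "(\<integral>\<^sup>+t. ennreal (?f t) \<partial>count_space UNIV) = (\<Sum>t<nstates M. ennreal (?f t))"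
    by (rule nn_integral_count_space'[of "{..<nstates M}"]) auto
  also have "\<dots> = ennreal (\<Sum>t<nstates M. ?f t)"
    using nonneg by (rule sum_ennreal)
  also have "(\<Sum>t<nstates M. ?f t) = real_of_rat (\<Sum>t<nstates M. prob M s a t)"
    by (simp add: of_rat_sum)
  also have "\<dots> = 1"
    using assms by (simp add: enabled_def)
  finally show "(\<integral>\<^sup>+t. ennreal (?f t) \<partial>count_space UNIV) = 1"
    by simp
qed

text \<open>
  Maximal paths are represented by infinite sequences whose \<open>n\<close>-th entry is \<open>Some (a\<^sub>n, s\<^sub>n\<^sub>+\<^sub>1)\<close>,
  or \<open>None\<close> if the path has already ended in a terminal state after at most \<open>n\<close> steps.
  Their distribution is obtained from the one-step kernels by the Ionescu-Tulcea theorem.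
\<close>

type_synonym mpath = "nat \<Rightarrow> (nat \<times> nat) option"

definition history :: "nat \<Rightarrow> mpath \<Rightarrow> path" where
  "history n \<omega> = map the (takeWhile (\<lambda>x. x \<noteq> None) (map \<omega> [0..<n]))"

definition step_pmf :: "mdp \<Rightarrow> scheduler \<Rightarrow> path \<Rightarrow> (nat \<times> nat) option pmf" where
  "step_pmf M \<SS> h =
     (if terminal M (last_state M h) then return_pmf None
      else bind_pmf (\<SS> h) (\<lambda>a. map_pmf (\<lambda>t. Some (a, t)) (trans_pmf M (last_state M h) a)))"

definition step_kernel :: "mdp \<Rightarrow> scheduler \<Rightarrow> nat \<Rightarrow> mpath \<Rightarrow> (nat \<times> nat) option measure" where
  "step_kernel M \<SS> n \<omega> = measure_pmf (step_pmf M \<SS> (history n \<omega>))"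

lemma measurable_map_upt_count_space:
  assumes "{0..<n} \<subseteq> I"
  shows "(\<lambda>\<omega>. map \<omega> [0..<n]) \<in> measurable (Pi\<^sub>M I (\<lambda>_. count_space UNIV))
           (count_space (UNIV :: 'a :: countable list set))"
proof -
  let ?P = "Pi\<^sub>M I (\<lambda>_. count_space (UNIV :: 'a set))"
  have "(\<lambda>\<omega>. map \<omega> [0..<n]) -` {xs} \<inter> space ?P \<in> sets ?P" for xs :: "'a list"
  proof (cases "length xs = n")
    case True
    have "(\<lambda>\<omega>. \<omega> j) \<in> measurable ?P (count_space UNIV)" if "j < n" for j
      using that assms by (intro measurable_component_singleton) auto
    from measurable_sets[OF this, of _ "{xs ! j}" for j]
    have "(\<lambda>\<omega>. \<omega> j) -` {xs ! j} \<inter> space ?P \<in> sets ?P" if "j < n" for j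
      using that by simp
    moreover have "(\<lambda>\<omega>. \<omega> j) -` {xs ! j} \<inter> space ?P = {\<omega> \<in> space ?P. \<omega> j = xs ! j}" for j
      by auto
    ultimately have "{\<omega> \<in> space ?P. \<omega> j = xs ! j} \<in> sets ?P" if "j < n" for j
      using that by simp
    then have "{\<omega> \<in> space ?P. \<forall>j\<in>{..<n}. \<omega> j = xs ! j} \<in> sets ?P"
      by (intro sets.sets_Collect_finite_All) auto
    moreover have "(\<forall>j\<in>{..<n}. \<omega> j = xs ! j) \<longleftrightarrow> map \<omega> [0..<n] = xs" for \<omega>
      using True by (subst list_eq_iff_nth_eq) auto
    then have "{\<omega> \<in> space ?P. \<forall>j\<in>{..<n}. \<omega> j = xs ! j} = (\<lambda>\<omega>. map \<omega> [0..<n]) -` {xs} \<inter> space ?P"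
      by blast
    ultimately show ?thesis by simp
  next
    case False
    then have "(\<lambda>\<omega>. map \<omega> [0..<n]) -` {xs} \<inter> space ?P = {}"
      by auto
    then show ?thesis
      by simp
  qed
  then show ?thesis
    by (subst measurable_count_space_eq2_countable) simp_all
qed

lemma measurable_history:
  "{0..<n} \<subseteq> I \<Longrightarrow>
     history n \<in> measurable (Pi\<^sub>M I (\<lambda>_. count_space UNIV)) (count_space UNIV)"
  unfolding history_def
  by (rule measurable_compose[OF measurable_map_upt_count_space]) simp_all

lemma Ionescu_Tulcea_step_kernel: "Ionescu_Tulcea (step_kernel M \<SS>) (\<lambda>_. count_space UNIV)"
proof (rule Ionescu_Tulcea.intro)
  show "step_kernel M \<SS> n \<in> measurable (Pi\<^sub>M {0..<n} (\<lambda>_. count_space UNIV))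
          (subprob_algebra (count_space UNIV))" for n
    unfolding step_kernel_def
    by (rule measurable_compose[OF measurable_history])
       (auto simp: space_subprob_algebra measure_pmf.subprob_space_axioms)
  show "prob_space (step_kernel M \<SS> n \<omega>)" for n \<omega>
    unfolding step_kernel_def by (rule measure_pmf.prob_space_axioms)
qed

definition path_measure :: "mdp \<Rightarrow> scheduler \<Rightarrow> mpath measure" where
  "path_measure M \<SS> = projective_family.lim UNIV
     (Ionescu_Tulcea.CI (step_kernel M \<SS>) (\<lambda>_. count_space UNIV)) (\<lambda>_. count_space UNIV)"

lemma prob_space_path_measure: "prob_space (path_measure M \<SS>)"
proof -
  interpret Ionescu_Tulcea "step_kernel M \<SS>" "\<lambda>_. count_space UNIV"
    by (rule Ionescu_Tulcea_step_kernel)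
  show ?thesis
  proof
    have "emeasure PF.lim (PF.emb UNIV {} {\<lambda>_. undefined}) = emeasure (CI {}) {\<lambda>_. undefined}"
      by (rule lim) (auto simp: PiM_empty)
    also have "\<dots> = emeasure (CI {}) (space (CI {}))"
      by (simp add: PF.space_P space_PiM)
    also have "\<dots> = 1"
      using PF.prob_space_P[of "{}"] by (simp add: prob_space.emeasure_space_1)
    also have "PF.emb UNIV {} {\<lambda>_. undefined} = space PF.lim"
      by (auto simp: prod_emb_def space_PiM)
    finally show "emeasure (path_measure M \<SS>) (space (path_measure M \<SS>)) = 1"
      unfolding path_measure_def .
  qed
qed

lemma sets_path_measure [measurable_cong]:
  "sets (path_measure M \<SS>) = sets (Pi\<^sub>M UNIV (\<lambda>_. count_space UNIV))"
proof -
  interpret Ionescu_Tulcea "step_kernel M \<SS>" "\<lambda>_. count_space UNIV"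
    by (rule Ionescu_Tulcea_step_kernel)
  show ?thesis
    unfolding path_measure_def by (rule PF.sets_lim)
qed

text \<open>The random variable $\oplus\mathit{Goal}$. When the path visits a terminal goal state, it ends there.\<close>

definition goal_weight :: "mdp \<Rightarrow> nat set \<Rightarrow> mpath \<Rightarrow> real" where
  "goal_weight M G \<omega> =
     (if \<exists>n. last_state M (history n \<omega>) \<in> G
      then path_weight M (init M) (history (LEAST n. last_state M (history n \<omega>) \<in> G) \<omega>)
      else 0)"

lemma borel_measurable_goal_weight: "goal_weight M G \<in> borel_measurable (path_measure M \<SS>)"
proof -
  have [measurable]: "history n \<in> measurable (path_measure M \<SS>) (count_space UNIV)" for n
    using measurable_history[of n UNIV] by (simp add: measurable_cong_sets[OF sets_path_measure refl])
  show ?thesis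
    unfolding goal_weight_def[abs_def] by measurable
qed

text \<open>
  The supremum ranges over all schedulers for which the expectation exists in the extended reals,
  i.e. the positive or the negative part of $\oplus\mathit{Goal}$ has finite expectation.
\<close>

definition expectation_pos :: "mdp \<Rightarrow> nat set \<Rightarrow> scheduler \<Rightarrow> ennreal" where
  "expectation_pos M G \<SS> = (\<integral>\<^sup>+\<omega>. ennreal (goal_weight M G \<omega>) \<partial>path_measure M \<SS>)"

definition expectation_neg :: "mdp \<Rightarrow> nat set \<Rightarrow> scheduler \<Rightarrow> ennreal" where
  "expectation_neg M G \<SS> = (\<integral>\<^sup>+\<omega>. ennreal (- goal_weight M G \<omega>) \<partial>path_measure M \<SS>)"

definition partial_expectation :: "mdp \<Rightarrow> nat set \<Rightarrow> scheduler \<Rightarrow> ereal" where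
  "partial_expectation M G \<SS> =
     enn2ereal (expectation_pos M G \<SS>) - enn2ereal (expectation_neg M G \<SS>)"

definition max_partial_expectation :: "mdp \<Rightarrow> nat set \<Rightarrow> ereal" where
  "max_partial_expectation M G =
     (SUP \<SS> \<in> {\<SS>. is_scheduler M \<SS> \<and> (expectation_pos M G \<SS> < \<infinity> \<or> expectation_neg M G \<SS> < \<infinity>)}.
        partial_expectation M G \<SS>)"

text \<open>Encoding: number of states and actions, initial state, characteristic function of the goal
  set, weights, and finally all transition probabilities followed by the threshold.\<close>

definition encodes_mdp_threshold :: "int list \<Rightarrow> mdp \<Rightarrow> nat set \<Rightarrow> rat \<Rightarrow> bool" where
  "encodes_mdp_threshold w M G \<theta> \<longleftrightarrow>
     (\<exists>v. w = [int (nstates M), int (nacts M), int (init M)]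
            @ [if s \<in> G then 1 else 0. s \<leftarrow> [0..<nstates M]]
            @ [wgt M s a. s \<leftarrow> [0..<nstates M], a \<leftarrow> [0..<nacts M]] @ v \<and>
          encodes_rats v ([prob M s a t. s \<leftarrow> [0..<nstates M], a \<leftarrow> [0..<nacts M],
                                         t \<leftarrow> [0..<nstates M]] @ [\<theta>]))"

definition partial_ssp_threshold_problem :: "int list set" where
  "partial_ssp_threshold_problem = {w. \<exists>M G \<theta>.
     wf_mdp M \<and> G \<subseteq> {s. s < nstates M \<and> terminal M s} \<and> encodes_mdp_threshold w M G \<theta> \<and>
     max_partial_expectation M G > ereal (real_of_rat \<theta>)}"

end

theory Submission
  imports Defs "HOL-Real_Asymp.Real_Asymp"
begin

text \<open>
  Write \<open>c\<close> for \<open>1 / ((k + 2) * B)\<close>, where \<open>B\<close> bounds all coefficients and initial values. The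
  process has twin states \<open>6 + 2 * j\<close> and \<open>7 + 2 * j\<close> for \<open>j < k\<close>. Each step from them lowers the
  weight by 1 and leads to twin states, or to the states 2, 3, 4 where the scheduler may stop in the
  goal 5 with the current weight shifted by -1, 0, 1, or give up in the state 1. Thus the latter have the value
  \<open>max (w + i) 0\<close>, whose second difference in \<open>w\<close> is a point mass. The transition probabilities of twins
  differ only in the sign of the coefficients. Hence the difference of the values of twins at weight
  \<open>n + 1\<close> obeys the recurrence and equals \<open>c ^ (n + 1) * u (n + j)\<close>, while the sum of their values
  depends on \<open>k\<close> only.

  In the initial state 0 the weight is raised by 1 in every step, and the state is left with
  probability 1/2. On leaving at weight \<open>n + 1\<close> the scheduler goes to a fair mixture of the twins 6
  and 7 or to 7 alone. The second choice is strictly better iff \<open>u n < 0\<close>. If the mixture is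
  always optimal, then the value has a closed form, namely \<open>9 / (2 * (k + 4))\<close>; this is the threshold.
\<close>

section \<open>Path measures and potentials\<close>

text \<open>The obstacle is that coefficients and initial values may be negative while probabilities
  may not. With twins, a signed entry \<open>x\<close> appears as \<open>B + x\<close> in one row
  and as \<open>B - x\<close> in the other: both are non-negative, the difference of the rows keeps
  \<open>2 * x\<close> and their sum forgets \<open>x\<close>. That the sum forgets the sequence
  makes the threshold computable; the factor \<open>c\<close> per step, forced by normalizing the
  rows, is positive and leaves signs intact. The option to give up supplies the one nonlinearity: a
  linear reward would have second difference 0, and the initial values could not enter. The loop at
  the start puts the tests for all \<open>n\<close> into one process; each weight is reached with
  positive probability, so one negative term already yields a strict gain. The bound against
  arbitrary schedulers uses only the positive part of the reward and a non-negative superharmonic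
  function, so no signed limits occur. The policy that profits from a negative term is evaluated
  with a finite horizon; values grow linearly in the weight, whereas the loop lasts up to weight
  \<open>N\<close> with probability \<open>1 / 2 ^ N\<close>, so the error vanishes.\<close>

definition hist_of :: "(nat \<times> nat) option list \<Rightarrow> path" where
  "hist_of l = map the (takeWhile (\<lambda>x. x \<noteq> None) l)"

lemma history_eq_hist_of: "history n \<omega> = hist_of (map \<omega> [0..<n])"
  by (simp add: history_def hist_of_def)

primrec prefix_pmf :: "mdp \<Rightarrow> scheduler \<Rightarrow> nat \<Rightarrow> (nat \<times> nat) option list pmf" where
  "prefix_pmf M \<SS> 0 = return_pmf []"
| "prefix_pmf M \<SS> (Suc n) =
     bind_pmf (prefix_pmf M \<SS> n) (\<lambda>l. map_pmf (\<lambda>x. l @ [x]) (step_pmf M \<SS> (hist_of l)))"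

text \<open>Composing with the next kernel appends one entry, and that kernel depends on the past
  only through \<open>history\<close>, hence only through the list of entries so far.\<close>

lemma nn_integral_C_prefix:
  "(\<integral>\<^sup>+\<omega>. f (map \<omega> [0..<n]) \<partial>Ionescu_Tulcea.C (step_kernel M \<SS>) (\<lambda>_. count_space UNIV) 0 n (\<lambda>_. undefined))
     = (\<integral>\<^sup>+l. f l \<partial>prefix_pmf M \<SS> n)"
proof -
  interpret Ionescu_Tulcea "step_kernel M \<SS>" "\<lambda>_. count_space UNIV"
    by (rule Ionescu_Tulcea_step_kernel)
  let ?P = "\<lambda>n. Pi\<^sub>M {0..<n} (\<lambda>_. count_space (UNIV :: (nat \<times> nat) option set))"
  show ?thesis
  proof (induction n arbitrary: f)
    case 0
    show ?case
      by (simp add: nn_integral_return PiM_empty)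
  next
    case (Suc n)
    have meas: "(\<lambda>\<omega>. f (map \<omega> [0..<n])) \<in> borel_measurable (?P n)" for n and f :: "_ \<Rightarrow> ennreal"
      by (rule measurable_compose[OF measurable_map_upt_count_space]) auto
    have "(\<integral>\<^sup>+\<omega>. f (map \<omega> [0..<Suc n]) \<partial>C 0 (Suc n) (\<lambda>_. undefined))
        = (\<integral>\<^sup>+\<omega>. \<integral>\<^sup>+\<omega>'. f (map \<omega>' [0..<Suc n]) \<partial>eP n \<omega> \<partial>C 0 n (\<lambda>_. undefined))"
      using measurable_eP[of n] meas[of f "Suc n"]
      by (simp only: C.simps add_0)
         (subst nn_integral_bind[where B = "?P (Suc n)"],
           auto simp: measurable_cong_sets[OF sets_C refl] space_PiM)
    also have "\<dots> = (\<integral>\<^sup>+\<omega>. \<integral>\<^sup>+x. f (map \<omega> [0..<n] @ [x]) \<partial>step_pmf M \<SS> (hist_of (map \<omega> [0..<n]))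
        \<partial>C 0 n (\<lambda>_. undefined))"
    proof (rule nn_integral_cong)
      fix \<omega> assume "\<omega> \<in> space (C 0 n (\<lambda>_. undefined))"
      then have \<omega>: "\<omega> \<in> space (?P n)"
        by (subst (asm) space_C) (auto simp: space_PiM)
      have map_eq: "map (\<lambda>a. if a = n then x else \<omega> a) [0..<n] = map \<omega> [0..<n]" for x
        by auto
      show "(\<integral>\<^sup>+\<omega>'. f (map \<omega>' [0..<Suc n]) \<partial>eP n \<omega>)
          = (\<integral>\<^sup>+x. f (map \<omega> [0..<n] @ [x]) \<partial>step_pmf M \<SS> (hist_of (map \<omega> [0..<n])))"
        using meas[of f "Suc n"]
        by (subst nn_integral_eP[OF \<omega>])
           (simp_all add: step_kernel_def history_eq_hist_of fun_upd_def map_eq cong: map_cong)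
    qed
    also have "\<dots> = (\<integral>\<^sup>+l. f l \<partial>prefix_pmf M \<SS> (Suc n))"
      by (simp add: Suc.IH[of "\<lambda>l. \<integral>\<^sup>+x. f (l @ [x]) \<partial>step_pmf M \<SS> (hist_of l)"])
    finally show ?case .
  qed
qed

text \<open>Events about an initial segment are cylinder sets, on which the projective limit agrees
  with the finite composition \<open>C 0 n\<close> of kernels. From here on, expectations over
  infinite paths are computed with discrete distributions of lists.\<close>

lemma distr_path_measure:
  "distr (path_measure M \<SS>) (count_space UNIV) (\<lambda>\<omega>. map \<omega> [0..<n]) = measure_pmf (prefix_pmf M \<SS> n)"
proof (rule measure_eqI)
  interpret Ionescu_Tulcea "step_kernel M \<SS>" "\<lambda>_. count_space UNIV"
    by (rule Ionescu_Tulcea_step_kernel)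
  let ?P = "Pi\<^sub>M {0..<n} (\<lambda>_. count_space (UNIV :: (nat \<times> nat) option set))"
  fix A :: "(nat \<times> nat) option list set"
  define X where "X = (\<lambda>\<omega>. map \<omega> [0..<n]) -` A \<inter> space ?P"
  have X: "X \<in> sets ?P"
    unfolding X_def by (rule measurable_sets[OF measurable_map_upt_count_space]) auto
  have restr: "map (restrict \<omega> {0..<n}) [0..<n] = map \<omega> [0..<n]" for \<omega> :: mpath
    by (auto cong: map_cong)
  have "emeasure (distr (path_measure M \<SS>) (count_space UNIV) (\<lambda>\<omega>. map \<omega> [0..<n])) A
      = emeasure (path_measure M \<SS>) ((\<lambda>\<omega>. map \<omega> [0..<n]) -` A \<inter> space (path_measure M \<SS>))"
    by (rule emeasure_distr)
       (auto simp: measurable_cong_sets[OF sets_path_measure refl] measurable_map_upt_count_space)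
  also have "(\<lambda>\<omega>. map \<omega> [0..<n]) -` A \<inter> space (path_measure M \<SS>) = PF.emb UNIV {0..<n} X"
    unfolding X_def sets_eq_imp_space_eq[OF sets_path_measure]
    by (auto simp: prod_emb_def space_PiM restr)
  also have "emeasure (path_measure M \<SS>) \<dots> = emeasure (CI {0..<n}) X"
    unfolding path_measure_def using X by (intro lim) auto
  also have "\<dots> = emeasure (C 0 n (\<lambda>_. undefined)) (PF.emb {0..<n} {0..<n} X)"
    using X by (intro emeasure_CI) auto
  also have "PF.emb {0..<n} {0..<n} X = X"
    by (intro prod_emb_id) (auto simp: X_def space_PiM)
  also have "emeasure (C 0 n (\<lambda>_. undefined)) X = (\<integral>\<^sup>+\<omega>. indicator X \<omega> \<partial>C 0 n (\<lambda>_. undefined))"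
    using X by (subst nn_integral_indicator) (auto simp: sets_C space_PiM)
  also have "\<dots> = (\<integral>\<^sup>+\<omega>. indicator A (map \<omega> [0..<n]) \<partial>C 0 n (\<lambda>_. undefined))"
    by (rule nn_integral_cong) (auto simp: X_def space_C space_PiM split: split_indicator)
  also have "\<dots> = emeasure (prefix_pmf M \<SS> n) A"
    by (simp add: nn_integral_C_prefix)
  finally show "emeasure (distr (path_measure M \<SS>) (count_space UNIV) (\<lambda>\<omega>. map \<omega> [0..<n])) A
      = emeasure (prefix_pmf M \<SS> n) A" .
qed simp

lemma measurable_prefix [measurable]:
  "(\<lambda>\<omega>. map \<omega> [0..<n]) \<in> measurable (path_measure M \<SS>) (count_space UNIV)"
  by (auto simp: measurable_cong_sets[OF sets_path_measure refl] measurable_map_upt_count_space)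

lemma nn_integral_path_measure_prefix:
  "(\<integral>\<^sup>+\<omega>. f (map \<omega> [0..<n]) \<partial>path_measure M \<SS>) = (\<integral>\<^sup>+l. f l \<partial>prefix_pmf M \<SS> n)"
  unfolding distr_path_measure[symmetric] by (subst nn_integral_distr) auto

text \<open>The space of all sequences does not enforce the rules of the process; the supports do.
  In particular, almost surely only \<open>None\<close> follows the arrival in a terminal
  state.\<close>

lemma AE_path_measure_prefix:
  "AE \<omega> in path_measure M \<SS>. \<forall>n. map \<omega> [0..<n] \<in> set_pmf (prefix_pmf M \<SS> n)"
proof -
  have "AE \<omega> in path_measure M \<SS>. map \<omega> [0..<n] \<in> set_pmf (prefix_pmf M \<SS> n)" for n
  proof -
    have "AE l in distr (path_measure M \<SS>) (count_space UNIV) (\<lambda>\<omega>. map \<omega> [0..<n]).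
            l \<in> set_pmf (prefix_pmf M \<SS> n)"
      unfolding distr_path_measure by (rule AE_pmfI)
    then show ?thesis
      by (subst (asm) AE_distr_iff) auto
  qed
  then show ?thesis
    by (simp add: AE_all_countable)
qed

section \<open>One-step expectations along histories\<close>

lemma hist_of_snoc:
  "hist_of (l @ [x]) =
     (if None \<in> set l then hist_of l else case x of None \<Rightarrow> hist_of l | Some y \<Rightarrow> hist_of l @ [y])"
proof (cases "None \<in> set l")
  case True
  then show ?thesis
    by (auto simp: hist_of_def takeWhile_append1)
next
  case False
  then have "x \<noteq> None" if "x \<in> set l" for x
    using that by metis
  then have "takeWhile (\<lambda>x. x \<noteq> None) (l @ [x]) = l @ takeWhile (\<lambda>x. x \<noteq> None) [x]"
    "takeWhile (\<lambda>x. x \<noteq> None) l = l"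
    by (rule takeWhile_append2, simp, subst takeWhile_eq_all_conv, simp)
  with False show ?thesis
    by (cases x) (simp_all only: hist_of_def, simp_all)
qed

lemma last_state_Nil [simp]: "last_state M [] = init M"
  by (simp add: last_state_def)

lemma last_state_snoc [simp]: "last_state M (h @ [(a, t)]) = t"
  by (simp add: last_state_def)

lemma path_from_append:
  "path_from M s (h @ h') \<longleftrightarrow> path_from M s h \<and> path_from M (if h = [] then s else snd (last h)) h'"
  by (induction h arbitrary: s) (auto split: prod.splits if_splits)

lemma path_from_snoc:
  "path_from M (init M) (h @ [(a, t)]) \<longleftrightarrow>
     path_from M (init M) h \<and> a \<in> enabled M (last_state M h) \<and> t < nstates M \<and>
     prob M (last_state M h) a t > 0"
  by (simp add: path_from_append last_state_def)

lemma path_weight_append: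
  "path_weight M s (h @ h') =
     path_weight M s h + path_weight M (if h = [] then s else snd (last h)) h'"
  by (induction h arbitrary: s) (auto split: prod.splits if_splits)

lemma path_weight_snoc:
  "path_weight M (init M) (h @ [(a, t)]) = path_weight M (init M) h + wgt M (last_state M h) a"
  by (simp add: path_weight_append last_state_def)

lemma last_state_less:
  assumes "wf_mdp M" "path_from M (init M) h"
  shows "last_state M h < nstates M"
  using assms by (cases h rule: rev_cases) (auto simp: path_from_snoc wf_mdp_def)

lemma set_trans_pmf:
  assumes "wf_mdp M" "s < nstates M" "a \<in> enabled M s" "t \<in> set_pmf (trans_pmf M s a)"
  shows "t < nstates M \<and> prob M s a t > 0"
  using assms pmf_trans_pmf[OF assms(1-3), of t]
  by (auto simp: set_pmf_iff wf_mdp_def enabled_def order_less_le split: if_splits)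

lemma nn_integral_trans_pmf:
  assumes "wf_mdp M" "s < nstates M" "a \<in> enabled M s"
  shows "(\<integral>\<^sup>+t. f t \<partial>trans_pmf M s a) = (\<Sum>t<nstates M. ennreal (real_of_rat (prob M s a t)) * f t)"
proof -
  have "(\<integral>\<^sup>+t. f t \<partial>trans_pmf M s a) = (\<integral>\<^sup>+t. ennreal (pmf (trans_pmf M s a) t) * f t \<partial>count_space UNIV)"
    by (rule nn_integral_measure_pmf)
  also have "\<dots> = (\<Sum>t<nstates M. ennreal (pmf (trans_pmf M s a) t) * f t)"
    by (rule nn_integral_count_space') (auto simp: pmf_trans_pmf[OF assms])
  finally show ?thesis
    by (simp add: pmf_trans_pmf[OF assms])
qed

definition extend_history :: "path \<Rightarrow> (nat \<times> nat) option \<Rightarrow> path" where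
  "extend_history h x = (case x of None \<Rightarrow> h | Some y \<Rightarrow> h @ [y])"

lemma set_prefix_pmf:
  assumes "wf_mdp M" "is_scheduler M \<SS>" "l \<in> set_pmf (prefix_pmf M \<SS> n)"
  shows "path_from M (init M) (hist_of l) \<and>
         (None \<in> set l \<longrightarrow> terminal M (last_state M (hist_of l)))"
  using assms(3)
proof (induction n arbitrary: l)
  case 0
  then show ?case by (simp add: hist_of_def)
next
  case (Suc n)
  then obtain l' x where l: "l = l' @ [x]" "l' \<in> set_pmf (prefix_pmf M \<SS> n)"
    "x \<in> set_pmf (step_pmf M \<SS> (hist_of l'))"
    by auto
  note IH = Suc.IH[OF l(2)]
  show ?case
  proof (cases "terminal M (last_state M (hist_of l'))")
    case True
    with l have "x = None"
      by (simp add: step_pmf_def)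
    with IH l True show ?thesis
      by (simp add: hist_of_snoc)
  next
    case False
    with IH have "None \<notin> set l'"
      by blast
    from False l(3) obtain a t where x: "x = Some (a, t)" "a \<in> set_pmf (\<SS> (hist_of l'))"
      "t \<in> set_pmf (trans_pmf M (last_state M (hist_of l')) a)"
      by (auto simp: step_pmf_def)
    with False IH assms(2) have "a \<in> enabled M (last_state M (hist_of l'))"
      by (auto simp: is_scheduler_def)
    with set_trans_pmf[OF assms(1) last_state_less[OF assms(1)] this x(3)] IH x \<open>None \<notin> set l'\<close> l
    show ?thesis
      by (auto simp: hist_of_snoc path_from_snoc)
  qed
qed

text \<open>Once \<open>None\<close> has occurred, the state is terminal and the next entry is
  \<open>None\<close> again, so appending an entry and extending the history agree there
  too.\<close>

lemma nn_integral_prefix_pmf_Suc: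
  assumes "wf_mdp M" "is_scheduler M \<SS>"
  shows "(\<integral>\<^sup>+l. f (hist_of l) \<partial>prefix_pmf M \<SS> (Suc n)) =
    (\<integral>\<^sup>+l. \<integral>\<^sup>+x. f (extend_history (hist_of l) x) \<partial>step_pmf M \<SS> (hist_of l) \<partial>prefix_pmf M \<SS> n)"
proof -
  have "(\<integral>\<^sup>+x. f (hist_of (l @ [x])) \<partial>step_pmf M \<SS> (hist_of l)) =
        (\<integral>\<^sup>+x. f (extend_history (hist_of l) x) \<partial>step_pmf M \<SS> (hist_of l))"
    if "l \<in> set_pmf (prefix_pmf M \<SS> n)" for l
    using set_prefix_pmf[OF assms that]
    by (cases "None \<in> set l") (simp_all add: step_pmf_def hist_of_snoc extend_history_def)
  then show ?thesis
    by simp (rule nn_integral_cong_AE, rule AE_pmfI, simp)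
qed

lemma nn_integral_step_pmf:
  assumes "wf_mdp M" "is_scheduler M \<SS>" "path_from M (init M) h" "\<not> terminal M (last_state M h)"
  shows "(\<integral>\<^sup>+x. f (extend_history h x) \<partial>step_pmf M \<SS> h) =
    (\<integral>\<^sup>+a. (\<Sum>t<nstates M. ennreal (real_of_rat (prob M (last_state M h) a t)) * f (h @ [(a, t)])) \<partial>\<SS> h)"
proof -
  have "set_pmf (\<SS> h) \<subseteq> enabled M (last_state M h)"
    using assms by (auto simp: is_scheduler_def)
  then show ?thesis
    using assms nn_integral_trans_pmf[OF assms(1) last_state_less[OF assms(1,3)]]
    by (auto simp: step_pmf_def extend_history_def intro!: nn_integral_cong_AE AE_pmfI)
qed

section \<open>Bounds by potentials over finite horizons\<close>

definition eval_path :: "mdp \<Rightarrow> (nat \<Rightarrow> int \<Rightarrow> ennreal) \<Rightarrow> path \<Rightarrow> ennreal" where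
  "eval_path M \<Phi> h = \<Phi> (last_state M h) (path_weight M (init M) h)"

text \<open>A non-negative function of state and weight that does not increase in expectation is a
  supermartingale along the process. The hypothesis is restricted to actions in the support of
  \<open>\<SS> h\<close>; thus the lemma serves both the bound over all schedulers and the proof
  that one particular policy never collects negative weight.\<close>

lemma nn_integral_prefix_le:
  assumes "wf_mdp M" "is_scheduler M \<SS>"
  assumes super: "\<And>h s w a. s = last_state M h \<Longrightarrow> w = path_weight M (init M) h \<Longrightarrow> s < nstates M \<Longrightarrow>
    a \<in> enabled M s \<Longrightarrow> a \<in> set_pmf (\<SS> h) \<Longrightarrow>
    (\<Sum>t<nstates M. ennreal (real_of_rat (prob M s a t)) * \<Phi> t (w + wgt M s a)) \<le> \<Phi> s w"
  shows "(\<integral>\<^sup>+l. eval_path M \<Phi> (hist_of l) \<partial>prefix_pmf M \<SS> n) \<le> \<Phi> (init M) 0"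
proof (induction n)
  case 0
  show ?case by (simp add: eval_path_def hist_of_def)
next
  case (Suc n)
  have "(\<integral>\<^sup>+x. eval_path M \<Phi> (extend_history h x) \<partial>step_pmf M \<SS> h) \<le> eval_path M \<Phi> h"
    if h: "path_from M (init M) h" for h
  proof (cases "terminal M (last_state M h)")
    case True
    then show ?thesis
      by (simp add: step_pmf_def extend_history_def)
  next
    case False
    from assms(2) h False have "set_pmf (\<SS> h) \<subseteq> enabled M (last_state M h)"
      by (auto simp: is_scheduler_def)
    then have "(\<Sum>t<nstates M. ennreal (real_of_rat (prob M (last_state M h) a t)) * eval_path M \<Phi> (h @ [(a, t)]))
        \<le> eval_path M \<Phi> h" if "a \<in> set_pmf (\<SS> h)" for a
      using that super[OF refl refl last_state_less[OF assms(1) h], of a]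
      by (auto simp: eval_path_def path_weight_snoc)
    then have "(\<integral>\<^sup>+x. eval_path M \<Phi> (extend_history h x) \<partial>step_pmf M \<SS> h)
        \<le> (\<integral>\<^sup>+a. eval_path M \<Phi> h \<partial>\<SS> h)"
      by (subst nn_integral_step_pmf[OF assms(1,2) h False], intro nn_integral_mono_AE AE_pmfI)
    then show ?thesis
      by (simp add: measure_pmf.emeasure_space_1)
  qed
  then have "(\<integral>\<^sup>+l. eval_path M \<Phi> (hist_of l) \<partial>prefix_pmf M \<SS> (Suc n))
      \<le> (\<integral>\<^sup>+l. eval_path M \<Phi> (hist_of l) \<partial>prefix_pmf M \<SS> n)"
    unfolding nn_integral_prefix_pmf_Suc[OF assms(1,2)]
    using set_prefix_pmf[OF assms(1,2)] by (auto intro!: nn_integral_mono_AE AE_pmfI)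
  also note Suc.IH
  finally show ?case .
qed

definition memoryless :: "mdp \<Rightarrow> (nat \<Rightarrow> int \<Rightarrow> nat) \<Rightarrow> scheduler" where
  "memoryless M \<pi> h = return_pmf (\<pi> (last_state M h) (path_weight M (init M) h))"

lemma is_scheduler_memoryless:
  assumes "wf_mdp M" "\<And>s w. s < nstates M \<Longrightarrow> \<not> terminal M s \<Longrightarrow> \<pi> s w \<in> enabled M s"
  shows "is_scheduler M (memoryless M \<pi>)"
  using assms by (auto simp: is_scheduler_def memoryless_def last_state_less)

text \<open>The index of \<open>F\<close> counts the remaining steps.\<close>

lemma nn_integral_prefix_memoryless_ge:
  assumes "wf_mdp M" and \<pi>: "\<And>s w. s < nstates M \<Longrightarrow> \<not> terminal M s \<Longrightarrow> \<pi> s w \<in> enabled M s"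
  assumes sub: "\<And>m s w. s < nstates M \<Longrightarrow> \<not> terminal M s \<Longrightarrow>
    F (Suc m) s w \<le> (\<Sum>t<nstates M. ennreal (real_of_rat (prob M s (\<pi> s w) t)) * F m t (w + wgt M s (\<pi> s w)))"
  assumes fin: "\<And>m s w. s < nstates M \<Longrightarrow> terminal M s \<Longrightarrow> F (Suc m) s w \<le> F m s w"
  shows "F (m + n) (init M) 0 \<le> (\<integral>\<^sup>+l. eval_path M (F m) (hist_of l) \<partial>prefix_pmf M (memoryless M \<pi>) n)"
proof (induction n arbitrary: m)
  case 0
  show ?case by (simp add: eval_path_def hist_of_def)
next
  case (Suc n)
  have sched: "is_scheduler M (memoryless M \<pi>)"
    using assms(1) \<pi> by (rule is_scheduler_memoryless)
  have "eval_path M (F (Suc m)) h \<le> (\<integral>\<^sup>+x. eval_path M (F m) (extend_history h x) \<partial>step_pmf M (memoryless M \<pi>) h)"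
    if h: "path_from M (init M) h" for h
  proof (cases "terminal M (last_state M h)")
    case True
    then show ?thesis
      using fin[OF last_state_less[OF assms(1) h] True]
      by (simp add: step_pmf_def extend_history_def eval_path_def)
  next
    case False
    then show ?thesis
      using sub[OF last_state_less[OF assms(1) h] False]
      by (subst nn_integral_step_pmf[OF assms(1) sched h False])
         (auto simp: memoryless_def eval_path_def path_weight_snoc)
  qed
  then have "(\<integral>\<^sup>+l. eval_path M (F (Suc m)) (hist_of l) \<partial>prefix_pmf M (memoryless M \<pi>) n)
      \<le> (\<integral>\<^sup>+l. eval_path M (F m) (hist_of l) \<partial>prefix_pmf M (memoryless M \<pi>) (Suc n))"
    unfolding nn_integral_prefix_pmf_Suc[OF assms(1) sched]
    using set_prefix_pmf[OF assms(1) sched] by (auto intro!: nn_integral_mono_AE AE_pmfI)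
  with Suc.IH[of "Suc m"] show ?case
    by simp
qed

section \<open>The goal weight as a monotone limit\<close>

definition goal_reward :: "nat set \<Rightarrow> (real \<Rightarrow> ennreal) \<Rightarrow> nat \<Rightarrow> int \<Rightarrow> ennreal" where
  "goal_reward G \<phi> s w = (if s \<in> G then \<phi> (real_of_int w) else 0)"

lemma history_Suc_terminal:
  assumes "map \<omega> [0..<Suc n] \<in> set_pmf (prefix_pmf M \<SS> (Suc n))"
    and "terminal M (last_state M (history n \<omega>))"
  shows "history (Suc n) \<omega> = history n \<omega>"
proof -
  from assms(1) obtain l x where "map \<omega> [0..<n] @ [\<omega> n] = l @ [x]"
    "x \<in> set_pmf (step_pmf M \<SS> (hist_of l))"
    by (auto simp del: append1_eq_conv)
  then have "\<omega> n \<in> set_pmf (step_pmf M \<SS> (hist_of (map \<omega> [0..<n])))"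
    by auto
  with assms(2) have "\<omega> n = None"
    by (simp add: step_pmf_def history_eq_hist_of)
  then show ?thesis
    by (simp add: history_eq_hist_of hist_of_snoc)
qed

text \<open>Goal states are terminal, so the history is frozen after reaching one: the reward is 0
  before the first visit and constant from then on. A path that misses the goal has weight 0, in
  accordance with \<open>\<phi> 0 = 0\<close>. The function \<open>\<phi>\<close> stands for the
  positive or the negative part.\<close>

lemma goal_weight_eq_SUP:
  assumes G: "G \<subseteq> {s. terminal M s}" and [simp]: "\<phi> 0 = 0"
    and supp: "\<forall>n. map \<omega> [0..<n] \<in> set_pmf (prefix_pmf M \<SS> n)"
  shows "\<phi> (goal_weight M G \<omega>) = (SUP n. eval_path M (goal_reward G \<phi>) (history n \<omega>))"
    and "eval_path M (goal_reward G \<phi>) (history n \<omega>) \<le> eval_path M (goal_reward G \<phi>) (history (Suc n) \<omega>)"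
proof -
  have stay: "history (Suc n) \<omega> = history n \<omega>" if "last_state M (history n \<omega>) \<in> G" for n
    using supp G that by (intro history_Suc_terminal[of _ _ M \<SS>]) (blast+)
  then show "eval_path M (goal_reward G \<phi>) (history n \<omega>) \<le> eval_path M (goal_reward G \<phi>) (history (Suc n) \<omega>)"
    by (cases "last_state M (history n \<omega>) \<in> G") (auto simp: eval_path_def goal_reward_def)
  show "\<phi> (goal_weight M G \<omega>) = (SUP n. eval_path M (goal_reward G \<phi>) (history n \<omega>))"
  proof (cases "\<exists>n. last_state M (history n \<omega>) \<in> G")
    case False
    then show ?thesis
      by (simp add: goal_weight_def eval_path_def goal_reward_def)
  next
    case True
    define L where "L = (LEAST n. last_state M (history n \<omega>) \<in> G)"
    from True have L: "last_state M (history L \<omega>) \<in> G"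
      unfolding L_def by (rule LeastI_ex)
    have less: "last_state M (history n \<omega>) \<notin> G" if "n < L" for n
      using that unfolding L_def by (rule not_less_Least)
    have stable: "history (L + d) \<omega> = history L \<omega>" for d
    proof (induction d)
      case (Suc d)
      with L stay[of "L + d"] show ?case
        by simp
    qed simp
    have later: "history n \<omega> = history L \<omega>" if "n \<ge> L" for n
      using stable[of "n - L"] that by simp
    have "eval_path M (goal_reward G \<phi>) (history n \<omega>) =
        (if n \<ge> L then \<phi> (path_weight M (init M) (history L \<omega>)) else 0)" for n
      using L less[of n] later[of n] by (cases "L \<le> n") (simp_all add: eval_path_def goal_reward_def)
    then have "(SUP n. eval_path M (goal_reward G \<phi>) (history n \<omega>)) = \<phi> (path_weight M (init M) (history L \<omega>))"
      by (simp only:) (rule antisym, rule SUP_least, simp, rule SUP_upper2[of L], simp_all)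
    with True show ?thesis
      by (simp add: goal_weight_def L_def)
  qed
qed

text \<open>Monotone convergence along these rewards reduces expectations of the goal weight to
  finite horizons, where the bounds by potentials apply.\<close>

lemma nn_integral_goal_weight:
  assumes G: "G \<subseteq> {s. terminal M s}" and "\<phi> 0 = 0"
  shows "(\<integral>\<^sup>+\<omega>. \<phi> (goal_weight M G \<omega>) \<partial>path_measure M \<SS>) =
    (SUP n. \<integral>\<^sup>+l. eval_path M (goal_reward G \<phi>) (hist_of l) \<partial>prefix_pmf M \<SS> n)"
proof -
  let ?E = "\<lambda>n \<omega>. eval_path M (goal_reward G \<phi>) (history n \<omega>)"
  have "(\<integral>\<^sup>+\<omega>. \<phi> (goal_weight M G \<omega>) \<partial>path_measure M \<SS>) = (\<integral>\<^sup>+\<omega>. (SUP n. ?E n \<omega>) \<partial>path_measure M \<SS>)"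
    by (rule nn_integral_cong_AE, rule AE_mp[OF AE_path_measure_prefix])
       (auto intro!: AE_I2 goal_weight_eq_SUP(1)[of G M \<phi>, OF assms])
  also have "\<dots> = (SUP n. \<integral>\<^sup>+\<omega>. ?E n \<omega> \<partial>path_measure M \<SS>)"
  proof (rule nn_integral_monotone_convergence_SUP_AE)
    show "AE \<omega> in path_measure M \<SS>. ?E n \<omega> \<le> ?E (Suc n) \<omega>" for n
      by (rule AE_mp[OF AE_path_measure_prefix])
         (auto intro!: AE_I2 goal_weight_eq_SUP(2)[of G M \<phi>, OF assms])
    show "?E n \<in> borel_measurable (path_measure M \<SS>)" for n
      unfolding history_eq_hist_of
      by (rule measurable_compose[OF measurable_prefix]) auto
  qed
  finally show ?thesis
    unfolding history_eq_hist_of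
    by (simp only: nn_integral_path_measure_prefix[where f = "\<lambda>l. eval_path M (goal_reward G \<phi>) (hist_of l)"])
qed

section \<open>The Markov decision process\<close>

text \<open>Companion matrix of the recurrence, acting on windows of \<open>k\<close> consecutive
  terms; the last row holds the coefficients in reversed order.\<close>

definition companion :: "rat list \<Rightarrow> nat \<Rightarrow> nat \<Rightarrow> rat" where
  "companion \<alpha> j l =
     (if Suc j = length \<alpha> then \<alpha> ! (length \<alpha> - Suc l) else if l = Suc j then 1 else 0)"

definition gadget_coeff :: "rat list \<Rightarrow> rat list \<Rightarrow> nat \<Rightarrow> nat \<Rightarrow> rat" where
  "gadget_coeff \<alpha> \<beta> s t =
     (if t < 6 then \<beta> ! ((s - 6) div 2) else companion \<alpha> ((s - 6) div 2) ((t - 6) div 2))"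

text \<open>The multiplicities 1, 2, 1 of the states 2, 3, 4, with signs given by the parity of the
  state, are the weights 1, -2, 1 of a second difference. Together with the \<open>2 * k\<close>
  twins they give a row the total \<open>2 * (k + 2)\<close> in units of \<open>B\<close>.\<close>

definition gadget_mult :: "nat \<Rightarrow> nat" where
  "gadget_mult t = (if t \<in> {0, 1, 5} then 0 else if t = 3 then 2 else 1)"

text \<open>The parity of \<open>s + t\<close> flips the sign between twins as sources and between
  twins as targets, so differences of values are mapped to differences. Within each row the signed
  parts cancel, which makes the row sum 1.\<close>

definition gadget_prob :: "rat list \<Rightarrow> rat list \<Rightarrow> nat \<Rightarrow> nat \<Rightarrow> nat \<Rightarrow> nat \<Rightarrow> rat" where
  "gadget_prob \<alpha> \<beta> B s a t =
     (if s = 0 then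
        (if t = 0 then 1/2 else if t = 6 then (1 - of_nat a) / 4 else if t = 7 then (1 + of_nat a) / 4 else 0)
      else if s \<in> {2, 3, 4} then (if t = 5 - 4 * a then 1 else 0)
      else if s < 6 then 0
      else of_nat (gadget_mult t) *
        (of_nat B + (if even (s + t) then gadget_coeff \<alpha> \<beta> s t else - gadget_coeff \<alpha> \<beta> s t)) /
        of_nat (2 * (length \<alpha> + 2) * B))"

definition gadget_wgt :: "nat \<Rightarrow> int" where
  "gadget_wgt s = (if s = 0 then 1 else if s \<in> {2, 3, 4} then int s - 3 else if s < 6 then 0 else - 1)"

definition gadget_threshold :: "nat \<Rightarrow> rat" where
  "gadget_threshold k = 9 / (2 * (of_nat k + 4))"

lemma lrs_companion:
  assumes "j < length \<alpha>"
  shows "(\<Sum>l<length \<alpha>. companion \<alpha> j l * lrs \<alpha> \<beta> (n + l)) = lrs \<alpha> \<beta> (Suc (n + j))"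
proof (cases "Suc j = length \<alpha>")
  case True
  let ?k = "length \<alpha>"
  have "lrs \<alpha> \<beta> (Suc (n + j)) = (\<Sum>i<?k. \<alpha> ! i * lrs \<alpha> \<beta> (n + ?k - Suc i))"
    using True by (subst lrs.simps) (simp flip: add_Suc_right)
  also have "\<dots> = (\<Sum>i<?k. \<alpha> ! (?k - Suc i) * lrs \<alpha> \<beta> (n + ?k - Suc (?k - Suc i)))"
    by (rule sum.nat_diff_reindex[symmetric])
  also have "\<dots> = (\<Sum>l<?k. companion \<alpha> j l * lrs \<alpha> \<beta> (n + l))"
    using True by (intro sum.cong) (auto simp: companion_def intro!: arg_cong[of _ _ "lrs \<alpha> \<beta>"])
  finally show ?thesis ..
next
  case False
  then have "(\<Sum>l<length \<alpha>. companion \<alpha> j l * lrs \<alpha> \<beta> (n + l)) =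
      (\<Sum>l<length \<alpha>. if l = Suc j then lrs \<alpha> \<beta> (n + l) else 0)"
    by (intro sum.cong) (auto simp: companion_def)
  with False assms show ?thesis
    by (simp add: sum.delta)
qed

section \<open>Sums over the states and closed forms of values\<close>

lemma sum_gadget_states:
  fixes f :: "nat \<Rightarrow> 'a :: comm_monoid_add"
  shows "(\<Sum>t<2 * k + 6. f t) = f 0 + f 1 + f 2 + f 3 + f 4 + f 5 + (\<Sum>l<k. f (6 + 2 * l) + f (7 + 2 * l))"
proof (induction k)
  case 0
  show ?case by (simp add: numeral_eq_Suc)
next
  case (Suc k)
  have "{..<2 * Suc k + 6} = insert (7 + 2 * k) (insert (6 + 2 * k) {..<2 * k + 6})"
    by auto
  with Suc show ?case
    by (simp add: algebra_simps)
qed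

text \<open>Sum of the values of two twins at weight \<open>n\<close>, the same for all pairs. The
  three summands besides the recursive one are the values of the states 4, 3, 2 after the weight has
  dropped to \<open>n\<close>; truncated subtraction in \<open>n - 1\<close> accounts for giving
  up.\<close>

fun sum_value :: "nat \<Rightarrow> nat \<Rightarrow> real" where
  "sum_value k 0 = 0"
| "sum_value k (Suc n) = (real k * sum_value k n + real (n + 1) + 2 * real n + real (n - 1)) / (real k + 2)"

lemma sum_value_nonneg: "sum_value k n \<ge> 0"
  by (induction n) auto

lemma sum_value_le: "sum_value k n \<le> 4 * real n"
proof (induction n)
  case (Suc n)
  have "real k * sum_value k n + real (n + 1) + 2 * real n + real (n - 1) \<le> real k * (4 * real n) + 4 * real n + 1"
    using mult_left_mono[OF Suc, of "real k"] by (cases n) auto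
  also have "\<dots> \<le> 4 * real (Suc n) * (real k + 2)"
    by (simp add: algebra_simps)
  finally have "real k * sum_value k n + real (n + 1) + 2 * real n + real (n - 1) \<le> 4 * real (Suc n) * (real k + 2)" .
  then show ?case
    by (simp only: sum_value.simps divide_le_eq) simp
qed simp

text \<open>Value of the initial state at weight \<open>n\<close> if the mixture is always chosen.
  All solutions of the recurrence \<open>start_value_rec\<close> differ by multiples of
  \<open>2 ^ n\<close>; linear growth singles this one out. The extra 1 at \<open>n = 0\<close>
  reflects that \<open>(k + 2) * sum_value k (n + 1) - k * sum_value k n\<close> is
  \<open>4 * n\<close>, except for the value 1 at \<open>n = 0\<close>.\<close>

definition start_value :: "nat \<Rightarrow> nat \<Rightarrow> real" where
  "start_value k n = (real k * sum_value k n + 8 * (real n + 1) + (if n = 0 then 1 else 0)) / (2 * (real k + 4))"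

lemma start_value_nonneg: "start_value k n \<ge> 0"
  by (simp add: start_value_def sum_value_nonneg)

lemma start_value_0: "start_value k 0 = real_of_rat (gadget_threshold k)"
  by (simp add: start_value_def gadget_threshold_def of_rat_divide of_rat_mult of_rat_add)

text \<open>The loop is left with probability 1/2, and a fair mixture of twins is worth half the sum
  of their values, whence the factor 1/4.\<close>

lemma start_value_rec: "start_value k n = start_value k (Suc n) / 2 + sum_value k (Suc n) / 4"
proof -
  define v where "v = sum_value k (Suc n)"
  define K where "K = 2 * (real k + 4)"
  have "K > 0"
    unfolding K_def by (simp add: add_nonneg_pos)
  then have pos: "K \<noteq> 0"
    by simp
  have "(real k + 2) * v = real k * sum_value k n + 4 * real n + (if n = 0 then 1 else 0)"
    unfolding v_def by (cases n) auto
  then have "start_value k n = ((real k + 2) * v + 4 * real n + 8) / K"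
    by (simp add: start_value_def algebra_simps K_def)
  also have "(real k + 2) * v + 4 * real n + 8 = (real k * v + 8 * (real (Suc n) + 1)) / 2 + v / 4 * K"
    by (simp add: field_simps K_def)
  also have "\<dots> / K = (real k * v + 8 * (real (Suc n) + 1)) / K / 2 + v / 4"
    using pos by (simp add: add_divide_distrib)
  also have "\<dots> = start_value k (Suc n) / 2 + v / 4"
    by (simp add: start_value_def v_def K_def del: sum_value.simps)
  finally show ?thesis
    by (simp only: v_def)
qed

text \<open>Linear growth suffices later: the loop reaches weight \<open>N\<close> only with
  probability \<open>1 / 2 ^ N\<close>, so cutting it off there costs an amount tending to
  0.\<close>

lemma start_value_le: "start_value k n \<le> 3 * real n + 2"
proof -
  have "real k * sum_value k n + 8 * (real n + 1) + (if n = 0 then 1 else 0) \<le> (3 * real n + 2) * (2 * (real k + 4))"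
  proof -
    have "real k * sum_value k n \<le> 4 * (real k * real n)"
      using mult_left_mono[OF sum_value_le[of k n], of "real k"] by simp
    then have "real k * sum_value k n + 8 * (real n + 1) + (if n = 0 then 1 else 0) \<le>
        6 * (real k * real n) + 24 * real n + 4 * real k + 16"
      by (auto intro: order.trans)
    also have "\<dots> = (3 * real n + 2) * (2 * (real k + 4))"
      by (simp add: algebra_simps)
    finally show ?thesis .
  qed
  then show ?thesis
    by (simp add: start_value_def divide_le_eq)
qed

text \<open>Truncating negative reals to 0 is subadditive. The function \<open>f\<close> may take
  negative values, because \<open>lower\<close> contains differences that are not shown to be
  non-negative.\<close>

lemma ennreal_sum_le:
  fixes p f :: "'a \<Rightarrow> real"
  assumes "\<And>t. t \<in> A \<Longrightarrow> p t \<ge> 0"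
  shows "ennreal (\<Sum>t\<in>A. p t * f t) \<le> (\<Sum>t\<in>A. ennreal (p t) * ennreal (f t))"
  using assms
proof (induction A rule: infinite_finite_induct)
  case (insert x F)
  have "ennreal (p x * f x + (\<Sum>t\<in>F. p t * f t)) \<le> ennreal (p x * f x) + ennreal (\<Sum>t\<in>F. p t * f t)"
    by (simp add: ennreal_def plus_ennreal.abs_eq eq_onp_def less_eq_ennreal.abs_eq max_def)
  also have "\<dots> \<le> ennreal (p x) * ennreal (f x) + (\<Sum>t\<in>F. ennreal (p t) * ennreal (f t))"
    using insert by (intro add_mono) (auto simp: ennreal_mult')
  finally show ?case
    using insert by simp
qed auto

text \<open>The components of \<open>M\<close> are constrained only within the index ranges, since
  an encoded word determines an MDP only there.\<close>

locale gadget =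
  fixes \<alpha> \<beta> :: "rat list" and B :: nat and M :: mdp
  assumes length_ge: "length \<alpha> \<ge> 2" and length_eq: "length \<beta> = length \<alpha>"
    and B_pos: "B > 0" and B_bound: "\<And>x. x \<in> set \<alpha> \<union> set \<beta> \<Longrightarrow> \<bar>x\<bar> \<le> of_nat B"
    and nstates: "nstates M = 2 * length \<alpha> + 6" and nacts: "nacts M = 2" and init: "init M = 0"
    and wgt: "\<And>s a. s < nstates M \<Longrightarrow> a < 2 \<Longrightarrow> wgt M s a = gadget_wgt s"
    and prob: "\<And>s a t. s < nstates M \<Longrightarrow> a < 2 \<Longrightarrow> t < nstates M \<Longrightarrow> prob M s a t = gadget_prob \<alpha> \<beta> B s a t"
begin

section \<open>Well-formedness of the process\<close>

abbreviation "k \<equiv> length \<alpha>"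

lemma gadget_coeff_le:
  assumes "6 \<le> s" "s < nstates M" "t < nstates M"
  shows "\<bar>gadget_coeff \<alpha> \<beta> s t\<bar> \<le> of_nat B"
proof -
  \<comment> \<open>The second fact covers the entries 1 of the companion matrix.\<close>
  have "(s - 6) div 2 < k" "1 \<le> (of_nat B :: rat)"
    using assms nstates B_pos by auto
  then have "\<bar>\<beta> ! ((s - 6) div 2)\<bar> \<le> of_nat B"
    using length_eq by (intro B_bound) simp
  moreover have "\<bar>\<alpha> ! (k - Suc l)\<bar> \<le> of_nat B" for l
    using length_ge by (intro B_bound) simp
  ultimately show ?thesis
    using \<open>1 \<le> of_nat B\<close> by (simp add: gadget_coeff_def companion_def)
qed

lemma gadget_prob_nonneg:
  assumes "s < nstates M" "a < 2" "t < nstates M"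
  shows "gadget_prob \<alpha> \<beta> B s a t \<ge> 0"
proof (cases "s < 6")
  case True
  then show ?thesis
    using assms by (auto simp: gadget_prob_def)
next
  case False
  with gadget_coeff_le[of s t] assms
  have "0 \<le> of_nat B + gadget_coeff \<alpha> \<beta> s t \<and> 0 \<le> of_nat B - gadget_coeff \<alpha> \<beta> s t"
    by (auto simp: abs_le_iff)
  with False show ?thesis
    by (auto simp: gadget_prob_def intro!: divide_nonneg_nonneg mult_nonneg_nonneg)
qed

text \<open>The first summand governs the sum of the values of twins, the second one their difference.\<close>

lemma sum_gadget_prob:
  fixes f :: "nat \<Rightarrow> 'a :: field_char_0"
  assumes "6 \<le> s" "s < nstates M"
  shows "(\<Sum>t<nstates M. of_rat (gadget_prob \<alpha> \<beta> B s a t) * f t) =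
    (f 2 + 2 * f 3 + f 4 + (\<Sum>l<k. f (6 + 2 * l) + f (7 + 2 * l))) / (2 * (of_nat k + 2)) +
    (- 1) ^ s * (of_rat (\<beta> ! ((s - 6) div 2)) * (f 2 - 2 * f 3 + f 4) +
       (\<Sum>l<k. of_rat (companion \<alpha> ((s - 6) div 2) l) * (f (6 + 2 * l) - f (7 + 2 * l)))) /
     (2 * (of_nat k + 2) * of_nat B)"
proof -
  define D :: 'a where "D = 2 * (of_nat k + 2) * of_nat B"
  define \<sigma> :: 'a where "\<sigma> = (- 1) ^ s"
  define b :: 'a where "b = of_rat (\<beta> ! ((s - 6) div 2))"
  define m :: "nat \<Rightarrow> 'a" where "m l = of_rat (companion \<alpha> ((s - 6) div 2) l)" for l
  define S1 where "S1 = (\<Sum>l<k. f (6 + 2 * l) + f (7 + 2 * l))"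
  define S2 where "S2 = (\<Sum>l<k. m l * (f (6 + 2 * l) - f (7 + 2 * l)))"
  define K :: 'a where "K = of_nat k + 2"
  have k2: "K \<noteq> 0"
    unfolding K_def by (metis of_nat_add of_nat_numeral of_nat_eq_0_iff add_is_0 zero_neq_numeral)
  with B_pos have D: "D \<noteq> 0"
    by (simp add: D_def flip: K_def)
  have D_eq: "(of_nat (2 * (k + 2) * B) :: 'a) = D"
    by (simp add: D_def algebra_simps)
  have p: "of_rat (gadget_prob \<alpha> \<beta> B s a t) =
      of_nat (gadget_mult t) * (of_nat B + (- 1) ^ (s + t) * of_rat (gadget_coeff \<alpha> \<beta> s t)) / D" for t
    using assms(1) D_eq
    by (simp add: gadget_prob_def of_rat_divide of_rat_mult of_rat_add of_rat_minus del: of_nat_mult of_nat_add)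
  have "(\<Sum>t<nstates M. of_rat (gadget_prob \<alpha> \<beta> B s a t) * f t) =
     (of_nat B + \<sigma> * b) / D * f 2 + 2 * (of_nat B - \<sigma> * b) / D * f 3 + (of_nat B + \<sigma> * b) / D * f 4 +
     (\<Sum>l<k. (of_nat B + \<sigma> * m l) / D * f (6 + 2 * l) + (of_nat B - \<sigma> * m l) / D * f (7 + 2 * l))"
    unfolding nstates sum_gadget_states p
    by (simp add: gadget_mult_def gadget_coeff_def power_add \<sigma>_def b_def m_def)
  also have "(\<Sum>l<k. (of_nat B + \<sigma> * m l) / D * f (6 + 2 * l) + (of_nat B - \<sigma> * m l) / D * f (7 + 2 * l)) =
     (\<Sum>l<k. of_nat B / D * (f (6 + 2 * l) + f (7 + 2 * l)) + \<sigma> / D * (m l * (f (6 + 2 * l) - f (7 + 2 * l))))"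
    using D by (intro sum.cong) (auto simp: field_simps)
  also have "\<dots> = of_nat B / D * S1 + \<sigma> / D * S2"
    by (subst sum.distrib) (simp only: sum_distrib_left S1_def S2_def)
  finally have "(\<Sum>t<nstates M. of_rat (gadget_prob \<alpha> \<beta> B s a t) * f t) =
      of_nat B / D * (f 2 + 2 * f 3 + f 4 + S1) + \<sigma> / D * (b * (f 2 - 2 * f 3 + f 4) + S2)"
    using D by (simp add: divide_simps) (simp add: algebra_simps)
  moreover have "of_nat B / D = 1 / (2 * (of_nat k + 2))"
    using B_pos k2 by (simp add: D_def flip: K_def)
  ultimately show ?thesis
    by (simp add: D_def \<sigma>_def b_def m_def S1_def S2_def)
qed

lemma sum_gadget_prob_start:
  fixes f :: "nat \<Rightarrow> 'a :: field_char_0"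
  assumes "a < 2"
  shows "(\<Sum>t<nstates M. of_rat (gadget_prob \<alpha> \<beta> B 0 a t) * f t) =
    f 0 / 2 + (1 - of_nat a) / 4 * f 6 + (1 + of_nat a) / 4 * f 7"
proof -
  have "(\<Sum>t<nstates M. of_rat (gadget_prob \<alpha> \<beta> B 0 a t) * f t) =
      (\<Sum>t\<in>{0, 6, 7}. of_rat (gadget_prob \<alpha> \<beta> B 0 a t) * f t)"
    using nstates length_ge by (intro sum.mono_neutral_right) (auto simp: gadget_prob_def)
  then show ?thesis
    by (simp add: gadget_prob_def of_rat_divide of_rat_diff of_rat_add)
qed

lemma sum_gadget_prob_stop:
  fixes f :: "nat \<Rightarrow> 'a :: field_char_0"
  assumes "a < 2" "s \<in> {2, 3, 4}"
  shows "(\<Sum>t<nstates M. of_rat (gadget_prob \<alpha> \<beta> B s a t) * f t) = (if a = 0 then f 5 else f 1)"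
proof -
  have "(\<Sum>t<nstates M. of_rat (gadget_prob \<alpha> \<beta> B s a t) * f t) =
      (\<Sum>t\<in>{5 - 4 * a}. of_rat (gadget_prob \<alpha> \<beta> B s a t) * f t)"
    using nstates assms by (intro sum.mono_neutral_right) (auto simp: gadget_prob_def)
  then show ?thesis
    using assms by (auto simp: gadget_prob_def less_2_cases_iff)
qed

lemma sum_gadget_prob_total:
  assumes "s < nstates M" "a < 2"
  shows "(\<Sum>t<nstates M. gadget_prob \<alpha> \<beta> B s a t) = (if s \<in> {1, 5} then 0 else 1)"
proof -
  \<comment> \<open>Row totals are weighted sums of the constant function 1, so the three evaluation
    lemmas apply; \<open>of_rat\<close> is the identity on \<open>rat\<close>.\<close>
  have eq: "(\<Sum>t<nstates M. gadget_prob \<alpha> \<beta> B s a t) = (\<Sum>t<nstates M. of_rat (gadget_prob \<alpha> \<beta> B s a t) * (1::rat))"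
    by (simp add: of_rat_def Fract_of_int_quotient flip: id_def)
  consider "s = 0" | "s \<in> {1, 5}" | "s \<in> {2, 3, 4}" | "6 \<le> s"
    by fastforce
  then show ?thesis
  proof cases
    case 1
    then show ?thesis
      unfolding eq using sum_gadget_prob_start[OF assms(2), of "\<lambda>_. 1 :: rat"] by (simp add: field_simps)
  next
    case 2
    then show ?thesis
      by (auto simp: gadget_prob_def)
  next
    case 3
    then show ?thesis
      unfolding eq using sum_gadget_prob_stop[OF assms(2) 3, of "\<lambda>_. 1 :: rat"] by auto
  next
    case 4
    have "(of_nat k + 2 :: rat) \<noteq> 0"
      by (metis of_nat_add of_nat_numeral of_nat_eq_0_iff add_is_0 zero_neq_numeral)
    with 4 show ?thesis
      unfolding eq using sum_gadget_prob[OF 4 assms(1), of a "\<lambda>_. 1 :: rat"] by (auto simp: field_simps)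
  qed
qed

lemma sum_prob_total:
  "s < nstates M \<Longrightarrow> a < 2 \<Longrightarrow> (\<Sum>t<nstates M. prob M s a t) = (if s \<in> {1, 5} then 0 else 1)"
  using sum_gadget_prob_total by (subst sum.cong[OF refl prob]) auto

lemma wf_gadget: "wf_mdp M"
  unfolding wf_mdp_def using gadget_prob_nonneg sum_prob_total
  by (auto simp: init nacts nstates prob)

lemma enabled_gadget:
  assumes "s < nstates M"
  shows "enabled M s = (if s \<in> {1, 5} then {} else {0, 1})"
proof -
  have "a \<in> enabled M s \<longleftrightarrow> a < 2 \<and> s \<notin> {1, 5}" for a
  proof (cases "a < 2")
    case True
    show ?thesis
      unfolding enabled_def nacts mem_Collect_eq sum_prob_total[OF assms True] using True by simp
  qed (simp add: enabled_def nacts)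
  then have "enabled M s = {a. a < 2 \<and> s \<notin> {1, 5}}"
    by blast
  also have "\<dots> = (if s \<in> {1, 5} then {} else {0, 1})"
    by auto
  finally show ?thesis .
qed

lemma terminal_gadget: "s < nstates M \<Longrightarrow> terminal M s \<longleftrightarrow> s \<in> {1, 5}"
  by (simp add: terminal_def enabled_gadget)

section \<open>Values of the twin states\<close>

definition diff_value :: "nat \<Rightarrow> nat \<Rightarrow> real" where
  "diff_value j n =
     (case n of 0 \<Rightarrow> 0 | Suc m \<Rightarrow> (1 / ((real k + 2) * real B)) ^ Suc m * real_of_rat (lrs \<alpha> \<beta> (m + j)))"

text \<open>The initial values are injected in the step from weight 1 to weight 0, where all
  differences vanish; hence weight \<open>m + 1\<close> belongs to the term with index
  \<open>m + j\<close>. Above that, multiplication by the companion matrix shifts the window, and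
  each step contributes one damping factor.\<close>

lemma diff_value_Suc:
  assumes "j < k"
  shows "diff_value j (Suc n) =
    ((if n = 0 then real_of_rat (\<beta> ! j) else 0) + (\<Sum>l<k. real_of_rat (companion \<alpha> j l) * diff_value l n)) /
      ((real k + 2) * real B)"
proof (cases n)
  case 0
  with assms show ?thesis
    by (simp add: diff_value_def lrs_initial)
next
  case (Suc m)
  define c where "c = 1 / ((real k + 2) * real B)"
  have "diff_value j (Suc n) = c * c ^ Suc m * real_of_rat (\<Sum>l<k. companion \<alpha> j l * lrs \<alpha> \<beta> (m + l))"
    unfolding lrs_companion[OF assms] by (simp add: diff_value_def Suc c_def)
  also have "\<dots> = c * (\<Sum>l<k. real_of_rat (companion \<alpha> j l) * diff_value l n)"
    by (simp add: diff_value_def Suc c_def of_rat_sum of_rat_mult sum_distrib_left sum_divide_distrib mult_ac)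
  finally show ?thesis
    by (simp add: Suc c_def)
qed

definition chain_value :: "nat \<Rightarrow> nat \<Rightarrow> real" where
  "chain_value s n = (sum_value k n + (- 1) ^ s * diff_value ((s - 6) div 2) n) / 2"

definition stop_value :: "nat \<Rightarrow> int \<Rightarrow> real" where
  "stop_value s w = real_of_int (max (w + int s - 3) 0)"

lemma chain_value_0 [simp]: "chain_value s 0 = 0"
  by (simp add: chain_value_def diff_value_def)

text \<open>Adding and subtracting the values of twins decouples the transition into the recurrences
  of \<open>sum_value\<close> and \<open>diff_value\<close>. The function \<open>f\<close> is
  prescribed only at the states that are reached, so the lemma serves the upper bound, the lower
  bound and non-negativity alike.\<close>

lemma chain_value_rec:
  assumes s: "6 \<le> s" "s < nstates M"
    and f: "f 2 = stop_value 2 (w - 1)" "f 3 = stop_value 3 (w - 1)" "f 4 = stop_value 4 (w - 1)"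
      "\<And>t. 6 \<le> t \<Longrightarrow> t < nstates M \<Longrightarrow> f t = chain_value t (nat (w - 1))"
  shows "(\<Sum>t<nstates M. real_of_rat (gadget_prob \<alpha> \<beta> B s a t) * f t) = chain_value s (nat w)"
proof -
  define j where "j = (s - 6) div 2"
  have j: "j < k"
    using s nstates by (auto simp: j_def)
  have f_chain: "f (6 + 2 * l) = chain_value (6 + 2 * l) (nat (w - 1))"
      "f (7 + 2 * l) = chain_value (7 + 2 * l) (nat (w - 1))" if "l < k" for l
    using that nstates by (auto intro!: f(4))
  have sums: "(\<Sum>l<k. f (6 + 2 * l) + f (7 + 2 * l)) = real k * sum_value k (nat (w - 1))"
    "(\<Sum>l<k. real_of_rat (companion \<alpha> j l) * (f (6 + 2 * l) - f (7 + 2 * l))) =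
       (\<Sum>l<k. real_of_rat (companion \<alpha> j l) * diff_value l (nat (w - 1)))"
  proof -
    have "f (6 + 2 * l) + f (7 + 2 * l) = sum_value k (nat (w - 1))"
      "f (6 + 2 * l) - f (7 + 2 * l) = diff_value l (nat (w - 1))" if "l < k" for l
      using that by (simp_all only: f_chain) (simp_all add: chain_value_def field_simps)
    then show "(\<Sum>l<k. f (6 + 2 * l) + f (7 + 2 * l)) = k * sum_value k (nat (w - 1))"
      "(\<Sum>l<k. real_of_rat (companion \<alpha> j l) * (f (6 + 2 * l) - f (7 + 2 * l))) =
       (\<Sum>l<k. real_of_rat (companion \<alpha> j l) * diff_value l (nat (w - 1)))"
      by (simp_all cong: sum.cong_simp)
  qed
  show ?thesis
  proof (cases "w \<le> 0")
    case True
    then show ?thesis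
      unfolding sum_gadget_prob[OF s] j_def[symmetric] sums f(1-3)
      by (simp add: stop_value_def diff_value_def)
  next
    case False
    then obtain n where w: "w = int (Suc n)"
      by (metis zero_less_imp_eq_int not_le gr0_implies_Suc)
    have stop: "stop_value 2 (w - 1) = real (n - 1)" "stop_value 3 (w - 1) = real n" "stop_value 4 (w - 1) = real (Suc n)"
      by (auto simp: stop_value_def w)
    \<comment> \<open>The kink of the truncation at 0: only for \<open>n = 0\<close> does the
      initial value survive.\<close>
    have curv: "real (n - 1) - 2 * real n + real (Suc n) = (if n = 0 then 1 else 0)"
      by (cases n) auto
    have n: "nat (w - 1) = n" "nat w = Suc n"
      by (auto simp: w)
    have B0: "real B \<noteq> 0" "real k + 2 \<noteq> 0"
      using B_pos by auto
    have "(\<Sum>t<nstates M. real_of_rat (gadget_prob \<alpha> \<beta> B s a t) * f t) =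
       (real (n - 1) + 2 * real n + real (Suc n) + real k * sum_value k n) / (2 * (real k + 2)) +
       (- 1) ^ s * (real_of_rat (\<beta> ! j) * (real (n - 1) - 2 * real n + real (Suc n)) +
          (\<Sum>l<k. real_of_rat (companion \<alpha> j l) * diff_value l n)) / (2 * (real k + 2) * real B)"
      unfolding sum_gadget_prob[OF s] j_def[symmetric] sums f(1-3) stop n by simp
    also have "\<dots> = (sum_value k (Suc n) + (- 1) ^ s * diff_value j (Suc n)) / 2"
      unfolding diff_value_Suc[OF j] curv by (simp add: add_divide_distrib algebra_simps)
    finally show ?thesis
      by (simp only: chain_value_def n j_def)
  qed
qed

text \<open>This is not visible from the closed form, where the difference may have either sign. It
  holds because the value is an average of non-negative values at the next smaller weight.\<close>

lemma chain_value_nonneg: "6 \<le> s \<Longrightarrow> s < nstates M \<Longrightarrow> chain_value s n \<ge> 0"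
proof (induction n arbitrary: s)
  case (Suc n)
  define f where "f t = (if t < 6 then stop_value t (int n) else chain_value t n)" for t
  have "0 \<le> (\<Sum>t<nstates M. real_of_rat (gadget_prob \<alpha> \<beta> B s 0 t) * f t)"
    using Suc by (intro sum_nonneg mult_nonneg_nonneg) (auto simp: f_def stop_value_def gadget_prob_nonneg)
  also have "\<dots> = chain_value s (nat (int (Suc n)))"
    using Suc.prems by (intro chain_value_rec) (auto simp: f_def)
  finally show ?case
    by (simp only: nat_int)
qed simp

section \<open>Upper bound for sequences without negative terms\<close>

definition upper :: "nat \<Rightarrow> int \<Rightarrow> real" where
  "upper s w = (if s = 0 then start_value k (nat w) else if s = 1 then 0
     else if s \<in> {2, 3, 4} then stop_value s w else if s = 5 then max (real_of_int w) 0
     else chain_value s (nat w))"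

lemma upper_nonneg: "s < nstates M \<Longrightarrow> upper s w \<ge> 0"
  by (auto simp: upper_def start_value_nonneg stop_value_def chain_value_nonneg)

text \<open>The two choices in the initial state differ by a multiple of
  \<open>diff_value 0 n\<close>; here the sign of a term of the sequence decides which action is
  better.\<close>

lemma chain_value_start:
  "(1 - of_nat a) / 4 * chain_value 6 n + (1 + of_nat a) / 4 * chain_value 7 n =
     sum_value k n / 4 - of_nat a * diff_value 0 n / 4"
  by (simp add: chain_value_def field_simps)

text \<open>The function \<open>upper\<close> is the value of always choosing the mixture; in the
  goal it is the positive part of the reward. Negative weights are truncated to 0 so that the
  inequality holds at every integer weight.\<close>

lemma upper_superharmonic:
  assumes pos: "\<And>n. lrs \<alpha> \<beta> n \<ge> 0" and s: "s < nstates M" and a: "a \<in> enabled M s"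
  shows "(\<Sum>t<nstates M. real_of_rat (gadget_prob \<alpha> \<beta> B s a t) * upper t (w + gadget_wgt s)) \<le> upper s w"
proof -
  have a2: "a < 2"
    using a by (simp add: enabled_def nacts)
  consider "s = 0" | "s \<in> {1, 5}" | "s \<in> {2, 3, 4}" | "6 \<le> s"
    by fastforce
  then show ?thesis
  proof cases
    case 1
    have "(\<Sum>t<nstates M. real_of_rat (gadget_prob \<alpha> \<beta> B s a t) * upper t (w + gadget_wgt s)) =
        start_value k (nat (w + 1)) / 2 + sum_value k (nat (w + 1)) / 4 - of_nat a * diff_value 0 (nat (w + 1)) / 4"
      using chain_value_start[of a "nat (w + 1)"]
      unfolding 1 sum_gadget_prob_start[OF a2] by (simp add: upper_def gadget_wgt_def)
    \<comment> \<open>Positivity of the sequence enters here: action 1 subtracts a non-negative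
      amount.\<close>
    also have "\<dots> \<le> start_value k (nat (w + 1)) / 2 + sum_value k (nat (w + 1)) / 4"
      using pos by (auto simp: diff_value_def split: nat.split)
    also have "\<dots> \<le> start_value k (nat w)"
    proof (cases "w \<ge> 0")
      case True
      then have "nat (w + 1) = Suc (nat w)"
        by simp
      with start_value_rec[of k "nat w"] show ?thesis
        by (simp del: sum_value.simps)
    next
      \<comment> \<open>For \<open>w < 0\<close> both truncated weights are 0, and half of a
        non-negative number is at most that number.\<close>
      case False
      then show ?thesis
        using start_value_nonneg[of k 0] by simp
    qed
    finally show ?thesis
      by (simp add: upper_def 1)
  next
    case 2
    with enabled_gadget[OF s] a show ?thesis
      by simp
  next
    case 3
    then show ?thesis
      unfolding sum_gadget_prob_stop[OF a2 3]
      by (auto simp: upper_def stop_value_def gadget_wgt_def)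
  next
    case 4
    have "(\<Sum>t<nstates M. real_of_rat (gadget_prob \<alpha> \<beta> B s a t) * upper t (w + gadget_wgt s)) = chain_value s (nat w)"
      using 4 s by (intro chain_value_rec) (auto simp: upper_def gadget_wgt_def)
    with 4 show ?thesis
      by (simp add: upper_def)
  qed
qed

lemma sum_prob_eq:
  assumes "s < nstates M" "a < 2"
  shows "(\<Sum>t<nstates M. ennreal (real_of_rat (prob M s a t)) * f t (w + wgt M s a)) =
    (\<Sum>t<nstates M. ennreal (real_of_rat (gadget_prob \<alpha> \<beta> B s a t)) * f t (w + gadget_wgt s))"
  using assms by (simp add: prob wgt)

lemma sum_ennreal_gadget_prob:
  assumes "s < nstates M" "a < 2" "\<And>t. t < nstates M \<Longrightarrow> f t \<ge> 0"
  shows "(\<Sum>t<nstates M. ennreal (real_of_rat (gadget_prob \<alpha> \<beta> B s a t)) * ennreal (f t)) =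
    ennreal (\<Sum>t<nstates M. real_of_rat (gadget_prob \<alpha> \<beta> B s a t) * f t)"
  using assms gadget_prob_nonneg[OF assms(1,2)]
  by (subst sum_ennreal[symmetric]) (auto simp: ennreal_mult)

lemma goal_subset: "{5} \<subseteq> {s. terminal M s}"
  using terminal_gadget[of 5] by (simp add: nstates)

text \<open>Dropping the negative part can only enlarge the expectation, so it suffices to bound the
  positive part, which is dominated by the potential \<open>upper\<close> under every
  scheduler.\<close>

lemma max_partial_expectation_le:
  assumes pos: "\<And>n. lrs \<alpha> \<beta> n \<ge> 0"
  shows "max_partial_expectation M {5} \<le> ereal (real_of_rat (gadget_threshold k))"
  unfolding max_partial_expectation_def
proof (rule SUP_least)
  fix \<SS> assume "\<SS> \<in> {\<SS>. is_scheduler M \<SS> \<and> (expectation_pos M {5} \<SS> < \<infinity> \<or> expectation_neg M {5} \<SS> < \<infinity>)}"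
  then have sched: "is_scheduler M \<SS>"
    by blast
  let ?\<Phi> = "\<lambda>s w. ennreal (upper s w)"
  have "(\<integral>\<^sup>+l. eval_path M (goal_reward {5} ennreal) (hist_of l) \<partial>prefix_pmf M \<SS> n)
      \<le> (\<integral>\<^sup>+l. eval_path M ?\<Phi> (hist_of l) \<partial>prefix_pmf M \<SS> n)" for n
    by (intro nn_integral_mono) (auto simp: eval_path_def goal_reward_def upper_def intro!: ennreal_leI)
  also have "\<dots> n \<le> ?\<Phi> (init M) 0" for n
  proof (rule nn_integral_prefix_le[OF wf_gadget sched])
    fix s a and w :: int
    assume s: "s < nstates M" and a: "a \<in> enabled M s"
    then have a2: "a < 2"
      by (simp add: enabled_def nacts)
    show "(\<Sum>t<nstates M. ennreal (real_of_rat (prob M s a t)) * ?\<Phi> t (w + wgt M s a)) \<le> ?\<Phi> s w"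
      using upper_superharmonic[OF pos s a, of w]
      unfolding sum_prob_eq[OF s a2, of "\<lambda>s w. ennreal (upper s w)"]
      by (subst sum_ennreal_gadget_prob[OF s a2]) (auto intro: upper_nonneg ennreal_leI)
  qed
  finally have "expectation_pos M {5} \<SS> \<le> ennreal (real_of_rat (gadget_threshold k))"
    unfolding expectation_pos_def
    by (subst nn_integral_goal_weight[OF goal_subset])
       (auto simp: init upper_def start_value_0 intro!: SUP_least)
  then have "enn2ereal (expectation_pos M {5} \<SS>) \<le> ereal (real_of_rat (gadget_threshold k))"
    by (metis enn2ereal_ennreal start_value_0 start_value_nonneg less_eq_ennreal.rep_eq)
  then show "partial_expectation M {5} \<SS> \<le> ereal (real_of_rat (gadget_threshold k))"
    unfolding partial_expectation_def
    by (rule order.trans[rotated])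
       (cases "expectation_pos M {5} \<SS>"; cases "expectation_neg M {5} \<SS>"; simp)
qed

section \<open>A policy that exploits a negative term\<close>

definition policy :: "nat \<Rightarrow> nat \<Rightarrow> int \<Rightarrow> nat" where
  "policy n0 s w = (if s = 0 then of_bool (w = int n0)
     else if s \<in> {2, 3, 4} then of_bool (w + int s - 3 < 0) else 0)"

text \<open>Gain of the deviation at weight \<open>n0\<close>, discounted by the probability
  \<open>2 ^ n / 2 ^ n0\<close> of staying in the loop from weight \<open>n\<close> up to weight
  \<open>n0\<close>.\<close>

definition bonus :: "nat \<Rightarrow> nat \<Rightarrow> real" where
  "bonus n0 n = (if n \<le> n0 then 2 ^ n / 2 ^ n0 * (- diff_value 0 (Suc n0) / 4) else 0)"

definition policy_value :: "nat \<Rightarrow> nat \<Rightarrow> real" where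
  "policy_value n0 n = start_value k n + bonus n0 n"

lemma policy_value_rec:
  "policy_value n0 n = policy_value n0 (Suc n) / 2 + sum_value k (Suc n) / 4 -
     of_bool (n = n0) * diff_value 0 (Suc n) / 4"
proof -
  have "bonus n0 n = bonus n0 (Suc n) / 2 - of_bool (n = n0) * diff_value 0 (Suc n) / 4"
    by (auto simp: bonus_def not_less_eq_eq)
  with start_value_rec[of k n] show ?thesis
    by (simp add: policy_value_def add_divide_distrib del: sum_value.simps)
qed

text \<open>A lower bound for the value of the policy within \<open>m\<close> steps. It is exact at the states
  \<open>s \<ge> 6\<close> with enough time left, since these lower the weight; at the initial state, which raises
  the weight, the loop is cut off at weight \<open>N\<close>.\<close>

definition lower :: "nat \<Rightarrow> nat \<Rightarrow> nat \<Rightarrow> nat \<Rightarrow> int \<Rightarrow> real" where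
  "lower n0 N m s w =
     (if s = 0 then
        (if 0 \<le> w \<and> w \<le> int N \<and> 2 * int N + 5 \<le> int m + w
         then policy_value n0 (nat w) - 2 ^ nat w / 2 ^ N * policy_value n0 N else 0)
      else if s = 1 then 0
      else if s \<in> {2, 3, 4} then (if m = 0 then 0 else stop_value s w)
      else if s = 5 then max (real_of_int w) 0
      else if w + 3 \<le> int m then chain_value s (nat w) else 0)"

lemma policy_less_2: "policy n0 s w < 2"
  by (simp add: policy_def)

lemma policy_enabled: "s < nstates M \<Longrightarrow> \<not> terminal M s \<Longrightarrow> policy n0 s w \<in> enabled M s"
  using policy_less_2[of n0 s w] by (auto simp: enabled_gadget terminal_gadget less_2_cases_iff)

text \<open>The time budgets are compatible with the moves: in the loop the weight rises as the
  remaining time falls, so \<open>m + w\<close> is constant; in the twins both fall, so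
  \<open>m - w\<close> is constant. When the loop is left from \<open>w < N\<close>, the condition
  \<open>2 * N + 5 \<le> m + 1 + w\<close> gives \<open>w + 4 \<le> m\<close>, the budget of the
  twins at weight \<open>w + 1\<close>. The second disjunct covers the places where the bound is set
  to 0.\<close>

lemma lower_subharmonic:
  assumes s: "s < nstates M" "\<not> terminal M s"
  shows "ennreal (lower n0 N (Suc m) s w) \<le>
    ennreal (\<Sum>t<nstates M. real_of_rat (gadget_prob \<alpha> \<beta> B s (policy n0 s w) t) * lower n0 N m t (w + gadget_wgt s)) \<or>
    lower n0 N (Suc m) s w \<le> 0"
proof -
  let ?a = "policy n0 s w"
  consider "s = 0" | "s \<in> {2, 3, 4}" | "6 \<le> s"
    using s terminal_gadget by fastforce
  then show ?thesis
  proof cases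
    case 1
    show ?thesis
    proof (cases "0 \<le> w \<and> w < int N \<and> 2 * int N + 5 \<le> int (Suc m) + w")
      case True
      then obtain n where w: "w = int n"
        using nonneg_int_cases by blast
      have n: "nat (w + 1) = Suc n"
        by (simp add: w nat_add_distrib)
      have "(\<Sum>t<nstates M. real_of_rat (gadget_prob \<alpha> \<beta> B s ?a t) * lower n0 N m t (w + gadget_wgt s)) =
          (policy_value n0 (Suc n) - 2 ^ Suc n / 2 ^ N * policy_value n0 N) / 2 +
          ((1 - of_nat ?a) / 4 * chain_value 6 (Suc n) + (1 + of_nat ?a) / 4 * chain_value 7 (Suc n))"
        using True n unfolding 1 sum_gadget_prob_start[OF policy_less_2]
        by (simp add: lower_def gadget_wgt_def)
      also have "\<dots> = policy_value n0 n - 2 ^ n / 2 ^ N * policy_value n0 N"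
        unfolding chain_value_start policy_value_rec[of n0 n]
        by (simp add: policy_def 1 w field_simps del: sum_value.simps)
      also have "\<dots> = lower n0 N (Suc m) s w"
        using True by (simp add: lower_def 1 w)
      finally show ?thesis
        by simp
    next
      case False
      then show ?thesis
        by (auto simp: 1 lower_def)
    qed
  next
    case 2
    then show ?thesis
      unfolding sum_gadget_prob_stop[OF policy_less_2 2]
      by (auto simp: lower_def policy_def stop_value_def gadget_wgt_def)
  next
    case 3
    show ?thesis
    proof (cases "w + 3 \<le> int (Suc m)")
      case True
      define f where "f t = (if t \<in> {2, 3, 4} then stop_value t (w - 1) else lower n0 N m t (w - 1))" for t
      \<comment> \<open>With no time left, \<open>lower\<close> is 0 in these states; then
        \<open>w \<le> - 2\<close>, and their value is 0 anyway.\<close>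
      have "stop_value t (w - 1) = 0" if "m = 0" "t \<in> {2, 3, 4}" for t
        using True that by (auto simp: stop_value_def)
      then have "lower n0 N m t (w + gadget_wgt s) = f t" for t
        using 3 by (auto simp: f_def lower_def gadget_wgt_def)
      then have "(\<Sum>t<nstates M. real_of_rat (gadget_prob \<alpha> \<beta> B s ?a t) * lower n0 N m t (w + gadget_wgt s)) =
          (\<Sum>t<nstates M. real_of_rat (gadget_prob \<alpha> \<beta> B s ?a t) * f t)"
        by simp
      also have "\<dots> = chain_value s (nat w)"
        using True 3 s by (intro chain_value_rec) (auto simp: f_def lower_def)
      also have "\<dots> = lower n0 N (Suc m) s w"
        using True 3 by (simp add: lower_def)
      finally show ?thesis
        by simp
    next
      case False
      with 3 show ?thesis
        by (simp add: lower_def)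
    qed
  qed
qed

text \<open>The negative part of the reward is itself a potential: the goal is entered only from the
  states 2, 3, 4, where the policy gives up if the resulting weight would be negative. Its start
  value is 0.\<close>

lemma expectation_neg_policy: "expectation_neg M {5} (memoryless M (policy n0)) = 0"
proof -
  let ?\<pi> = "memoryless M (policy n0)" and ?\<Phi> = "goal_reward {5} (\<lambda>x. ennreal (- x))"
  have "(\<integral>\<^sup>+l. eval_path M ?\<Phi> (hist_of l) \<partial>prefix_pmf M ?\<pi> n) \<le> ?\<Phi> (init M) 0" for n
  proof (rule nn_integral_prefix_le[OF wf_gadget is_scheduler_memoryless[OF wf_gadget policy_enabled]])
    fix h s a and w :: int
    assume h: "s = last_state M h" "w = path_weight M (init M) h" and s: "s < nstates M"
      and a: "a \<in> enabled M s" "a \<in> set_pmf (?\<pi> h)"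
    then have a_eq: "a = policy n0 s w" and a2: "a < 2"
      by (simp_all add: memoryless_def enabled_def nacts)
    have "ennreal (real_of_rat (gadget_prob \<alpha> \<beta> B s a t)) * ?\<Phi> t (w + gadget_wgt s) = 0" for t
      using a_eq by (auto simp: goal_reward_def gadget_prob_def policy_def gadget_wgt_def gadget_mult_def ennreal_eq_0_iff)
    then have "(\<Sum>t<nstates M. ennreal (real_of_rat (gadget_prob \<alpha> \<beta> B s a t)) * ?\<Phi> t (w + gadget_wgt s)) = 0"
      by (intro sum.neutral) blast
    then show "(\<Sum>t<nstates M. ennreal (real_of_rat (prob M s a t)) * ?\<Phi> t (w + wgt M s a)) \<le> ?\<Phi> s w"
      unfolding sum_prob_eq[OF s a2, of ?\<Phi>] by (simp only: zero_le)
  qed auto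
  then show ?thesis
    unfolding expectation_neg_def
    by (subst nn_integral_goal_weight[OF goal_subset]) (auto simp: goal_reward_def init)
qed

text \<open>With horizon \<open>2 * N + 5\<close>, the function \<open>lower\<close> at the start is
  the claimed bound. With horizon 0 it has the same positive part as the goal reward, because every
  time budget then excludes a positive value outside the goal.\<close>

lemma expectation_pos_policy:
  assumes "n0 < N"
  shows "expectation_pos M {5} (memoryless M (policy n0)) \<ge>
    ennreal (policy_value n0 0 - policy_value n0 N / 2 ^ N)"
proof -
  let ?F = "\<lambda>m s w. ennreal (lower n0 N m s w)" and ?m = "2 * N + 5"
  have "?F (0 + ?m) (init M) 0 \<le> (\<integral>\<^sup>+l. eval_path M (?F 0) (hist_of l) \<partial>prefix_pmf M (memoryless M (policy n0)) ?m)"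
  proof (rule nn_integral_prefix_memoryless_ge[OF wf_gadget policy_enabled])
    fix m s and w :: int
    assume s: "s < nstates M" "\<not> terminal M s"
    have "ennreal (\<Sum>t<nstates M. real_of_rat (gadget_prob \<alpha> \<beta> B s (policy n0 s w) t) * lower n0 N m t (w + gadget_wgt s))
        \<le> (\<Sum>t<nstates M. ennreal (real_of_rat (gadget_prob \<alpha> \<beta> B s (policy n0 s w) t)) * ?F m t (w + gadget_wgt s))"
      using gadget_prob_nonneg[OF s(1) policy_less_2] by (intro ennreal_sum_le) auto
    with lower_subharmonic[OF s, of n0 N m w]
    show "?F (Suc m) s w \<le> (\<Sum>t<nstates M. ennreal (real_of_rat (prob M s (policy n0 s w) t)) * ?F m t (w + wgt M s (policy n0 s w)))"
      unfolding sum_prob_eq[OF s(1) policy_less_2, where f = "?F m"]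
      by (auto simp: ennreal_neg intro: order.trans)
  next
    fix m s and w :: int
    assume "s < nstates M" "terminal M s"
    then show "?F (Suc m) s w \<le> ?F m s w"
      by (auto simp: terminal_gadget lower_def)
  qed auto
  also have "?F 0 = goal_reward {5} ennreal"
    by (intro ext) (auto simp: lower_def goal_reward_def max_def ennreal_neg)
  also have "(\<integral>\<^sup>+l. eval_path M (goal_reward {5} ennreal) (hist_of l) \<partial>prefix_pmf M (memoryless M (policy n0)) ?m)
      \<le> expectation_pos M {5} (memoryless M (policy n0))"
    unfolding expectation_pos_def by (subst nn_integral_goal_weight[OF goal_subset]) (auto intro: SUP_upper)
  finally show ?thesis
    by (simp add: init lower_def)
qed

text \<open>A single deviation from the mixture, at weight \<open>n0\<close>, already gives a strict
  gain over the threshold.\<close>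

lemma max_partial_expectation_gt:
  assumes neg: "lrs \<alpha> \<beta> n0 < 0"
  shows "max_partial_expectation M {5} > ereal (real_of_rat (gadget_threshold k))"
proof -
  let ?\<pi> = "memoryless M (policy n0)"
  have "diff_value 0 (Suc n0) < 0"
    using neg B_pos unfolding diff_value_def nat.case add_0_right
    by (intro mult_pos_neg zero_less_power divide_pos_pos mult_pos_pos) auto
  then have bonus: "bonus n0 0 > 0"
    by (simp add: bonus_def divide_neg_pos)
  \<comment> \<open>The loss at the cut-off tends to 0, whereas the bonus at weight 0 is a fixed
    positive number. Taking \<open>n0 < N\<close> places the deviation before the cut-off and makes
    the bonus at \<open>N\<close> vanish.\<close>
  have "(\<lambda>N. (3 * real N + 2) / 2 ^ N) \<longlonglongrightarrow> 0"
    by real_asymp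
  then have "\<forall>\<^sub>F N in sequentially. (3 * real N + 2) / 2 ^ N < bonus n0 0 \<and> n0 < N"
    using bonus by (intro eventually_conj order_tendstoD(2) eventually_gt_at_top) auto
  then obtain N where N: "(3 * real N + 2) / 2 ^ N < bonus n0 0" "n0 < N"
    by (auto simp: eventually_sequentially)
  have "policy_value n0 N / 2 ^ N \<le> (3 * real N + 2) / 2 ^ N"
    using N(2) start_value_le[of k N] by (intro divide_right_mono) (auto simp: policy_value_def bonus_def)
  with N(1) have less: "real_of_rat (gadget_threshold k) < policy_value n0 0 - policy_value n0 N / 2 ^ N"
    by (simp add: policy_value_def start_value_0)
  moreover have "real_of_rat (gadget_threshold k) \<ge> 0"
    by (simp add: gadget_threshold_def)
  ultimately have "ereal (real_of_rat (gadget_threshold k)) <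
      enn2ereal (ennreal (policy_value n0 0 - policy_value n0 N / 2 ^ N))"
    by (subst enn2ereal_ennreal) (linarith, simp)
  also have "\<dots> \<le> enn2ereal (expectation_pos M {5} ?\<pi>)"
    using expectation_pos_policy[OF N(2)] by (simp add: less_eq_ennreal.rep_eq)
  also have "\<dots> = partial_expectation M {5} ?\<pi>"
    by (simp add: partial_expectation_def expectation_neg_policy zero_ennreal.rep_eq)
  also have "\<dots> \<le> max_partial_expectation M {5}"
    unfolding max_partial_expectation_def
    using is_scheduler_memoryless[OF wf_gadget policy_enabled] expectation_neg_policy[of n0]
    by (intro SUP_upper) simp
  finally show ?thesis
    by simp
qed

theorem max_partial_expectation_gt_iff:
  "max_partial_expectation M {5} > ereal (real_of_rat (gadget_threshold k)) \<longleftrightarrow> (\<exists>n. lrs \<alpha> \<beta> n < 0)"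
  using max_partial_expectation_gt max_partial_expectation_le by (meson not_less)

end

section \<open>Programs and their cost\<close>

lemma bits_le_iff: "bits x \<le> Suc n \<longleftrightarrow> \<bar>x\<bar> < 2 ^ n"
proof -
  have "bits x \<le> Suc n \<longleftrightarrow> nat \<bar>x\<bar> < 2 ^ n"
    by (simp add: bits_def floorlog_le_iff)
  also have "\<dots> \<longleftrightarrow> \<bar>x\<bar> < 2 ^ n"
    by (simp add: nat_less_iff)
  finally show ?thesis .
qed

lemma bits_ge_1: "bits x \<ge> 1"
  by (simp add: bits_def)

lemma bits_0 [simp]: "bits 0 = 1" and bits_1 [simp]: "bits 1 = 2"
  by (simp_all add: bits_def floorlog_def)

lemma bits_le_abs: "bits x \<le> Suc (nat \<bar>x\<bar>)"
proof -
  have "int (nat \<bar>x\<bar>) < int (2 ^ nat \<bar>x\<bar>)"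
    by (simp only: of_nat_less_iff less_exp)
  then show ?thesis
    by (simp add: bits_le_iff)
qed

text \<open>Rounding down moves a negative quotient away from 0, but never beyond
  \<open>- \<bar>x\<bar>\<close>.\<close>

lemma abs_div_le: "\<bar>x div y\<bar> \<le> \<bar>x\<bar>" for x y :: int
proof (cases "y = 0")
  case False
  show ?thesis
  proof (cases "y > 0")
    case True
    then show ?thesis
      by (smt (verit) div_by_1 int_div_less_self pos_imp_zdiv_neg_iff zdiv_mono2 zdiv_mono2_neg)
  next
    case neg: False
    have "x div y = (- x) div (- y)"
      by simp
    moreover have "- y > 0"
      using neg False by simp
    ultimately show ?thesis
      by (smt (verit) div_by_1 int_div_less_self pos_imp_zdiv_neg_iff zdiv_mono2 zdiv_mono2_neg)
  qed
qed simp

text \<open>The two sign digits on the right leave room for the carry of an addition.\<close>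

lemma bits_arith_val: "bits (arith_val f x y) \<le> bits x + bits y"
proof -
  obtain a b where ab: "bits x = Suc a" "bits y = Suc b"
    by (simp add: bits_def)
  then have *: "\<bar>x\<bar> < 2 ^ a" "\<bar>y\<bar> < 2 ^ b"
    by (simp_all flip: bits_le_iff)
  have **: "(2::int) ^ a \<le> 2 ^ (a + b)" "(2::int) ^ b \<le> 2 ^ (a + b)"
    by simp_all
  have "\<bar>arith_val f x y\<bar> < 2 ^ Suc (a + b)"
  proof (cases f)
    case ADD
    have "\<bar>x + y\<bar> < 2 * 2 ^ (a + b)"
      using * ** by linarith
    with ADD show ?thesis by simp
  next
    case SUB
    have "\<bar>x - y\<bar> < 2 * 2 ^ (a + b)"
      using * ** by linarith
    with SUB show ?thesis by simp
  next
    case MULT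
    have "\<bar>x\<bar> * \<bar>y\<bar> < 2 ^ a * 2 ^ b"
      using * by (intro mult_strict_mono) auto
    then have "\<bar>x * y\<bar> < 2 * 2 ^ (a + b)"
      using ** by (simp add: abs_mult power_add) (smt (verit) zero_less_power mult_pos_pos)
    with MULT show ?thesis by simp
  next
    case DIV
    have "\<bar>x div y\<bar> < 2 * 2 ^ (a + b)"
      using * ** abs_div_le[of x y] by linarith
    with DIV show ?thesis by simp
  qed
  then have "bits (arith_val f x y) \<le> Suc (Suc (a + b))"
    by (simp only: bits_le_iff)
  with ab show ?thesis
    by simp
qed

text \<open>The input tape is included because \<open>READ\<close> moves its entries into cells. The
  query tape is left out because its contents never return to a cell.\<close>

definition sized :: "nat \<Rightarrow> config \<Rightarrow> bool" where
  "sized b \<sigma> \<longleftrightarrow> (\<forall>r. bits (mem \<sigma> r) \<le> b) \<and> (\<forall>x\<in>set (inp \<sigma>). bits x \<le> b)"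

lemma sized_pos: "sized b \<sigma> \<Longrightarrow> b \<ge> 1"
  using bits_ge_1 order_trans unfolding sized_def by blast

lemma sized_mono: "sized b \<sigma> \<Longrightarrow> b \<le> b' \<Longrightarrow> sized b' \<sigma>"
  unfolding sized_def using order_trans by blast

lemma sized_set_cell: "sized b \<sigma> \<Longrightarrow> bits x \<le> b \<Longrightarrow> sized b (set_cell r x \<sigma>)"
  by (simp add: sized_def set_cell_def)

lemma sized_qry [simp]: "sized b (\<sigma>\<lparr>qry := q\<rparr>) = sized b \<sigma>"
  by (simp add: sized_def)

section \<open>Cost of programs without loops\<close>

primrec loop_free :: "com \<Rightarrow> bool" where
  "loop_free (IMM r x) \<longleftrightarrow> True"
| "loop_free (ARITH f r i j) \<longleftrightarrow> True"
| "loop_free (LOAD r i) \<longleftrightarrow> True"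
| "loop_free (STORE i r) \<longleftrightarrow> True"
| "loop_free (READ r) \<longleftrightarrow> True"
| "loop_free (EOF r) \<longleftrightarrow> True"
| "loop_free (WRITE r) \<longleftrightarrow> True"
| "loop_free (QUERY r) \<longleftrightarrow> False"
| "loop_free (SEQ c d) \<longleftrightarrow> loop_free c \<and> loop_free d"
| "loop_free (IFPOS r c d) \<longleftrightarrow> loop_free c \<and> loop_free d"
| "loop_free (WHILEPOS r c) \<longleftrightarrow> False"

text \<open>Only meaningful for programs without loops and queries.\<close>

primrec run :: "com \<Rightarrow> config \<Rightarrow> config" where
  "run (IMM r x) \<sigma> = set_cell r x \<sigma>"
| "run (ARITH f r i j) \<sigma> = set_cell r (arith_val f (mem \<sigma> i) (mem \<sigma> j)) \<sigma>"
| "run (LOAD r i) \<sigma> = set_cell r (mem \<sigma> (nat (mem \<sigma> i))) \<sigma>"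
| "run (STORE i r) \<sigma> = set_cell (nat (mem \<sigma> i)) (mem \<sigma> r) \<sigma>"
| "run (READ r) \<sigma> = (case inp \<sigma> of [] \<Rightarrow> set_cell r 0 \<sigma> | x # w \<Rightarrow> set_cell r x (\<sigma>\<lparr>inp := w\<rparr>))"
| "run (EOF r) \<sigma> = set_cell r (if inp \<sigma> = [] then 1 else 0) \<sigma>"
| "run (WRITE r) \<sigma> = \<sigma>\<lparr>qry := qry \<sigma> @ [mem \<sigma> r]\<rparr>"
| "run (QUERY r) \<sigma> = \<sigma>"
| "run (SEQ c d) \<sigma> = run d (run c \<sigma>)"
| "run (IFPOS r c d) \<sigma> = (if mem \<sigma> r > 0 then run c \<sigma> else run d \<sigma>)"
| "run (WHILEPOS r c) \<sigma> = \<sigma>"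

definition runs_in :: "int list set \<Rightarrow> com \<Rightarrow> config \<Rightarrow> nat \<Rightarrow> config \<Rightarrow> bool" where
  "runs_in B c \<sigma> T \<tau> \<longleftrightarrow> (\<exists>t\<le>T. exec B c \<sigma> t \<tau>)"

lemma runs_in_mono: "runs_in B c \<sigma> T \<tau> \<Longrightarrow> T \<le> T' \<Longrightarrow> runs_in B c \<sigma> T' \<tau>"
  unfolding runs_in_def using order_trans by blast

lemma runs_in_SEQ: "runs_in B c \<sigma> T \<rho> \<Longrightarrow> runs_in B d \<rho> U \<tau> \<Longrightarrow> runs_in B (SEQ c d) \<sigma> (T + U) \<tau>"
  unfolding runs_in_def using exec.Seq add_mono by blast

text \<open>Every operation at most doubles the maximal length, so for a fixed program without loops
  cost and lengths grow by a constant factor only.\<close>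

definition linear_cost :: "nat \<Rightarrow> com \<Rightarrow> bool" where
  "linear_cost K c \<longleftrightarrow>
     (\<forall>B \<sigma> b. sized b \<sigma> \<longrightarrow> runs_in B c \<sigma> (K * b) (run c \<sigma>) \<and> sized (K * b) (run c \<sigma>))"

lemma linear_costI:
  assumes "\<And>B \<sigma> b. sized b \<sigma> \<Longrightarrow>
    \<exists>t\<le>K * b. exec B c \<sigma> t (run c \<sigma>) \<and> sized (K * b) (run c \<sigma>)"
  shows "linear_cost K c"
  using assms unfolding linear_cost_def runs_in_def by blast

lemma linear_costD: "linear_cost K c \<Longrightarrow> sized b \<sigma> \<Longrightarrow> run c \<sigma> = \<tau> \<Longrightarrow> runs_in B c \<sigma> (K * b) \<tau>"
  by (auto simp: linear_cost_def)

lemma loop_free_linear_cost: "loop_free c \<Longrightarrow> \<exists>K. linear_cost K c"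
proof (induction c)
  case (IMM r x)
  show ?case
  proof (rule exI[of _ "Suc (bits x)"], rule linear_costI)
    fix B \<sigma> b assume b: "sized b \<sigma>"
    have *: "bits x \<le> Suc (bits x) * b" "b \<le> Suc (bits x) * b"
      using sized_pos[OF b] by (simp_all add: trans_le_add2)
    then have "sized (Suc (bits x) * b) (run (IMM r x) \<sigma>)"
      using b by (auto intro!: sized_set_cell elim: sized_mono)
    with *(1) show "\<exists>t\<le>Suc (bits x) * b. exec B (IMM r x) \<sigma> t (run (IMM r x) \<sigma>) \<and>
        sized (Suc (bits x) * b) (run (IMM r x) \<sigma>)"
      using exec.Imm[of B r x \<sigma>] by auto
  qed
next
  case (ARITH f r i j)
  show ?case
  proof (rule exI[of _ "2"], rule linear_costI)
    fix B \<sigma> b assume b: "sized b \<sigma>"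
    let ?t = "bits (mem \<sigma> i) + bits (mem \<sigma> j)"
    have t: "?t \<le> 2 * b"
      using b by (simp add: sized_def add_mono mult_2)
    then have "sized (2 * b) (run (ARITH f r i j) \<sigma>)"
      using b bits_arith_val[of f "mem \<sigma> i" "mem \<sigma> j"] by (auto intro!: sized_set_cell elim: sized_mono)
    then show "\<exists>t\<le>2 * b. exec B (ARITH f r i j) \<sigma> t (run (ARITH f r i j) \<sigma>) \<and> sized (2 * b) (run (ARITH f r i j) \<sigma>)"
      using t exec.Arith by auto
  qed
next
  case (LOAD r i)
  show ?case
  proof (rule exI[of _ "2"], rule linear_costI)
    fix B \<sigma> b assume b: "sized b \<sigma>"
    then have "bits (mem \<sigma> i) + bits (mem \<sigma> (nat (mem \<sigma> i))) \<le> 2 * b" "sized (2 * b) (run (LOAD r i) \<sigma>)"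
      by (auto simp: sized_def set_cell_def add_mono mult_2 trans_le_add1)
    then show "\<exists>t\<le>2 * b. exec B (LOAD r i) \<sigma> t (run (LOAD r i) \<sigma>) \<and> sized (2 * b) (run (LOAD r i) \<sigma>)"
      using exec.Load by auto
  qed
next
  case (STORE i r)
  show ?case
  proof (rule exI[of _ "2"], rule linear_costI)
    fix B \<sigma> b assume b: "sized b \<sigma>"
    then have "bits (mem \<sigma> i) + bits (mem \<sigma> r) \<le> 2 * b" "sized (2 * b) (run (STORE i r) \<sigma>)"
      by (auto simp: sized_def set_cell_def add_mono mult_2 trans_le_add1)
    then show "\<exists>t\<le>2 * b. exec B (STORE i r) \<sigma> t (run (STORE i r) \<sigma>) \<and> sized (2 * b) (run (STORE i r) \<sigma>)"
      using exec.Store by auto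
  qed
next
  case (READ r)
  show ?case
  proof (rule exI[of _ "1"], rule linear_costI)
    fix B \<sigma> b assume b: "sized b \<sigma>"
    show "\<exists>t\<le>1 * b. exec B (READ r) \<sigma> t (run (READ r) \<sigma>) \<and> sized (1 * b) (run (READ r) \<sigma>)"
    proof (cases "inp \<sigma>")
      case Nil
      with exec.Read_Nil[OF Nil, of B r] sized_pos[OF b] b show ?thesis
        by (auto intro!: sized_set_cell)
    next
      case (Cons x w)
      with b have "bits x \<le> b" "sized b (\<sigma>\<lparr>inp := w\<rparr>)"
        by (auto simp: sized_def)
      with exec.Read_Cons[OF Cons, of B r] Cons show ?thesis
        by (auto intro!: sized_set_cell)
    qed
  qed
next
  case (EOF r)
  show ?case
  proof (rule exI[of _ "2"], rule linear_costI)
    fix B \<sigma> b assume b: "sized b \<sigma>"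
    with sized_pos[OF b] have "sized (2 * b) (run (EOF r) \<sigma>)"
      by (auto intro!: sized_set_cell elim: sized_mono)
    then show "\<exists>t\<le>2 * b. exec B (EOF r) \<sigma> t (run (EOF r) \<sigma>) \<and> sized (2 * b) (run (EOF r) \<sigma>)"
      using exec.Eof[of B r \<sigma>] sized_pos[OF b] by (intro exI[of _ 1]) auto
  qed
next
  case (WRITE r)
  show ?case
  proof (rule exI[of _ "1"], rule linear_costI)
    fix B \<sigma> b assume b: "sized b \<sigma>"
    then show "\<exists>t\<le>1 * b. exec B (WRITE r) \<sigma> t (run (WRITE r) \<sigma>) \<and> sized (1 * b) (run (WRITE r) \<sigma>)"
      using exec.Write[of B r \<sigma>] by (auto simp: sized_def)
  qed
next
  case (QUERY r)
  then show ?case by simp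
next
  case (SEQ c d)
  then obtain K L where K: "linear_cost K c" and L: "linear_cost L d"
    by auto
  show ?case
    unfolding linear_cost_def
  \<comment> \<open>The second program starts with lengths up to \<open>K * b\<close>, whence the
    product.\<close>
  proof (rule exI[of _ "K + L * K"], intro allI impI)
    fix B \<sigma> b assume b: "sized b \<sigma>"
    have c: "runs_in B c \<sigma> (K * b) (run c \<sigma>)" "sized (K * b) (run c \<sigma>)"
      using K b by (auto simp: linear_cost_def)
    have d: "runs_in B d (run c \<sigma>) (L * (K * b)) (run (SEQ c d) \<sigma>)" "sized (L * (K * b)) (run (SEQ c d) \<sigma>)"
      using L c(2) by (auto simp: linear_cost_def)
    show "runs_in B (SEQ c d) \<sigma> ((K + L * K) * b) (run (SEQ c d) \<sigma>) \<and> sized ((K + L * K) * b) (run (SEQ c d) \<sigma>)"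
      using runs_in_SEQ[OF c(1) d(1)] sized_mono[OF d(2)] by (simp add: algebra_simps)
  qed
next
  case (IFPOS r c d)
  then obtain K L where K: "linear_cost K c" and L: "linear_cost L d"
    by auto
  show ?case
  proof (rule exI[of _ "Suc (K + L)"], rule linear_costI)
    fix B \<sigma> b assume b: "sized b \<sigma>"
    let ?M = "Suc (K + L)"
    have r: "bits (mem \<sigma> r) \<le> b"
      using b by (simp add: sized_def)
    have "\<exists>t\<le>K * b. exec B c \<sigma> t (run c \<sigma>)" "sized (K * b) (run c \<sigma>)"
      "\<exists>t\<le>L * b. exec B d \<sigma> t (run d \<sigma>)" "sized (L * b) (run d \<sigma>)"
      using K L b by (auto simp: linear_cost_def runs_in_def)
    then obtain t u where t: "t \<le> K * b" "exec B c \<sigma> t (run c \<sigma>)" and u: "u \<le> L * b" "exec B d \<sigma> u (run d \<sigma>)"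
      and s: "sized (K * b) (run c \<sigma>)" "sized (L * b) (run d \<sigma>)"
      by blast
    have "sized (?M * b) (run (IFPOS r c d) \<sigma>)"
      using s by (auto elim: sized_mono simp: algebra_simps)
    moreover have "bits (mem \<sigma> r) + t \<le> ?M * b" "bits (mem \<sigma> r) + u \<le> ?M * b"
      using r t(1) u(1) by (simp_all add: algebra_simps)
    ultimately show "\<exists>t\<le>?M * b. exec B (IFPOS r c d) \<sigma> t (run (IFPOS r c d) \<sigma>) \<and> sized (?M * b) (run (IFPOS r c d) \<sigma>)"
      using exec.If_True[of \<sigma> r B c t "run c \<sigma>" d] exec.If_False[of \<sigma> r B d u "run d \<sigma>" c] t u
      by (cases "mem \<sigma> r > 0") auto
  qed
next
  case (WHILEPOS r c)
  then show ?case by simp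
qed

text \<open>Iterating the bound of \<open>linear_cost\<close> would multiply the lengths by a
  constant in each round and become exponential. Therefore the configurations at the loop head are
  given explicitly by \<open>st\<close>, with one common bound \<open>b\<close> on their lengths,
  and each round costs at most a constant times \<open>b\<close>.\<close>

lemma runs_in_while:
  assumes "linear_cost K c"
    and pos: "\<And>i. i < n \<Longrightarrow> mem (st i) r > 0" and fin: "mem (st n) r \<le> 0"
    and step: "\<And>i. i < n \<Longrightarrow> run c (st i) = st (Suc i)"
    and sized: "\<And>i. i \<le> n \<Longrightarrow> sized b (st i)"
  shows "runs_in B (WHILEPOS r c) (st 0) (Suc n * (Suc K * b)) (st n)"
proof -
  have "runs_in B (WHILEPOS r c) (st (n - m)) (Suc m * (Suc K * b)) (st n)" if "m \<le> n" for m
    using that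
  proof (induction m)
    case 0
    have "bits (mem (st n) r) \<le> Suc 0 * (Suc K * b)"
      using sized[of n] by (auto simp: sized_def intro: trans_le_add1)
    with exec.While_False[OF fin] show ?case
      unfolding runs_in_def by auto
  next
    case (Suc m)
    let ?i = "n - Suc m"
    have i: "?i < n" "Suc ?i = n - m"
      using Suc.prems by auto
    have "runs_in B c (st ?i) (K * b) (run c (st ?i))"
      using assms(1) sized[of ?i] i(1) by (simp add: linear_cost_def)
    then have "runs_in B c (st ?i) (K * b) (st (n - m))"
      by (simp only: step[OF i(1)] i(2))
    then obtain t where t: "t \<le> K * b" "exec B c (st ?i) t (st (n - m))"
      by (auto simp: runs_in_def)
    from Suc obtain u where u: "u \<le> Suc m * (Suc K * b)" "exec B (WHILEPOS r c) (st (n - m)) u (st n)"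
      by (auto simp: runs_in_def)
    have "bits (mem (st ?i) r) \<le> b"
      using sized[of ?i] by (simp add: sized_def)
    with t u have "bits (mem (st ?i) r) + t + u \<le> Suc (Suc m) * (Suc K * b)"
      by (simp add: algebra_simps)
    with exec.While_True[OF pos[OF i(1)] t(2) u(2)] show ?case
      unfolding runs_in_def by blast
  qed
  from this[of n] show ?thesis
    by simp
qed

text \<open>Expressions are evaluated into cell 16, with cells 17 to 31 as a stack; these are zero before
  and after. The cells below 16 are variables, the cells from 32 on form an array.\<close>

datatype exp = Var nat | Num int | Op arith exp exp | Idx exp | Cond exp exp exp

text \<open>Array access below address 32 yields 0, so that an expression whose variables are below
  16 does not depend on the stack cells.\<close>

primrec eval_exp :: "(nat \<Rightarrow> int) \<Rightarrow> exp \<Rightarrow> int" where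
  "eval_exp m (Var x) = m x"
| "eval_exp m (Num z) = z"
| "eval_exp m (Op f a b) = arith_val f (eval_exp m a) (eval_exp m b)"
| "eval_exp m (Idx e) = (if eval_exp m e \<ge> 32 then m (nat (eval_exp m e)) else 0)"
| "eval_exp m (Cond c a b) = (if eval_exp m c > 0 then eval_exp m a else eval_exp m b)"

text \<open>The number \<open>d\<close> counts the cells available above the result cell; copying a
  variable takes one of them as a zero summand.\<close>

primrec fits :: "nat \<Rightarrow> exp \<Rightarrow> bool" where
  "fits d (Var x) \<longleftrightarrow> x < 16 \<and> d > 0"
| "fits d (Num z) \<longleftrightarrow> True"
| "fits d (Op f a b) \<longleftrightarrow> d > 0 \<and> fits d a \<and> fits (d - 1) b"
| "fits d (Idx e) \<longleftrightarrow> d > 0 \<and> fits d e"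
| "fits d (Cond c a b) \<longleftrightarrow> fits d c \<and> fits d a \<and> fits d b"

text \<open>The cell above the result is reset to 0 after use, so that it can serve again as the
  zero summand of a copy. The constant -31 turns \<open>IFPOS\<close> into a test for an address of
  at least 32.\<close>

primrec compile :: "nat \<Rightarrow> exp \<Rightarrow> com" where
  "compile r (Var x) = ARITH ADD r x (Suc r)"
| "compile r (Num z) = IMM r z"
| "compile r (Op f a b) = SEQ (compile r a) (SEQ (compile (Suc r) b) (SEQ (ARITH f r r (Suc r)) (IMM (Suc r) 0)))"
| "compile r (Idx e) = SEQ (compile r e) (SEQ (IMM (Suc r) (- 31)) (SEQ (ARITH ADD (Suc r) r (Suc r))
     (SEQ (IFPOS (Suc r) (LOAD r r) (IMM r 0)) (IMM (Suc r) 0))))"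
| "compile r (Cond c a b) = SEQ (compile r c) (IFPOS r (compile r a) (compile r b))"

lemma loop_free_compile: "loop_free (compile r e)"
  by (induction e arbitrary: r) auto

lemma mem_set_cell [simp]: "mem (set_cell r x \<sigma>) = (mem \<sigma>)(r := x)"
  and inp_set_cell [simp]: "inp (set_cell r x \<sigma>) = inp \<sigma>"
  and qry_set_cell [simp]: "qry (set_cell r x \<sigma>) = qry \<sigma>"
  by (simp_all add: set_cell_def)

lemma config_eqI: "mem \<sigma> = mem \<tau> \<Longrightarrow> inp \<sigma> = inp \<tau> \<Longrightarrow> qry \<sigma> = qry \<tau> \<Longrightarrow> \<sigma> = (\<tau> :: config)"
  by simp

lemma eval_exp_fun_upd:
  "fits d e \<Longrightarrow> 16 \<le> r \<Longrightarrow> r < 32 \<Longrightarrow> eval_exp (m(r := v)) e = eval_exp m e"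
proof (induction e arbitrary: d)
  case (Op f a b)
  then show ?case
    using Op.IH(1)[of d] Op.IH(2)[of "d - 1"] by simp
next
  case (Idx e)
  then show ?case
    using Idx.IH[of d] by auto
next
  case (Cond c a b)
  then show ?case
    using Cond.IH(1)[of d] Cond.IH(2)[of d] Cond.IH(3)[of d] by simp
qed auto

lemma run_compile:
  assumes "fits d e" "16 \<le> r" "r + d < 32" "\<And>q. r < q \<Longrightarrow> q < 32 \<Longrightarrow> mem \<sigma> q = 0"
  shows "run (compile r e) \<sigma> = set_cell r (eval_exp (mem \<sigma>) e) \<sigma>"
  using assms
proof (induction e arbitrary: r d \<sigma>)
  case (Var x)
  then show ?case by simp
next
  case (Num z)
  then show ?case by simp
next
  case (Op f a b)
  have a: "run (compile r a) \<sigma> = set_cell r (eval_exp (mem \<sigma>) a) \<sigma>"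
    using Op.prems by (intro Op.IH(1)[of d]) auto
  have b: "run (compile (Suc r) b) (set_cell r (eval_exp (mem \<sigma>) a) \<sigma>) =
      set_cell (Suc r) (eval_exp (mem \<sigma>) b) (set_cell r (eval_exp (mem \<sigma>) a) \<sigma>)"
    using Op.prems eval_exp_fun_upd[of "d - 1" b r]
    by (subst Op.IH(2)[of "d - 1"]) auto
  have "mem \<sigma> (Suc r) = 0"
    using Op.prems by simp
  then show ?case
    by (intro config_eqI) (simp_all add: a b fun_eq_iff)
next
  case (Idx e)
  have e: "run (compile r e) \<sigma> = set_cell r (eval_exp (mem \<sigma>) e) \<sigma>"
    using Idx.prems by (intro Idx.IH[of d]) auto
  define a where "a = eval_exp (mem \<sigma>) e"
  have zero: "mem \<sigma> (Suc r) = 0"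
    using Idx.prems by simp
  show ?case
  proof (cases "a \<ge> 32")
    case True
    then have "nat a \<noteq> r" "nat a \<noteq> Suc r"
      using Idx.prems by auto
    with True zero e show ?thesis
      by (intro config_eqI) (auto simp: fun_eq_iff simp flip: a_def)
  next
    case False
    with zero e show ?thesis
      by (intro config_eqI) (auto simp: fun_eq_iff simp flip: a_def)
  qed
next
  case (Cond c a b)
  have c: "run (compile r c) \<sigma> = set_cell r (eval_exp (mem \<sigma>) c) \<sigma>"
    using Cond.prems by (intro Cond.IH(1)[of d]) auto
  have ab: "run (compile r a) (set_cell r v \<sigma>) = set_cell r (eval_exp (mem \<sigma>) a) \<sigma>"
      "run (compile r b) (set_cell r v \<sigma>) = set_cell r (eval_exp (mem \<sigma>) b) \<sigma>" for v
    using Cond.prems eval_exp_fun_upd[of d a r] eval_exp_fun_upd[of d b r]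
    by (subst Cond.IH(2)[of d] Cond.IH(3)[of d], auto simp: set_cell_def)+
  show ?case
    by (simp add: c ab)
qed

definition tidy :: "(nat \<Rightarrow> int) \<Rightarrow> bool" where
  "tidy m \<longleftrightarrow> (\<forall>q. 16 \<le> q \<longrightarrow> q < 32 \<longrightarrow> m q = 0)"

lemma tidy_fun_upd [simp]: "x < 16 \<or> 32 \<le> x \<Longrightarrow> tidy m \<Longrightarrow> tidy (m(x := v))"
  by (auto simp: tidy_def)

definition assign :: "nat \<Rightarrow> exp \<Rightarrow> com" where
  "assign x e = SEQ (compile 16 e) (SEQ (ARITH ADD x 16 17) (IMM 16 0))"

definition emit :: "exp \<Rightarrow> com" where
  "emit e = SEQ (compile 16 e) (SEQ (WRITE 16) (IMM 16 0))"

lemma run_assign: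
  assumes "tidy (mem \<sigma>)" "fits 15 e" "x < 16"
  shows "run (assign x e) \<sigma> = set_cell x (eval_exp (mem \<sigma>) e) \<sigma>"
proof -
  have "run (compile 16 e) \<sigma> = set_cell 16 (eval_exp (mem \<sigma>) e) \<sigma>"
    using assms by (intro run_compile[of 15]) (auto simp: tidy_def)
  moreover have "mem \<sigma> 16 = 0" "mem \<sigma> 17 = 0"
    using assms by (auto simp: tidy_def)
  ultimately show ?thesis
    using assms by (intro config_eqI) (auto simp: assign_def fun_eq_iff)
qed

lemma run_emit:
  assumes "tidy (mem \<sigma>)" "fits 15 e"
  shows "run (emit e) \<sigma> = \<sigma>\<lparr>qry := qry \<sigma> @ [eval_exp (mem \<sigma>) e]\<rparr>"
proof -
  have "run (compile 16 e) \<sigma> = set_cell 16 (eval_exp (mem \<sigma>) e) \<sigma>"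
    using assms by (intro run_compile[of 15]) (auto simp: tidy_def)
  moreover have "mem \<sigma> 16 = 0"
    using assms by (auto simp: tidy_def)
  ultimately show ?thesis
    using assms by (intro config_eqI) (auto simp: emit_def fun_eq_iff)
qed

lemma loop_free_assign [simp]: "loop_free (assign x e)" and loop_free_emit [simp]: "loop_free (emit e)"
  by (simp_all add: assign_def emit_def loop_free_compile)

section \<open>Programs that write lists\<close>

primrec emit_list :: "exp list \<Rightarrow> com" where
  "emit_list [] = IMM 16 0"
| "emit_list (e # es) = SEQ (emit e) (emit_list es)"

lemma loop_free_emit_list [simp]: "loop_free (emit_list es)"
  by (induction es) auto

lemma run_emit_list:
  assumes "tidy (mem \<sigma>)" "\<And>e. e \<in> set es \<Longrightarrow> fits 15 e"
  shows "run (emit_list es) \<sigma> = \<sigma>\<lparr>qry := qry \<sigma> @ map (eval_exp (mem \<sigma>)) es\<rparr>"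
  using assms
proof (induction es arbitrary: \<sigma>)
  case Nil
  then show ?case
    by (intro config_eqI) (auto simp: tidy_def)
next
  case (Cons e es)
  then show ?case
    by (simp add: run_emit)
qed

text \<open>Cell 6 counts up from 0 and cell 5 counts the remaining rounds.\<close>

definition emit_body :: "exp list \<Rightarrow> com" where
  "emit_body es = SEQ (emit_list es)
     (SEQ (assign 6 (Op ADD (Var 6) (Num 1))) (assign 5 (Op SUB (Var 5) (Num 1))))"

definition emit_loop :: "exp \<Rightarrow> exp list \<Rightarrow> com" where
  "emit_loop n es = SEQ (assign 5 n) (SEQ (WHILEPOS 5 (emit_body es)) (assign 6 (Num 0)))"

definition emitted :: "(nat \<Rightarrow> int) \<Rightarrow> nat \<Rightarrow> exp list \<Rightarrow> nat \<Rightarrow> int list" where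
  "emitted m n es i = concat (map (\<lambda>x. map (eval_exp (m(5 := int (n - x), 6 := int x))) es) [0..<i])"

text \<open>Cells 5 and 6 are 0 again at the end, so the memory is unchanged and loops can be
  chained. The constant depends only on the program text; \<open>b\<close> bounds both the lengths
  and the number of rounds, which accounts for the square.\<close>

lemma runs_in_emit_loop:
  "\<exists>K. \<forall>B \<sigma> b n. tidy (mem \<sigma>) \<longrightarrow> mem \<sigma> 5 = 0 \<longrightarrow> mem \<sigma> 6 = 0 \<longrightarrow> fits 15 N \<longrightarrow>
     (\<forall>e\<in>set es. fits 15 e) \<longrightarrow> eval_exp (mem \<sigma>) N = int n \<longrightarrow> sized b \<sigma> \<longrightarrow> Suc n \<le> b \<longrightarrow>
     runs_in B (emit_loop N es) \<sigma> (K * b ^ 2) (\<sigma>\<lparr>qry := qry \<sigma> @ emitted (mem \<sigma>) n es n\<rparr>)"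
proof -
  obtain K1 where K1: "linear_cost K1 (assign 5 N)"
    using loop_free_linear_cost[of "assign 5 N"] by auto
  obtain K2 where K2: "linear_cost K2 (emit_body es)"
    using loop_free_linear_cost[of "emit_body es"] by (auto simp: emit_body_def)
  obtain K3 where K3: "linear_cost K3 (assign 6 (Num 0))"
    using loop_free_linear_cost[of "assign 6 (Num 0)"] by auto
  show ?thesis
  proof (rule exI[of _ "K1 + Suc K2 + K3"], intro allI impI)
    fix B \<sigma> b n
    assume tidy: "tidy (mem \<sigma>)" and zero: "mem \<sigma> 5 = 0" "mem \<sigma> 6 = 0" and fits: "fits 15 N" "\<forall>e\<in>set es. fits 15 e"
      and n: "eval_exp (mem \<sigma>) N = int n" and b: "sized b \<sigma>" "Suc n \<le> b"
    define st where "st i = \<sigma>\<lparr>mem := (mem \<sigma>)(5 := int (n - i), 6 := int i), qry := qry \<sigma> @ emitted (mem \<sigma>) n es i\<rparr>" for i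
    have sized: "sized b (st i)" if "i \<le> n" for i
      using b that bits_le_abs[of "int i"] bits_le_abs[of "int (n - i)"] by (auto simp: sized_def st_def)
    have step: "run (emit_body es) (st i) = st (Suc i)" if "i < n" for i
      using that tidy fits(2)
      by (intro config_eqI) (simp_all add: emit_body_def st_def run_emit_list run_assign emitted_def fun_eq_iff of_nat_diff)
    have "runs_in B (assign 5 N) \<sigma> (K1 * b) (st 0)"
    proof -
      have "run (assign 5 N) \<sigma> = st 0"
        using tidy fits(1) n zero
        by (subst run_assign) (auto simp: st_def set_cell_def emitted_def fun_eq_iff intro!: config_eqI)
      with K1 b(1) show ?thesis
        unfolding linear_cost_def by metis
    qed
    moreover have "runs_in B (WHILEPOS 5 (emit_body es)) (st 0) (Suc n * (Suc K2 * b)) (st n)"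
      by (rule runs_in_while[OF K2]) (use sized step in \<open>auto simp: st_def\<close>)
    moreover have "runs_in B (assign 6 (Num 0)) (st n) (K3 * b) (\<sigma>\<lparr>qry := qry \<sigma> @ emitted (mem \<sigma>) n es n\<rparr>)"
    proof -
      have "run (assign 6 (Num 0)) (st n) = \<sigma>\<lparr>qry := qry \<sigma> @ emitted (mem \<sigma>) n es n\<rparr>"
        using tidy zero
        by (subst run_assign) (auto simp: st_def set_cell_def fun_eq_iff intro!: config_eqI)
      with K3 sized[of n] show ?thesis
        unfolding linear_cost_def by (metis order_refl)
    qed
    ultimately have "runs_in B (emit_loop N es) \<sigma> (K1 * b + (Suc n * (Suc K2 * b) + K3 * b))
        (\<sigma>\<lparr>qry := qry \<sigma> @ emitted (mem \<sigma>) n es n\<rparr>)"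
      unfolding emit_loop_def by (intro runs_in_SEQ)
    moreover have "K1 * b + (Suc n * (Suc K2 * b) + K3 * b) \<le> (K1 + Suc K2 + K3) * b ^ 2"
    proof -
      have "b \<le> b ^ 2"
        by (simp add: power2_eq_square)
      then have "K1 * b \<le> K1 * b ^ 2" "K3 * b \<le> K3 * b ^ 2"
        by (rule mult_le_mono2)+
      moreover have "Suc n * (Suc K2 * b) \<le> b * (Suc K2 * b)"
        using b(2) by (intro mult_right_mono) auto
      moreover have "(K1 + Suc K2 + K3) * b ^ 2 = K1 * b ^ 2 + (b * (Suc K2 * b) + K3 * b ^ 2)"
        by (simp add: algebra_simps power2_eq_square)
      ultimately show ?thesis
        by linarith
    qed
    ultimately show "runs_in B (emit_loop N es) \<sigma> ((K1 + Suc K2 + K3) * b ^ 2) (\<sigma>\<lparr>qry := qry \<sigma> @ emitted (mem \<sigma>) n es n\<rparr>)"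
      by (rule runs_in_mono)
  qed
qed

section \<open>The query\<close>

lemma encodes_rats_pairs:
  "encodes_rats (concat (map (\<lambda>(p, q). [p, q]) ps)) rs \<longleftrightarrow>
     (\<forall>(p, q)\<in>set ps. q > 0) \<and> rs = map (\<lambda>(p, q). Rat.Fract p q) ps"
proof (induction ps arbitrary: rs)
  case Nil
  then show ?case by (cases rs) auto
next
  case (Cons pq ps)
  then show ?case by (cases rs; cases pq) auto
qed

lemma encodes_rats_nth:
  assumes "encodes_rats w rs"
  shows "length w = 2 * length rs"
    and "i < length rs \<Longrightarrow> w ! Suc (2 * i) > 0 \<and> rs ! i = Rat.Fract (w ! (2 * i)) (w ! Suc (2 * i))"
proof -
  from assms show "length w = 2 * length rs"
    by (induction w rs rule: encodes_rats.induct) auto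
  from assms show "i < length rs \<Longrightarrow> w ! Suc (2 * i) > 0 \<and> rs ! i = Rat.Fract (w ! (2 * i)) (w ! Suc (2 * i))"
  proof (induction rs arbitrary: w i)
    case (Cons r rs)
    then show ?case by (cases i) auto
  qed simp
qed

lemma encodes_rats_exists:
  "length w = 2 * n \<Longrightarrow> (\<And>i. i < n \<Longrightarrow> w ! Suc (2 * i) > 0) \<Longrightarrow> \<exists>rs. length rs = n \<and> encodes_rats w rs"
proof (induction n arbitrary: w)
  case (Suc n)
  then obtain p q v where w: "w = p # q # v"
    by (metis length_Suc_conv mult_Suc_right add_2_eq_Suc)
  have "v ! Suc (2 * i) > 0" if "i < n" for i
    using Suc.prems(2)[of "Suc i"] that by (simp add: w)
  with Suc.IH[of v] Suc.prems(1) obtain rs where "length rs = n" "encodes_rats v rs"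
    by (auto simp: w)
  with Suc.prems(2)[of 0] show ?case
    by (intro exI[of _ "Rat.Fract p q # rs"]) (simp add: w)
qed simp

text \<open>The nested comprehensions of the encoding become one list indexed by a single counter,
  matching a program that emits them in one loop.\<close>

lemma concat_map_map_upt:
  "n > 0 \<Longrightarrow> concat (map (\<lambda>i. map (f i) [0..<n]) [0..<m]) = map (\<lambda>x. f (x div n) (x mod n)) [0..<m * n]"
proof (induction m)
  case (Suc m)
  have "[0..<Suc m * n] = [0..<m * n] @ map (\<lambda>j. m * n + j) [0..<n]"
    using map_add_upt[of "m * n" n] upt_add_eq_append[of 0 "m * n" n] by (simp add: add.commute)
  with Suc show ?case
    by (auto simp: mult.commute)
qed simp

lemma all_less_mult_iff:
  fixes m n :: nat
  assumes "n > 0"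
  shows "(\<forall>x<m * n. P (x div n) (x mod n)) \<longleftrightarrow> (\<forall>i<m. \<forall>j<n. P i j)"
proof (intro iffI allI impI)
  fix i j assume *: "\<forall>x<m * n. P (x div n) (x mod n)" "i < m" "j < n"
  have "i * n + j < m * n"
    using *(2,3) by (metis add_less_cancel_left less_le_trans mult_Suc mult_le_mono1 Suc_leI add.commute)
  with *(1) have "P ((i * n + j) div n) ((i * n + j) mod n)"
    by blast
  with *(3) show "P i j"
    by simp
next
  fix x assume *: "\<forall>i<m. \<forall>j<n. P i j" "x < m * n"
  then show "P (x div n) (x mod n)"
    using assms by (simp add: less_mult_imp_div_less)
qed

text \<open>In \<open>v\<close> the coefficients precede the initial values, so entry
  \<open>k + j\<close> is an initial value. The constant entries of the companion matrix become 1/1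
  and 0/1.\<close>

definition coeff_pair :: "nat \<Rightarrow> int list \<Rightarrow> nat \<Rightarrow> nat \<Rightarrow> int \<times> int" where
  "coeff_pair k v s t =
     (let j = (s - 6) div 2; l = (t - 6) div 2; entry = (\<lambda>i. (v ! (2 * i), v ! Suc (2 * i))) in
      if t < 6 then entry (k + j) else if Suc j = k then entry (k - Suc l)
      else if l = Suc j then (1, 1) else (0, 1))"

text \<open>Fractions are left unreduced, which the encoding permits and which spares the program a
  gcd. In the numerator, \<open>B\<close> is multiplied by the denominator of the coefficient to put
  both summands over one denominator.\<close>

definition prob_pair :: "nat \<Rightarrow> int \<Rightarrow> int list \<Rightarrow> nat \<Rightarrow> nat \<Rightarrow> nat \<Rightarrow> int \<times> int" where
  "prob_pair k B v s a t =
     (if s = 0 then (if t = 0 then 2 else if t = 6 then 1 - int a else if t = 7 then 1 + int a else 0, 4)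
      else if s \<in> {2, 3, 4} then (if t = 5 - 4 * a then 1 else 0, 1)
      else if s < 6 then (0, 1)
      else (int (gadget_mult t) * (B * snd (coeff_pair k v s t) +
          (if even (s + t) then fst (coeff_pair k v s t) else - fst (coeff_pair k v s t))),
        2 * (int k + 2) * B * snd (coeff_pair k v s t)))"

definition query_word :: "nat \<Rightarrow> int \<Rightarrow> int list \<Rightarrow> int list" where
  "query_word k B v =
     (let S = 2 * k + 6 in
      [int S, 2, 0] @ map (\<lambda>s. if s = 5 then 1 else 0) [0..<S] @
      map (\<lambda>x. gadget_wgt (x div 2)) [0..<S * 2] @
      concat (map (\<lambda>x. case prob_pair k B v (x div (2 * S)) (x mod (2 * S) div S) (x mod (2 * S) mod S) of
        (p, q) \<Rightarrow> [p, q]) [0..<S * (2 * S)]) @ [9, 2 * (int k + 4)])"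

locale instance_word =
  fixes k :: nat and B :: int and v :: "int list" and \<alpha> \<beta> :: "rat list"
  assumes k: "k \<ge> 2" "length \<alpha> = k" "length \<beta> = k"
    and encodes: "encodes_rats v (\<alpha> @ \<beta>)"
    and B: "B > 0" "\<And>x. x \<in> set v \<Longrightarrow> \<bar>x\<bar> \<le> B"
begin

lemma v_nth: "i < 2 * k \<Longrightarrow> v ! Suc (2 * i) > 0 \<and> (\<alpha> @ \<beta>) ! i = Rat.Fract (v ! (2 * i)) (v ! Suc (2 * i))"
  using encodes_rats_nth(2)[OF encodes, of i] k by simp

lemma length_v: "length v = 4 * k"
  using encodes_rats_nth(1)[OF encodes] k by simp

text \<open>Denominators are at least 1, so a bound on the numerators also bounds the
  fractions.\<close>

lemma abs_coeff_le:
  assumes "x \<in> set \<alpha> \<union> set \<beta>"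
  shows "\<bar>x\<bar> \<le> of_nat (nat B)"
proof -
  from assms obtain i where i: "i < 2 * k" "x = (\<alpha> @ \<beta>) ! i"
    using k by (metis Un_iff in_set_conv_nth length_append mult_2 set_append)
  define p q where "p = v ! (2 * i)" and "q = v ! Suc (2 * i)"
  have pq: "q > 0" "x = of_int p / of_int q"
    using v_nth[OF i(1)] i(2) by (simp_all add: p_def q_def Fract_of_int_quotient)
  have "\<bar>p\<bar> \<le> B"
    unfolding p_def using i(1) length_v by (intro B(2) nth_mem) simp
  also have "B * 1 \<le> B * q"
    using pq(1) B(1) by (intro mult_left_mono) auto
  finally have "\<bar>of_int p :: rat\<bar> \<le> of_int B * of_int q"
    by (metis mult.right_neutral of_int_abs of_int_le_iff of_int_mult)
  with pq B(1) show ?thesis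
    by (simp add: abs_divide divide_le_eq)
qed

lemma coeff_pair:
  assumes "6 \<le> s" "s < 2 * k + 6" "t < 2 * k + 6"
  shows "snd (coeff_pair k v s t) > 0"
    and "gadget_coeff \<alpha> \<beta> s t = of_int (fst (coeff_pair k v s t)) / of_int (snd (coeff_pair k v s t))"
proof -
  define j l where "j = (s - 6) div 2" and "l = (t - 6) div 2"
  have j: "j < k"
    using assms unfolding j_def by auto
  have \<beta>: "v ! Suc (2 * (k + j)) > 0 \<and> \<beta> ! j = of_int (v ! (2 * (k + j))) / of_int (v ! Suc (2 * (k + j)))"
    using v_nth[of "k + j"] j k by (simp add: nth_append Fract_of_int_quotient)
  have \<alpha>: "v ! Suc (2 * (k - Suc l)) > 0 \<and>
      \<alpha> ! (k - Suc l) = of_int (v ! (2 * (k - Suc l))) / of_int (v ! Suc (2 * (k - Suc l)))"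
    using v_nth[of "k - Suc l"] k by (simp add: nth_append Fract_of_int_quotient)
  show "snd (coeff_pair k v s t) > 0"
    using \<alpha> \<beta> by (simp add: coeff_pair_def Let_def flip: j_def l_def)
  show "gadget_coeff \<alpha> \<beta> s t = of_int (fst (coeff_pair k v s t)) / of_int (snd (coeff_pair k v s t))"
    using \<alpha> \<beta> k by (simp add: coeff_pair_def gadget_coeff_def companion_def Let_def flip: j_def l_def)
qed

lemma prob_pair:
  assumes "s < 2 * k + 6" "a < 2" "t < 2 * k + 6"
  shows "snd (prob_pair k B v s a t) > 0"
    and "Rat.Fract (fst (prob_pair k B v s a t)) (snd (prob_pair k B v s a t)) = gadget_prob \<alpha> \<beta> (nat B) s a t"
proof -
  show "snd (prob_pair k B v s a t) > 0"
    using coeff_pair(1)[of s t] assms B(1) by (auto simp: prob_pair_def)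
  show "Rat.Fract (fst (prob_pair k B v s a t)) (snd (prob_pair k B v s a t)) = gadget_prob \<alpha> \<beta> (nat B) s a t"
  proof (cases "s < 6")
    case True
    then show ?thesis
      by (auto simp: prob_pair_def gadget_prob_def Fract_of_int_quotient)
  next
    case False
    define p q where "p = fst (coeff_pair k v s t)" and "q = snd (coeff_pair k v s t)"
    have q: "(of_int q :: rat) \<noteq> 0" "gadget_coeff \<alpha> \<beta> s t = of_int p / of_int q"
      using coeff_pair[of s t] assms False by (simp_all add: p_def q_def)
    define C :: rat where "C = of_int B"
    define D :: rat where "D = 2 * (of_nat k + 2) * C"
    have B': "(of_nat (nat B) :: rat) = C"
      using B(1) by (simp add: C_def)
    have "Rat.Fract (fst (prob_pair k B v s a t)) (snd (prob_pair k B v s a t)) =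
        of_nat (gadget_mult t) * (C * of_int q + (if even (s + t) then of_int p else - of_int p)) / (D * of_int q)"
      using False by (simp add: prob_pair_def Fract_of_int_quotient D_def C_def flip: p_def q_def)
    also have "\<dots> = of_nat (gadget_mult t) *
        ((C * of_int q + (if even (s + t) then of_int p else - of_int p)) / of_int q) / D"
      by (simp add: mult.commute)
    also have "(C * of_int q + (if even (s + t) then of_int p else - of_int p)) / of_int q =
        C + (if even (s + t) then gadget_coeff \<alpha> \<beta> s t else - gadget_coeff \<alpha> \<beta> s t)"
      using q by (simp add: add_divide_distrib)
    also have "D = of_nat (2 * (length \<alpha> + 2) * nat B)"
      using k B' by (simp add: D_def algebra_simps)
    finally show ?thesis
      using False B' by (simp add: gadget_prob_def)
  qed
qed

text \<open>The word leaves the components outside the index ranges open, so it encodes many MDPs.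
  All of them are characterized, because a negative answer of the oracle has to exclude each
  one.\<close>

lemma encodes_query_word_iff:
  "encodes_mdp_threshold (query_word k B v) M G \<theta> \<longleftrightarrow>
     nstates M = 2 * k + 6 \<and> nacts M = 2 \<and> init M = 0 \<and> (\<forall>s<2 * k + 6. s \<in> G \<longleftrightarrow> s = 5) \<and>
     (\<forall>s<2 * k + 6. \<forall>a<2. wgt M s a = gadget_wgt s) \<and>
     (\<forall>s<2 * k + 6. \<forall>a<2. \<forall>t<2 * k + 6. prob M s a t = gadget_prob \<alpha> \<beta> (nat B) s a t) \<and>
     \<theta> = gadget_threshold k"
proof (cases "nstates M = 2 * k + 6 \<and> nacts M = 2 \<and> init M = 0")
  case False
  then show ?thesis
    by (auto simp: encodes_mdp_threshold_def query_word_def Let_def)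
next
  case True
  define S where "S = 2 * k + 6"
  have S: "S > 0"
    by (simp add: S_def)
  define f where "f x = prob_pair k B v (x div (2 * S)) (x mod (2 * S) div S) (x mod (2 * S) mod S)" for x
  define ps where "ps = map f [0..<S * (2 * S)] @ [(9, 2 * (int k + 4))]"
  have f: "snd (f x) > 0 \<and>
      Rat.Fract (fst (f x)) (snd (f x)) =
        gadget_prob \<alpha> \<beta> (nat B) (x div (2 * S)) (x mod (2 * S) div S) (x mod (2 * S) mod S)" if "x < S * (2 * S)" for x
    using that S prob_pair[of "x div (2 * S)" "x mod (2 * S) div S" "x mod (2 * S) mod S"]
    by (simp add: f_def less_mult_imp_div_less flip: S_def)
  have wgts: "[wgt M s a. s \<leftarrow> [0..<S], a \<leftarrow> [0..<2]] = map (\<lambda>x. wgt M (x div 2) (x mod 2)) [0..<S * 2]"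
    by (rule concat_map_map_upt) simp
  have "[prob M s a t. s \<leftarrow> [0..<S], a \<leftarrow> [0..<2], t \<leftarrow> [0..<S]] =
      concat (map (\<lambda>s. map (\<lambda>x. prob M s (x div S) (x mod S)) [0..<2 * S]) [0..<S])"
    by (simp only: concat_map_map_upt[OF S])
  also have "\<dots> = map (\<lambda>x. prob M (x div (2 * S)) (x mod (2 * S) div S) (x mod (2 * S) mod S)) [0..<S * (2 * S)]"
    using S by (intro concat_map_map_upt) simp
  finally have probs: "[prob M s a t. s \<leftarrow> [0..<S], a \<leftarrow> [0..<2], t \<leftarrow> [0..<S]] = \<dots>" .
  have "encodes_mdp_threshold (query_word k B v) M G \<theta> \<longleftrightarrow>
      map (\<lambda>s. if s = 5 then 1 else 0 :: int) [0..<S] = map (\<lambda>s. if s \<in> G then 1 else 0) [0..<S] \<and>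
      map (\<lambda>x. gadget_wgt (x div 2)) [0..<S * 2] = map (\<lambda>x. wgt M (x div 2) (x mod 2)) [0..<S * 2] \<and>
      encodes_rats (concat (map (\<lambda>(p, q). [p, q]) ps))
        (map (\<lambda>x. prob M (x div (2 * S)) (x mod (2 * S) div S) (x mod (2 * S) mod S)) [0..<S * (2 * S)] @ [\<theta>])"
    using True unfolding encodes_mdp_threshold_def query_word_def Let_def
    by (simp only: flip: S_def) (simp add: wgts probs ps_def comp_def flip: f_def)
  also have "encodes_rats (concat (map (\<lambda>(p, q). [p, q]) ps))
        (map (\<lambda>x. prob M (x div (2 * S)) (x mod (2 * S) div S) (x mod (2 * S) mod S)) [0..<S * (2 * S)] @ [\<theta>]) \<longleftrightarrow>
      (\<forall>x<S * (2 * S). prob M (x div (2 * S)) (x mod (2 * S) div S) (x mod (2 * S) mod S) =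
         gadget_prob \<alpha> \<beta> (nat B) (x div (2 * S)) (x mod (2 * S) div S) (x mod (2 * S) mod S)) \<and>
      \<theta> = gadget_threshold k"
    using f unfolding encodes_rats_pairs
    by (auto simp: ps_def case_prod_unfold gadget_threshold_def Fract_of_int_quotient)
  also have "(\<forall>x<S * (2 * S). prob M (x div (2 * S)) (x mod (2 * S) div S) (x mod (2 * S) mod S) =
         gadget_prob \<alpha> \<beta> (nat B) (x div (2 * S)) (x mod (2 * S) div S) (x mod (2 * S) mod S)) \<longleftrightarrow>
       (\<forall>s<S. \<forall>y<2 * S. prob M s (y div S) (y mod S) = gadget_prob \<alpha> \<beta> (nat B) s (y div S) (y mod S))"
    using S by (intro all_less_mult_iff) simp
  also have "\<dots> \<longleftrightarrow> (\<forall>s<S. \<forall>a<2. \<forall>t<S. prob M s a t = gadget_prob \<alpha> \<beta> (nat B) s a t)"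
    by (simp only: all_less_mult_iff[OF S, where m = 2 and
        P = "\<lambda>a t. prob M s a t = gadget_prob \<alpha> \<beta> (nat B) s a t" for s])
  also have "map (\<lambda>x. gadget_wgt (x div 2)) [0..<S * 2] = map (\<lambda>x. wgt M (x div 2) (x mod 2)) [0..<S * 2] \<longleftrightarrow>
      (\<forall>x<S * 2. wgt M (x div 2) (x mod 2) = gadget_wgt (x div 2))"
    by auto
  also have "\<dots> \<longleftrightarrow> (\<forall>s<S. \<forall>a<2. wgt M s a = gadget_wgt s)"
    by (rule all_less_mult_iff) simp
  also have "map (\<lambda>s. if s = 5 then 1 else 0 :: int) [0..<S] = map (\<lambda>s. if s \<in> G then 1 else 0) [0..<S] \<longleftrightarrow>
      (\<forall>s<S. s \<in> G \<longleftrightarrow> s = 5)"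
    by auto
  finally show ?thesis
    using True by (simp add: S_def)
qed

text \<open>Every MDP encoded by the word is an instance of the locale \<open>gadget\<close>, which
  settles one direction; for the other, one such MDP with goal set \<open>{5}\<close> has to be
  exhibited.\<close>

lemma query_word_iff:
  "query_word k B v \<in> partial_ssp_threshold_problem \<longleftrightarrow> (\<exists>n. lrs \<alpha> \<beta> n < 0)"
proof -
  have gadget: "gadget \<alpha> \<beta> (nat B) M" if "encodes_mdp_threshold (query_word k B v) M G \<theta>" for M G \<theta>
    using that k B(1) abs_coeff_le unfolding encodes_query_word_iff gadget_def by simp
  show ?thesis
  proof
    assume "query_word k B v \<in> partial_ssp_threshold_problem"
    then obtain M G \<theta> where M: "G \<subseteq> {s. s < nstates M \<and> terminal M s}"
      "encodes_mdp_threshold (query_word k B v) M G \<theta>" "max_partial_expectation M G > ereal (real_of_rat \<theta>)"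
      unfolding partial_ssp_threshold_problem_def by blast
    interpret gadget \<alpha> \<beta> "nat B" M
      using gadget[OF M(2)] .
    \<comment> \<open>The goal set has no elements outside the range of states, and inside it the
      encoding decides.\<close>
    have "G = {5}"
      using M(1,2) unfolding encodes_query_word_iff by auto
    with M(3) k show "\<exists>n. lrs \<alpha> \<beta> n < 0"
      using max_partial_expectation_gt_iff M(2) unfolding encodes_query_word_iff by simp
  next
    assume neg: "\<exists>n. lrs \<alpha> \<beta> n < 0"
    define M where "M = \<lparr>nstates = 2 * k + 6, nacts = 2, prob = gadget_prob \<alpha> \<beta> (nat B), init = 0,
      wgt = \<lambda>s a. gadget_wgt s\<rparr>"
    have M: "encodes_mdp_threshold (query_word k B v) M {5} (gadget_threshold k)"
      unfolding encodes_query_word_iff by (simp add: M_def)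
    interpret gadget \<alpha> \<beta> "nat B" M
      using gadget[OF M] .
    have "5 < nstates M"
      by (simp add: M_def)
    with M neg k show "query_word k B v \<in> partial_ssp_threshold_problem"
      unfolding partial_ssp_threshold_problem_def mem_Collect_eq
      using wf_gadget goal_subset max_partial_expectation_gt_iff
      by (intro exI[of _ M] exI[of _ "{5}"] exI[of _ "gadget_threshold k"]) auto
  qed
qed

end

section \<open>The reduction\<close>

text \<open>Equality is expressed as the failure of both strict comparisons, since the machine only
  tests for positive cells.\<close>

definition If_eq :: "exp \<Rightarrow> exp \<Rightarrow> exp \<Rightarrow> exp \<Rightarrow> exp" where
  "If_eq a b x y = Cond (Op SUB a b) y (Cond (Op SUB b a) y x)"

definition If_even :: "exp \<Rightarrow> exp \<Rightarrow> exp \<Rightarrow> exp" where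
  "If_even e x y = If_eq e (Op MULT (Op DIV e (Num 2)) (Num 2)) x y"

lemma eval_If_eq [simp]:
  "eval_exp m (If_eq a b x y) = (if eval_exp m a = eval_exp m b then eval_exp m x else eval_exp m y)"
  by (simp add: If_eq_def)

lemma eval_If_even [simp]:
  "eval_exp m (If_even e x y) = (if even (eval_exp m e) then eval_exp m x else eval_exp m y)"
proof -
  have "even z \<longleftrightarrow> z = z div 2 * 2" for z :: int
    by presburger
  then show ?thesis
    by (simp add: If_even_def)
qed

lemma fits_If_eq [simp]:
  "fits d (If_eq a b x y) \<longleftrightarrow> d > 0 \<and> fits d a \<and> fits d b \<and> fits (d - 1) a \<and> fits (d - 1) b \<and> fits d x \<and> fits d y"
  by (auto simp: If_eq_def)

lemma fits_If_even [simp]: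
  "fits d (If_even e x y) \<longleftrightarrow> d > 1 \<and> fits d e \<and> fits (d - 1) e \<and> fits d x \<and> fits d y"
  by (auto simp: If_even_def)

text \<open>Variables: 1 holds \<open>k\<close>, 2 the next free array cell, 3 the bound \<open>B\<close>, 4 whether some denominator
  is not positive, 5 the loop condition, 6 the last number read or the loop counter, 7 the end of the
  input, and 8 whether the input is well-formed.\<close>

definition size_exp :: exp where
  "size_exp = Op ADD (Op MULT (Var 1) (Num 2)) (Num 6)"

definition half_exp :: "exp \<Rightarrow> exp" where
  "half_exp e = Op DIV (Op SUB e (Num 6)) (Num 2)"

definition entry_exp :: "exp \<Rightarrow> int \<Rightarrow> exp" where
  "entry_exp i d = Idx (Op ADD (Op MULT i (Num 2)) (Num (32 + d)))"

text \<open>The parameter \<open>d\<close> selects the numerator (0) or the denominator (1). For the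
  matrix entry 0/1 the selected component is \<open>d\<close> itself.\<close>

definition coeff_exp :: "int \<Rightarrow> exp \<Rightarrow> exp \<Rightarrow> exp" where
  "coeff_exp d s t = Cond (Op SUB t (Num 5))
     (If_eq (Op ADD (half_exp s) (Num 1)) (Var 1)
        (entry_exp (Op SUB (Op SUB (Var 1) (Num 1)) (half_exp t)) d)
        (If_eq (half_exp t) (Op ADD (half_exp s) (Num 1)) (Num 1) (Num d)))
     (entry_exp (Op ADD (Var 1) (half_exp s)) d)"

definition mult_exp :: "exp \<Rightarrow> exp" where
  "mult_exp t = Cond (Op SUB t (Num 5)) (Num 1) (Cond (Op SUB t (Num 4)) (Num 0)
     (If_eq t (Num 3) (Num 2) (Cond (Op SUB t (Num 1)) (Num 1) (Num 0))))"

definition num_exp :: "exp \<Rightarrow> exp \<Rightarrow> exp \<Rightarrow> exp" where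
  "num_exp s a t = Cond (Op SUB s (Num 5))
     (Op MULT (mult_exp t) (Op ADD (Op MULT (Var 3) (coeff_exp 1 s t))
        (If_even (Op ADD s t) (coeff_exp 0 s t) (Op SUB (Num 0) (coeff_exp 0 s t)))))
     (Cond (Op SUB s (Num 4)) (Num 0)
       (Cond (Op SUB s (Num 1)) (If_eq t (Op SUB (Num 5) (Op MULT (Num 4) a)) (Num 1) (Num 0))
         (Cond s (Num 0)
           (If_eq t (Num 0) (Num 2)
             (If_eq t (Num 6) (Op SUB (Num 1) a) (If_eq t (Num 7) (Op ADD (Num 1) a) (Num 0)))))))"

definition den_exp :: "exp \<Rightarrow> exp \<Rightarrow> exp" where
  "den_exp s t = Cond (Op SUB s (Num 5))
     (Op MULT (Op MULT (Op MULT (Num 2) (Op ADD (Var 1) (Num 2))) (Var 3)) (coeff_exp 1 s t))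
     (Cond s (Num 1) (Num 4))"

definition wgt_exp :: "exp \<Rightarrow> exp" where
  "wgt_exp s = Cond (Op SUB s (Num 5)) (Num (- 1)) (Cond (Op SUB s (Num 4)) (Num 0)
     (Cond (Op SUB s (Num 1)) (Op SUB s (Num 3)) (Cond s (Num 0) (Num 1))))"

section \<open>Correctness of the expressions for weights and probabilities\<close>

lemma eval_size_exp: "m 1 = int k \<Longrightarrow> eval_exp m size_exp = int (2 * k + 6)"
  by (simp add: size_exp_def)

lemma eval_half_exp: "eval_exp m e = int x \<Longrightarrow> 6 \<le> x \<Longrightarrow> eval_exp m (half_exp e) = int ((x - 6) div 2)"
  by (simp add: half_exp_def zdiv_int of_nat_diff)

lemma eval_entry_exp:
  assumes "\<And>i. i < length v \<Longrightarrow> m (32 + i) = v ! i" "eval_exp m e = int i" "2 * i + d < length v"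
  shows "eval_exp m (entry_exp e (int d)) = v ! (2 * i + d)"
proof -
  have "nat (int i * 2 + (32 + int d)) = 32 + (2 * i + d)"
    by simp
  with assms show ?thesis
    by (simp add: entry_exp_def)
qed

lemma eval_coeff_exp:
  assumes m: "m 1 = int k" "\<And>i. i < length v \<Longrightarrow> m (32 + i) = v ! i" and v: "length v = 4 * k"
    and s: "eval_exp m s = int x" "6 \<le> x" "x < 2 * k + 6" and t: "eval_exp m t = int y" "y < 2 * k + 6"
  shows "eval_exp m (coeff_exp 0 s t) = fst (coeff_pair k v x y)"
    and "eval_exp m (coeff_exp 1 s t) = snd (coeff_pair k v x y)"
proof -
  define j where "j = (x - 6) div 2"
  have j: "j < k" "eval_exp m (half_exp s) = int j"
    using s eval_half_exp[of m s x] by (auto simp: j_def)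
  have "eval_exp m (coeff_exp (int d) s t) =
      (if d = 0 then fst (coeff_pair k v x y) else snd (coeff_pair k v x y))" if d: "d < 2" for d
  proof (cases "y < 6")
    case True
    have "eval_exp m (entry_exp (Op ADD (Var 1) (half_exp s)) (int d)) = v ! (2 * (k + j) + d)"
      using j v m(1) d by (intro eval_entry_exp m(2)) auto
    with True t d show ?thesis
      by (auto simp: coeff_exp_def coeff_pair_def Let_def less_2_cases_iff simp flip: j_def)
  next
    case False
    define l where "l = (y - 6) div 2"
    have l: "l < k" "eval_exp m (half_exp t) = int l"
      using t False eval_half_exp[of m t y] by (auto simp: l_def)
    have "eval_exp m (entry_exp (Op SUB (Op SUB (Var 1) (Num 1)) (half_exp t)) (int d)) = v ! (2 * (k - Suc l) + d)"
      using l v m(1) d by (intro eval_entry_exp m(2)) (auto simp: of_nat_diff)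
    with False t d j l m(1) show ?thesis
      by (auto simp: coeff_exp_def coeff_pair_def Let_def less_2_cases_iff simp flip: j_def l_def)
  qed
  from this[of 0] this[of 1] show "eval_exp m (coeff_exp 0 s t) = fst (coeff_pair k v x y)"
    "eval_exp m (coeff_exp 1 s t) = snd (coeff_pair k v x y)"
    by simp_all
qed

lemma eval_mult_exp: "eval_exp m t = int y \<Longrightarrow> eval_exp m (mult_exp t) = int (gadget_mult y)"
  by (auto simp: mult_exp_def gadget_mult_def)

lemma eval_wgt_exp: "eval_exp m s = int x \<Longrightarrow> eval_exp m (wgt_exp s) = gadget_wgt x"
  by (auto simp: wgt_exp_def gadget_wgt_def)

lemma eval_prob_exp:
  assumes m: "m 1 = int k" "m 3 = B" "\<And>i. i < length v \<Longrightarrow> m (32 + i) = v ! i" and v: "length v = 4 * k"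
    and s: "eval_exp m s = int x" "x < 2 * k + 6" and a: "eval_exp m a = int z" "z < 2"
    and t: "eval_exp m t = int y" "y < 2 * k + 6"
  shows "eval_exp m (num_exp s a t) = fst (prob_pair k B v x z y)"
    and "eval_exp m (den_exp s t) = snd (prob_pair k B v x z y)"
proof -
  note coeff = eval_coeff_exp[of m k v s x t y, OF m(1,3) v s(1) _ s(2) t]
  have "x = 0 \<or> x = 1 \<or> x \<in> {2, 3, 4} \<or> x = 5 \<or> 6 \<le> x"
    by fastforce
  then show "eval_exp m (num_exp s a t) = fst (prob_pair k B v x z y)"
    using s a t m coeff eval_mult_exp[OF t(1)]
    by (elim disjE) (auto simp: num_exp_def prob_pair_def less_2_cases_iff simp flip: of_nat_add)
  show "eval_exp m (den_exp s t) = snd (prob_pair k B v x z y)"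
    using s m coeff by (auto simp: den_exp_def prob_pair_def)
qed

section \<open>Reading and checking the input\<close>

definition read_body :: com where
  "read_body = SEQ (READ 6) (SEQ (STORE 2 6) (SEQ (assign 3 (Op ADD (Var 3) (Op MULT (Var 6) (Var 6))))
     (SEQ (assign 4 (Cond (Var 6) (Var 4) (If_even (Var 2) (Var 4) (Num 1))))
     (SEQ (assign 2 (Op ADD (Var 2) (Num 1))) (SEQ (EOF 7) (SEQ (assign 5 (Op SUB (Num 1) (Var 7)))
     (assign 6 (Num 0))))))))"

definition read_start :: com where
  "read_start = SEQ (READ 1) (SEQ (assign 2 (Num 32)) (SEQ (assign 3 (Num 1))
     (SEQ (EOF 7) (assign 5 (Op SUB (Num 1) (Var 7))))))"

definition valid_exp :: exp where
  "valid_exp = Cond (Op SUB (Var 1) (Num 1)) (Cond (Var 4) (Num 0)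
     (If_eq (Op SUB (Var 2) (Num 32)) (Op MULT (Var 1) (Num 4)) (Num 1) (Num 0))) (Num 0)"

definition read_word :: com where
  "read_word = SEQ read_start (SEQ (WHILEPOS 5 read_body) (SEQ (assign 7 (Num 0)) (assign 8 valid_exp)))"

text \<open>Loop invariant: the memory at the loop head after \<open>i\<close> entries, where
  \<open>k\<close> is the first number of the input.\<close>

definition read_mem :: "int \<Rightarrow> int list \<Rightarrow> nat \<Rightarrow> nat \<Rightarrow> int" where
  "read_mem k v i r =
     (if r = 1 then k else if r = 2 then 32 + int i
      else if r = 3 then 1 + (\<Sum>x\<leftarrow>take i v. x * x)
      else if r = 4 then (if \<exists>j<i. odd j \<and> v ! j \<le> 0 then 1 else 0)
      else if r = 5 then (if i < length v then 1 else 0)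
      else if r = 7 then (if i < length v then 0 else 1)
      else if 32 \<le> r \<and> r < 32 + i then v ! (r - 32) else 0)"

lemma tidy_read_mem [simp]: "tidy (read_mem k v i)"
  by (auto simp: tidy_def read_mem_def)

text \<open>For \<open>k \<ge> 2\<close> these are the words \<open>v\<close> that encode
  \<open>2 * k\<close> rationals. Tying \<open>k\<close> to the length of the word keeps it small
  although it is written in binary.\<close>

definition valid :: "int \<Rightarrow> int list \<Rightarrow> bool" where
  "valid k v \<longleftrightarrow> k \<ge> 2 \<and> int (length v) = 4 * k \<and> (\<forall>j<length v. odd j \<longrightarrow> v ! j > 0)"

definition final_mem :: "int \<Rightarrow> int list \<Rightarrow> nat \<Rightarrow> int" where
  "final_mem k v = (read_mem k v (length v))(7 := 0, 8 := (if valid k v then 1 else 0))"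

text \<open>A square has at most twice the length of its root, and lengths add up at worst under
  addition, so the sum of squares stays linear in the input size. The constant 40 absorbs the offset
  32 of the array and the small flags.\<close>

lemma bits_read_mem:
  assumes "i \<le> length v"
  shows "bits (read_mem k v i r) \<le> bits k + 2 * word_size v + length v + 40"
proof -
  have member: "bits (v ! j) \<le> word_size v" if "j < length v" for j
    using that unfolding word_size_def by (intro member_le_sum_list) auto
  have "bits (1 + (\<Sum>x\<leftarrow>w. x * x)) \<le> 2 + 2 * word_size w" for w
  proof (induction w)
    case (Cons x w)
    have "bits (x * x + (1 + (\<Sum>x\<leftarrow>w. x * x))) \<le> (bits x + bits x) + bits (1 + (\<Sum>x\<leftarrow>w. x * x))"
      using bits_arith_val[of ADD "x * x"] bits_arith_val[of MULT x x] by (metis add_le_mono1 arith_val.simps(1,3) order_trans)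
    with Cons show ?case
      by (simp add: word_size_def algebra_simps)
  qed (simp add: word_size_def)
  from this[of "take i v"] have "bits (1 + (\<Sum>x\<leftarrow>take i v. x * x)) \<le> 2 + 2 * word_size (take i v)" .
  also have "word_size v = word_size (take i v) + word_size (drop i v)"
    unfolding word_size_def by (metis append_take_drop_id map_append sum_list_append)
  then have "word_size (take i v) \<le> word_size v"
    by simp
  finally have sum: "bits (1 + (\<Sum>x\<leftarrow>take i v. x * x)) \<le> 2 + 2 * word_size v"
    by simp
  have "bits (32 + int i) \<le> length v + 33"
    using bits_le_abs[of "32 + int i"] assms by simp
  moreover have "bits (v ! (r - 32)) \<le> word_size v" if "32 \<le> r" "r < 32 + i"
    using that assms by (intro member) auto
  ultimately show ?thesis
    using sum assms by (auto simp: read_mem_def)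
qed

text \<open>The array starts at the even address 32, so odd addresses hold the denominators, and
  parity of the address decides whether a non-positive number is an error.\<close>

lemma run_read_body:
  assumes "i < length v"
  shows "run read_body \<lparr>mem = read_mem k v i, inp = drop i v, qry = []\<rparr> =
    \<lparr>mem = read_mem k v (Suc i), inp = drop (Suc i) v, qry = []\<rparr>"
proof -
  have drop: "drop i v = v ! i # drop (Suc i) v"
    using assms by (rule Cons_nth_drop_Suc[symmetric])
  have take: "take (Suc i) v = take i v @ [v ! i]"
    using assms by (rule take_Suc_conv_app_nth)
  define m where "m = (read_mem k v i)(6 := v ! i, nat (32 + int i) := v ! i)"
  have m: "m 2 = 32 + int i" "m 3 = 1 + (\<Sum>x\<leftarrow>take i v. x * x)"
    "m 4 = (if \<exists>j<i. odd j \<and> v ! j \<le> 0 then 1 else 0)" "m 6 = v ! i" "tidy m"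
    by (auto simp: m_def read_mem_def nat_add_distrib intro!: tidy_fun_upd)
  have bad: "(if v ! i > 0 then m 4 else if even (32 + int i) then m 4 else 1) =
      (if \<exists>j<Suc i. odd j \<and> v ! j \<le> 0 then 1 else 0)"
    unfolding m by (auto simp: less_Suc_eq)
  have sum: "m 3 + v ! i * v ! i = 1 + (\<Sum>x\<leftarrow>take (Suc i) v. x * x)"
    unfolding m take by simp
  have eof: "drop (Suc i) v = [] \<longleftrightarrow> \<not> Suc i < length v"
    by auto
  have "run (SEQ (READ 6) (STORE 2 6)) \<lparr>mem = read_mem k v i, inp = drop i v, qry = []\<rparr> =
      \<lparr>mem = m, inp = drop (Suc i) v, qry = []\<rparr>"
    by (intro config_eqI) (simp_all add: drop m_def read_mem_def)
  then have "run read_body \<lparr>mem = read_mem k v i, inp = drop i v, qry = []\<rparr> =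
      \<lparr>mem = m(3 := m 3 + v ! i * v ! i, 4 := if v ! i > 0 then m 4 else if even (32 + int i) then m 4 else 1,
         2 := 33 + int i, 7 := if Suc i < length v then 0 else 1, 5 := if Suc i < length v then 1 else 0, 6 := 0),
       inp = drop (Suc i) v, qry = []\<rparr>"
    using m by (intro config_eqI) (simp_all add: read_body_def run_assign eof)
  also have "\<dots> = \<lparr>mem = read_mem k v (Suc i), inp = drop (Suc i) v, qry = []\<rparr>"
    unfolding bad sum by (intro config_eqI) (auto simp: m_def read_mem_def fun_eq_iff nat_add_distrib)
  finally show ?thesis .
qed

text \<open>Reading past the end yields 0, hence the value 0 of \<open>k\<close> for the empty word,
  which \<open>valid\<close> rejects.\<close>

lemma runs_in_read_word:
  "\<exists>K. \<forall>B w b k v. k = (case w of [] \<Rightarrow> 0 | x # _ \<Rightarrow> x) \<longrightarrow> v = tl w \<longrightarrow>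
     bits k + 2 * word_size v + length v + 41 \<le> b \<longrightarrow> (\<forall>x\<in>set w. bits x \<le> b) \<longrightarrow>
     runs_in B read_word (initial_config w) (K * b ^ 2) \<lparr>mem = final_mem k v, inp = [], qry = []\<rparr> \<and>
     sized b \<lparr>mem = final_mem k v, inp = [], qry = []\<rparr>"
proof -
  let ?check = "SEQ (assign 7 (Num 0)) (assign 8 valid_exp)"
  obtain K1 where K1: "linear_cost K1 read_start"
    using loop_free_linear_cost[of read_start] by (auto simp: read_start_def)
  obtain K2 where K2: "linear_cost K2 read_body"
    using loop_free_linear_cost[of read_body] by (auto simp: read_body_def)
  obtain K3 where K3: "linear_cost K3 ?check"
    using loop_free_linear_cost[of ?check] by auto
  show ?thesis
  proof (rule exI[of _ "K1 + Suc K2 + K3"], intro allI impI)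
    fix B and w :: "int list" and b :: nat and k v
    assume k: "k = (case w of [] \<Rightarrow> 0 | x # _ \<Rightarrow> x)" and v: "v = tl w"
      and b: "bits k + 2 * word_size v + length v + 41 \<le> b" "\<forall>x\<in>set w. bits x \<le> b"
    define st where "st i = \<lparr>mem = read_mem k v i, inp = drop i v, qry = []\<rparr>" for i
    let ?n = "length v" and ?fin = "\<lparr>mem = final_mem k v, inp = [], qry = []\<rparr> :: config"
    have "x \<in> set w" if "x \<in> set (drop i v)" for x i
      using that v by (metis in_set_dropD list.set_sel(2) tl_Nil)
    then have sized: "sized b (st i)" if "i \<le> ?n" for i
    proof -
      have "bits (read_mem k v i r) \<le> b" for r
        using bits_read_mem[OF that, of k r] b(1) by linarith
      with \<open>\<And>x i. x \<in> set (drop i v) \<Longrightarrow> x \<in> set w\<close> b(2) show ?thesis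
        by (simp add: sized_def st_def)
    qed
    have "sized b (initial_config w)"
      using b by (auto simp: sized_def initial_config_def)
    moreover have "run read_start (initial_config w) = st 0"
      using k v by (intro config_eqI; cases w)
        (auto simp: read_start_def initial_config_def st_def run_assign tidy_def read_mem_def fun_eq_iff)
    ultimately have "runs_in B read_start (initial_config w) (K1 * b) (st 0)"
      using K1 unfolding linear_cost_def by metis
    moreover have "runs_in B (WHILEPOS 5 read_body) (st 0) (Suc ?n * (Suc K2 * b)) (st ?n)"
      by (rule runs_in_while[OF K2]) (use sized run_read_body in \<open>auto simp: st_def read_mem_def\<close>)
    moreover have "run ?check (st ?n) = ?fin"
      by (intro config_eqI) (auto simp: st_def run_assign valid_exp_def final_mem_def valid_def read_mem_def fun_eq_iff)
    then have "runs_in B ?check (st ?n) (K3 * b) ?fin"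
      using K3 sized[of ?n] unfolding linear_cost_def by (metis order_refl)
    ultimately have "runs_in B read_word (initial_config w) (K1 * b + (Suc ?n * (Suc K2 * b) + K3 * b)) ?fin"
      unfolding read_word_def by (intro runs_in_SEQ)
    moreover have "K1 * b + (Suc ?n * (Suc K2 * b) + K3 * b) \<le> (K1 + Suc K2 + K3) * b ^ 2"
    proof -
      have "b \<le> b ^ 2"
        by (simp add: power2_eq_square)
      then have "K1 * b \<le> K1 * b ^ 2" "K3 * b \<le> K3 * b ^ 2"
        by (rule mult_le_mono2)+
      moreover have "Suc ?n * (Suc K2 * b) \<le> b * (Suc K2 * b)"
        using b(1) by (intro mult_right_mono) auto
      moreover have "(K1 + Suc K2 + K3) * b ^ 2 = K1 * b ^ 2 + (b * (Suc K2 * b) + K3 * b ^ 2)"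
        by (simp add: algebra_simps power2_eq_square)
      ultimately show ?thesis
        by linarith
    qed
    moreover have "sized b ?fin"
      using sized[of ?n] b(1) by (auto simp: sized_def st_def final_mem_def)
    ultimately show "runs_in B read_word (initial_config w) ((K1 + Suc K2 + K3) * b ^ 2) ?fin \<and> sized b ?fin"
      using runs_in_mono by blast
  qed
qed

section \<open>Writing the query\<close>

definition row_exp :: exp where
  "row_exp = Op MULT size_exp (Num 2)"

definition state_exp :: exp where
  "state_exp = Op DIV (Var 6) row_exp"

definition rest_exp :: exp where
  "rest_exp = Op SUB (Var 6) (Op MULT row_exp state_exp)"

definition act_exp :: exp where
  "act_exp = Op DIV rest_exp size_exp"

definition target_exp :: exp where
  "target_exp = Op SUB rest_exp (Op MULT size_exp act_exp)"

text \<open>The counter encodes source, action and target in mixed radix. Remainders are formed from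
  quotients because \<open>arith\<close> has no remainder operation.\<close>

lemma eval_index_exp:
  assumes "m 1 = int k" "m 6 = int x" and S: "S = 2 * k + 6"
  shows "eval_exp m state_exp = int (x div (2 * S))"
    and "eval_exp m act_exp = int (x mod (2 * S) div S)"
    and "eval_exp m target_exp = int (x mod (2 * S) mod S)"
proof -
  have size: "eval_exp m size_exp = int S"
    using assms eval_size_exp by simp
  then have row: "eval_exp m row_exp = int (2 * S)"
    by (simp add: row_exp_def)
  then show state: "eval_exp m state_exp = int (x div (2 * S))"
    using assms(2) by (simp add: state_exp_def zdiv_int)
  have sub: "int a - int b * int (a div b) = int (a mod b)" for a b
    by (simp add: zdiv_int zmod_int minus_mult_div_eq_mod)
  have rest: "eval_exp m rest_exp = int (x mod (2 * S))"
    using assms(2) row state sub[of x "2 * S"] by (simp add: rest_exp_def)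
  then show act: "eval_exp m act_exp = int (x mod (2 * S) div S)"
    using size by (simp add: act_exp_def zdiv_int)
  show "eval_exp m target_exp = int (x mod (2 * S) mod S)"
    using rest size act sub[of "x mod (2 * S)" S] by (simp add: target_exp_def)
qed

lemmas exp_defs = size_exp_def half_exp_def entry_exp_def coeff_exp_def mult_exp_def num_exp_def den_exp_def
  wgt_exp_def row_exp_def state_exp_def rest_exp_def act_exp_def target_exp_def

definition emit_query :: com where
  "emit_query = SEQ (emit_list [size_exp, Num 2, Num 0])
     (SEQ (emit_loop size_exp [If_eq (Var 6) (Num 5) (Num 1) (Num 0)])
     (SEQ (emit_loop row_exp [wgt_exp (Op DIV (Var 6) (Num 2))])
     (SEQ (emit_loop (Op MULT size_exp row_exp) [num_exp state_exp act_exp target_exp, den_exp state_exp target_exp])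
        (emit_list [Num 9, Op MULT (Num 2) (Op ADD (Var 1) (Num 4))]))))"

text \<open>Each block leaves the memory unchanged, so the next one starts from the same
  configuration with a longer query tape. The lower bound on \<open>b\<close> exceeds the number of
  rounds of the longest loop.\<close>

lemma runs_in_emit_query:
  "\<exists>K. \<forall>C \<sigma> b k B v. tidy (mem \<sigma>) \<longrightarrow> mem \<sigma> 1 = int k \<longrightarrow> mem \<sigma> 3 = B \<longrightarrow> mem \<sigma> 5 = 0 \<longrightarrow> mem \<sigma> 6 = 0 \<longrightarrow>
     (\<forall>i<length v. mem \<sigma> (32 + i) = v ! i) \<longrightarrow> length v = 4 * k \<longrightarrow> sized b \<sigma> \<longrightarrow>
     Suc ((2 * k + 6) * (2 * (2 * k + 6))) \<le> b \<longrightarrow>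
     runs_in C emit_query \<sigma> (K * b ^ 2) (\<sigma>\<lparr>qry := qry \<sigma> @ query_word k B v\<rparr>)"
proof -
  let ?head = "[size_exp, Num 2, Num 0]" and ?tail = "[Num 9, Op MULT (Num 2) (Op ADD (Var 1) (Num 4))]"
    and ?flags = "[If_eq (Var 6) (Num 5) (Num 1) (Num 0)]" and ?wgts = "[wgt_exp (Op DIV (Var 6) (Num 2))]"
    and ?probs = "[num_exp state_exp act_exp target_exp, den_exp state_exp target_exp]"
  have fits: "fits 15 size_exp" "fits 15 row_exp" "fits 15 (Op MULT size_exp row_exp)"
    "\<forall>e\<in>set ?head. fits 15 e" "\<forall>e\<in>set ?tail. fits 15 e" "\<forall>e\<in>set ?flags. fits 15 e"
    "\<forall>e\<in>set ?wgts. fits 15 e" "\<forall>e\<in>set ?probs. fits 15 e"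
    by (simp_all add: exp_defs)
  obtain K1 where K1: "linear_cost K1 (emit_list ?head)"
    using loop_free_linear_cost[of "emit_list ?head"] by auto
  obtain K5 where K5: "linear_cost K5 (emit_list ?tail)"
    using loop_free_linear_cost[of "emit_list ?tail"] by auto
  from runs_in_emit_loop[of size_exp ?flags] obtain K2 where K2: "\<And>C \<sigma> b n. tidy (mem \<sigma>) \<Longrightarrow> mem \<sigma> 5 = 0 \<Longrightarrow> mem \<sigma> 6 = 0 \<Longrightarrow>
      eval_exp (mem \<sigma>) size_exp = int n \<Longrightarrow> sized b \<sigma> \<Longrightarrow> Suc n \<le> b \<Longrightarrow>
      runs_in C (emit_loop size_exp ?flags) \<sigma> (K2 * b ^ 2) (\<sigma>\<lparr>qry := qry \<sigma> @ emitted (mem \<sigma>) n ?flags n\<rparr>)"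
    using fits by blast
  from runs_in_emit_loop[of row_exp ?wgts] obtain K3 where K3: "\<And>C \<sigma> b n. tidy (mem \<sigma>) \<Longrightarrow> mem \<sigma> 5 = 0 \<Longrightarrow> mem \<sigma> 6 = 0 \<Longrightarrow>
      eval_exp (mem \<sigma>) row_exp = int n \<Longrightarrow> sized b \<sigma> \<Longrightarrow> Suc n \<le> b \<Longrightarrow>
      runs_in C (emit_loop row_exp ?wgts) \<sigma> (K3 * b ^ 2) (\<sigma>\<lparr>qry := qry \<sigma> @ emitted (mem \<sigma>) n ?wgts n\<rparr>)"
    using fits by blast
  from runs_in_emit_loop[of "Op MULT size_exp row_exp" ?probs] obtain K4 where K4: "\<And>C \<sigma> b n. tidy (mem \<sigma>) \<Longrightarrow> mem \<sigma> 5 = 0 \<Longrightarrow> mem \<sigma> 6 = 0 \<Longrightarrow>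
      eval_exp (mem \<sigma>) (Op MULT size_exp row_exp) = int n \<Longrightarrow> sized b \<sigma> \<Longrightarrow> Suc n \<le> b \<Longrightarrow>
      runs_in C (emit_loop (Op MULT size_exp row_exp) ?probs) \<sigma> (K4 * b ^ 2)
        (\<sigma>\<lparr>qry := qry \<sigma> @ emitted (mem \<sigma>) n ?probs n\<rparr>)"
    using fits by blast
  show ?thesis
  proof (rule exI[of _ "K1 + (K2 + (K3 + (K4 + K5)))"], intro allI impI)
    fix C \<sigma> b k B and v :: "int list"
    assume tidy: "tidy (mem \<sigma>)" and m: "mem \<sigma> 1 = int k" "mem \<sigma> 3 = B" "mem \<sigma> 5 = 0" "mem \<sigma> 6 = 0"
      and v: "\<forall>i<length v. mem \<sigma> (32 + i) = v ! i" "length v = 4 * k" and b: "sized b \<sigma>"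
      and le: "Suc ((2 * k + 6) * (2 * (2 * k + 6))) \<le> b"
    define S where "S = 2 * k + 6"
    have size: "eval_exp (mem \<sigma>) size_exp = int S" "eval_exp (mem \<sigma>) row_exp = int (S * 2)"
      "eval_exp (mem \<sigma>) (Op MULT size_exp row_exp) = int (S * (2 * S))"
      using eval_size_exp[of "mem \<sigma>" k] m by (simp_all add: S_def row_exp_def)
    have "S * 2 \<le> S * (2 * S)" "S \<le> S * 2"
      by (simp_all add: S_def)
    moreover have "Suc (S * (2 * S)) \<le> b"
      using le by (simp only: S_def)
    ultimately have le: "Suc S \<le> b" "Suc (S * 2) \<le> b" "Suc (S * (2 * S)) \<le> b"
      by linarith+
    have flags: "emitted (mem \<sigma>) S ?flags S = map (\<lambda>s. if s = 5 then 1 else 0) [0..<S]"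
      by (simp add: emitted_def)
    have wgts: "emitted (mem \<sigma>) (S * 2) ?wgts (S * 2) = map (\<lambda>x. gadget_wgt (x div 2)) [0..<S * 2]"
      by (simp add: emitted_def eval_wgt_exp zdiv_int)
    have probs: "emitted (mem \<sigma>) (S * (2 * S)) ?probs (S * (2 * S)) =
        concat (map (\<lambda>x. case prob_pair k B v (x div (2 * S)) (x mod (2 * S) div S) (x mod (2 * S) mod S) of
          (p, q) \<Rightarrow> [p, q]) [0..<S * (2 * S)])"
      unfolding emitted_def
    proof (intro arg_cong[of _ _ concat] map_cong refl)
      fix x assume "x \<in> set [0..<S * (2 * S)]"
      then have x: "x div (2 * S) < 2 * k + 6" "x mod (2 * S) div S < 2" "x mod (2 * S) mod S < 2 * k + 6"
        unfolding S_def[symmetric] by (simp_all add: less_mult_imp_div_less S_def)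
      let ?m = "(mem \<sigma>)(5 := int (S * (2 * S) - x), 6 := int x)"
      have index: "eval_exp ?m state_exp = int (x div (2 * S))" "eval_exp ?m act_exp = int (x mod (2 * S) div S)"
        "eval_exp ?m target_exp = int (x mod (2 * S) mod S)"
        using m by (intro eval_index_exp[OF _ _ S_def]; simp)+
      have m': "?m 1 = int k" "?m 3 = B" "\<And>i. i < length v \<Longrightarrow> ?m (32 + i) = v ! i"
        using m v by simp_all
      show "map (eval_exp ?m) ?probs =
          (case prob_pair k B v (x div (2 * S)) (x mod (2 * S) div S) (x mod (2 * S) mod S) of (p, q) \<Rightarrow> [p, q])"
        using eval_prob_exp[where m = ?m, OF m' v(2) index(1) x(1) index(2) x(2) index(3) x(3)]
        by (simp add: case_prod_unfold)
    qed
    have "run (emit_list ?head) \<sigma> = \<sigma>\<lparr>qry := qry \<sigma> @ [int S, 2, 0]\<rparr>"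
      using tidy fits(4) size(1) by (subst run_emit_list) auto
    with K1 b have head: "runs_in C (emit_list ?head) \<sigma> (K1 * b) (\<sigma>\<lparr>qry := qry \<sigma> @ [int S, 2, 0]\<rparr>)"
      by (rule linear_costD)
    have tail: "runs_in C (emit_list ?tail) (\<sigma>\<lparr>qry := q\<rparr>) (K5 * b) (\<sigma>\<lparr>qry := q @ [9, 2 * (int k + 4)]\<rparr>)" for q
    proof (rule linear_costD[OF K5])
      show "run (emit_list ?tail) (\<sigma>\<lparr>qry := q\<rparr>) = \<sigma>\<lparr>qry := q @ [9, 2 * (int k + 4)]\<rparr>"
        using tidy fits(5) m(1) by (subst run_emit_list) auto
    qed (use b in simp)
    have "runs_in C emit_query \<sigma> (K1 * b + (K2 * b ^ 2 + (K3 * b ^ 2 + (K4 * b ^ 2 + K5 * b))))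
        (\<sigma>\<lparr>qry := ((((qry \<sigma> @ [int S, 2, 0]) @ emitted (mem \<sigma>) S ?flags S) @ emitted (mem \<sigma>) (S * 2) ?wgts (S * 2)) @
          emitted (mem \<sigma>) (S * (2 * S)) ?probs (S * (2 * S))) @ [9, 2 * (int k + 4)]\<rparr>)"
      unfolding emit_query_def
    proof (intro runs_in_SEQ)
      let ?\<sigma>1 = "\<sigma>\<lparr>qry := qry \<sigma> @ [int S, 2, 0]\<rparr>"
      let ?\<sigma>2 = "\<sigma>\<lparr>qry := qry ?\<sigma>1 @ emitted (mem \<sigma>) S ?flags S\<rparr>"
      let ?\<sigma>3 = "\<sigma>\<lparr>qry := qry ?\<sigma>2 @ emitted (mem \<sigma>) (S * 2) ?wgts (S * 2)\<rparr>"
      show "runs_in C (emit_list ?head) \<sigma> (K1 * b) ?\<sigma>1"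
        by (rule head)
      show "runs_in C (emit_loop size_exp ?flags) ?\<sigma>1 (K2 * b ^ 2) ?\<sigma>2"
        using K2[of ?\<sigma>1 S b C] tidy m size b le by simp
      show "runs_in C (emit_loop row_exp ?wgts) ?\<sigma>2 (K3 * b ^ 2) ?\<sigma>3"
        using K3[of ?\<sigma>2 "S * 2" b C] tidy m size b le by simp
      show "runs_in C (emit_loop (Op MULT size_exp row_exp) ?probs) ?\<sigma>3 (K4 * b ^ 2)
          (\<sigma>\<lparr>qry := qry ?\<sigma>3 @ emitted (mem \<sigma>) (S * (2 * S)) ?probs (S * (2 * S))\<rparr>)"
        using K4[of ?\<sigma>3 "S * (2 * S)" b C] tidy m size b le by simp
      show "runs_in C (emit_list ?tail) (\<sigma>\<lparr>qry := qry ?\<sigma>3 @ emitted (mem \<sigma>) (S * (2 * S)) ?probs (S * (2 * S))\<rparr>) (K5 * b)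
          (\<sigma>\<lparr>qry := ((((qry \<sigma> @ [int S, 2, 0]) @ emitted (mem \<sigma>) S ?flags S) @ emitted (mem \<sigma>) (S * 2) ?wgts (S * 2)) @
            emitted (mem \<sigma>) (S * (2 * S)) ?probs (S * (2 * S))) @ [9, 2 * (int k + 4)]\<rparr>)"
        using tail[of "qry ?\<sigma>3 @ emitted (mem \<sigma>) (S * (2 * S)) ?probs (S * (2 * S))"] by simp
    qed
    moreover have "b \<le> b ^ 2"
      by (simp add: power2_eq_square)
    then have "K1 * b \<le> K1 * b ^ 2" "K5 * b \<le> K5 * b ^ 2"
      by (rule mult_le_mono2)+
    then have "K1 * b + (K2 * b ^ 2 + (K3 * b ^ 2 + (K4 * b ^ 2 + K5 * b))) \<le> (K1 + (K2 + (K3 + (K4 + K5)))) * b ^ 2"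
      unfolding add_mult_distrib by linarith
    ultimately have "runs_in C emit_query \<sigma> ((K1 + (K2 + (K3 + (K4 + K5)))) * b ^ 2)
        (\<sigma>\<lparr>qry := ((((qry \<sigma> @ [int S, 2, 0]) @ emitted (mem \<sigma>) S ?flags S) @ emitted (mem \<sigma>) (S * 2) ?wgts (S * 2)) @
          emitted (mem \<sigma>) (S * (2 * S)) ?probs (S * (2 * S))) @ [9, 2 * (int k + 4)]\<rparr>)"
      by (rule runs_in_mono)
    then show "runs_in C emit_query \<sigma> ((K1 + (K2 + (K3 + (K4 + K5)))) * b ^ 2) (\<sigma>\<lparr>qry := qry \<sigma> @ query_word k B v\<rparr>)"
      unfolding flags wgts probs query_word_def Let_def S_def[symmetric] by (simp only: append_assoc)
  qed
qed

section \<open>The decision procedure and its correctness\<close>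

definition decide_positivity :: com where
  "decide_positivity = SEQ read_word
     (IFPOS 8 (SEQ emit_query (SEQ (QUERY 0) (assign 0 (Op SUB (Num 1) (Var 0))))) (IMM 0 0))"

text \<open>The content of cell 3 after reading. For integers a square dominates the absolute value,
  so this bounds all entries without any comparison.\<close>

definition bound_of :: "int list \<Rightarrow> int" where
  "bound_of v = 1 + (\<Sum>x\<leftarrow>v. x * x)"

lemma bound_of: "bound_of v > 0" "x \<in> set v \<Longrightarrow> \<bar>x\<bar> \<le> bound_of v"
proof -
  have nonneg: "0 \<le> (\<Sum>x\<leftarrow>w. x * x)" for w :: "int list"
    by (rule sum_list_nonneg) auto
  then show "bound_of v > 0"
    by (simp add: bound_of_def add_pos_nonneg)
  show "\<bar>x\<bar> \<le> bound_of v" if "x \<in> set v"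
  proof -
    have "x * x \<le> (\<Sum>x\<leftarrow>v. x * x)"
      using that nonneg by (auto dest!: split_list)
    moreover have "\<bar>x\<bar> \<le> x * x"
      by (cases "x = 0") (use mult_left_mono[of 1 "\<bar>x\<bar>" "\<bar>x\<bar>"] in auto)
    ultimately show ?thesis
      by (simp add: bound_of_def)
  qed
qed

text \<open>For inputs of size \<open>W\<close>, the number \<open>113 * (1 + W)\<^sup>2\<close> exceeds the bit lengths of all cells and the
  numbers of rounds of all loops.\<close>

lemma decide_positivity:
  "\<exists>K. \<forall>B w k v. k = (case w of [] \<Rightarrow> 0 | x # _ \<Rightarrow> x) \<longrightarrow> v = tl w \<longrightarrow>
     (\<exists>\<tau>. runs_in B decide_positivity (initial_config w) (K * (113 * (1 + word_size w) ^ 2) ^ 2) \<tau> \<and>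
       (mem \<tau> 0 = 1 \<longleftrightarrow> valid k v \<and> query_word (nat k) (bound_of v) v \<notin> B))"
proof -
  let ?flip = "assign 0 (Op SUB (Num 1) (Var 0))"
  from runs_in_read_word obtain K1 where K1: "\<And>B w b k v. k = (case w of [] \<Rightarrow> 0 | x # _ \<Rightarrow> x) \<Longrightarrow> v = tl w \<Longrightarrow>
     bits k + 2 * word_size v + length v + 41 \<le> b \<Longrightarrow> (\<forall>x\<in>set w. bits x \<le> b) \<Longrightarrow>
     runs_in B read_word (initial_config w) (K1 * b ^ 2) \<lparr>mem = final_mem k v, inp = [], qry = []\<rparr> \<and>
     sized b \<lparr>mem = final_mem k v, inp = [], qry = []\<rparr>"
    by blast
  from runs_in_emit_query obtain K2 where K2: "\<And>C \<sigma> b k B v. tidy (mem \<sigma>) \<Longrightarrow> mem \<sigma> 1 = int k \<Longrightarrow>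
     mem \<sigma> 3 = B \<Longrightarrow> mem \<sigma> 5 = 0 \<Longrightarrow> mem \<sigma> 6 = 0 \<Longrightarrow>
     (\<forall>i<length v. mem \<sigma> (32 + i) = v ! i) \<Longrightarrow> length v = 4 * k \<Longrightarrow> sized b \<sigma> \<Longrightarrow>
     Suc ((2 * k + 6) * (2 * (2 * k + 6))) \<le> b \<Longrightarrow>
     runs_in C emit_query \<sigma> (K2 * b ^ 2) (\<sigma>\<lparr>qry := qry \<sigma> @ query_word k B v\<rparr>)"
    by blast
  obtain K3 where K3: "linear_cost K3 ?flip"
    using loop_free_linear_cost[of ?flip] by auto
  show ?thesis
  proof (rule exI[of _ "K1 + K2 + K3 + 2"], intro allI impI)
    fix B and w :: "int list" and k v
    assume k: "k = (case w of [] \<Rightarrow> 0 | x # _ \<Rightarrow> x)" and v: "v = tl w"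
    define W b where "W = word_size w" and "b = 113 * (1 + W) ^ 2"
    define \<sigma> :: config where "\<sigma> = \<lparr>mem = final_mem k v, inp = [], qry = []\<rparr>"
    have W: "bits x \<le> W" if "x \<in> set w" for x
      unfolding W_def word_size_def using that by (intro member_le_sum_list) auto
    have "length u \<le> word_size u" for u
    proof (induction u)
      case (Cons x u)
      then show ?case
        using bits_ge_1[of x] by (simp add: word_size_def)
    qed simp
    from this[of v] have v_le: "length v \<le> word_size v" "bits k + word_size v \<le> 1 + W"
      using k v by (auto simp: W_def word_size_def split: list.splits)
    have b_eq: "b = 113 + 226 * W + 113 * W\<^sup>2"
      by (simp add: b_def power2_eq_square algebra_simps)
    have b1: "bits k + 2 * word_size v + length v + 41 \<le> b"
      using v_le b_eq by linarith
    have "W \<le> b"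
      using b_eq by linarith
    then have "\<forall>x\<in>set w. bits x \<le> b"
      using W order_trans by blast
    with K1[OF k v b1] have read: "runs_in B read_word (initial_config w) (K1 * b ^ 2) \<sigma>" and sized: "sized b \<sigma>"
      by (simp_all add: \<sigma>_def)
    then obtain t where t: "t \<le> K1 * b ^ 2" "exec B read_word (initial_config w) t \<sigma>"
      by (auto simp: runs_in_def)
    have bb: "b \<le> b ^ 2" "1 \<le> b"
      using b_eq by (auto simp: power2_eq_square)
    have bit8: "bits (mem \<sigma> 8) \<le> b"
      using sized by (simp add: sized_def)
    show "\<exists>\<tau>. runs_in B decide_positivity (initial_config w) ((K1 + K2 + K3 + 2) * (113 * (1 + word_size w) ^ 2) ^ 2) \<tau> \<and>
       (mem \<tau> 0 = 1 \<longleftrightarrow> valid k v \<and> query_word (nat k) (bound_of v) v \<notin> B)"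
      unfolding W_def[symmetric] b_def[symmetric]
    \<comment> \<open>Malformed words are rejected before any loop governed by \<open>k\<close> is
      entered.\<close>
    proof (cases "valid k v")
      case False
      let ?\<tau> = "set_cell 0 0 \<sigma>"
      have "mem \<sigma> 8 \<le> 0"
        using False by (simp add: \<sigma>_def final_mem_def)
      from exec.Seq[OF t(2) exec.If_False[OF this exec.Imm[of B 0 0]]]
      have "exec B decide_positivity (initial_config w) (t + (bits (mem \<sigma> 8) + 1)) ?\<tau>"
        by (simp add: decide_positivity_def)
      moreover have "t + (bits (mem \<sigma> 8) + 1) \<le> (K1 + K2 + K3 + 2) * b ^ 2"
        using t(1) bit8 bb unfolding add_mult_distrib by linarith
      ultimately show "\<exists>\<tau>. runs_in B decide_positivity (initial_config w) ((K1 + K2 + K3 + 2) * b ^ 2) \<tau> \<and>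
         (mem \<tau> 0 = 1 \<longleftrightarrow> valid k v \<and> query_word (nat k) (bound_of v) v \<notin> B)"
        using False by (intro exI[of _ ?\<tau>]) (auto simp: runs_in_def)
    next
      case True
      define k' where "k' = nat k"
      have k': "int k' = k" "length v = 4 * k'"
        using True by (auto simp: valid_def k'_def)
      have m: "tidy (mem \<sigma>)" "mem \<sigma> 1 = int k'" "mem \<sigma> 3 = bound_of v" "mem \<sigma> 5 = 0" "mem \<sigma> 6 = 0" "mem \<sigma> 8 = 1"
        "\<forall>i<length v. mem \<sigma> (32 + i) = v ! i" "qry \<sigma> = []"
        using True k' by (simp_all add: \<sigma>_def final_mem_def read_mem_def bound_of_def)
      \<comment> \<open>Here well-formedness bounds \<open>k\<close> by the length of the word, so a
        number of rounds quadratic in \<open>k\<close> is polynomial in the input size.\<close>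
      have "4 * k' \<le> 1 + W"
        using v_le k'(2) by linarith
      then have "2 * k' + 6 \<le> 7 + W"
        by linarith
      then have "(2 * k' + 6) * (2 * (2 * k' + 6)) \<le> (7 + W) * (2 * (7 + W))"
        by (intro mult_le_mono) auto
      also have "\<dots> = 98 + 28 * W + 2 * W\<^sup>2"
        by (simp add: power2_eq_square algebra_simps)
      finally have "Suc ((2 * k' + 6) * (2 * (2 * k' + 6))) \<le> b"
        using b_eq by linarith
      from K2[OF m(1-5,7) k'(2) sized this, of B] m(8) obtain u where u: "u \<le> K2 * b ^ 2"
        "exec B emit_query \<sigma> u (\<sigma>\<lparr>qry := query_word k' (bound_of v) v\<rparr>)"
        by (auto simp: runs_in_def)
      define r :: int where "r = (if query_word k' (bound_of v) v \<in> B then 1 else 0)"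
      let ?\<sigma>' = "set_cell 0 r \<sigma>"
      have "(\<sigma>\<lparr>qry := query_word k' (bound_of v) v\<rparr>)\<lparr>qry := []\<rparr> = \<sigma>"
        using m(8) by (intro config_eqI) simp_all
      with exec.Query[of B 0 "\<sigma>\<lparr>qry := query_word k' (bound_of v) v\<rparr>"]
      have query: "exec B (QUERY 0) (\<sigma>\<lparr>qry := query_word k' (bound_of v) v\<rparr>) 1 ?\<sigma>'"
        by (simp add: r_def)
      have "bits r \<le> b"
        using b_eq by (simp add: r_def)
      then have "runs_in B ?flip ?\<sigma>' (K3 * b) (run ?flip ?\<sigma>')"
        using K3 sized sized_set_cell unfolding linear_cost_def by blast
      moreover have "run ?flip ?\<sigma>' = set_cell 0 (1 - r) ?\<sigma>'"
        using m(1) by (subst run_assign) auto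
      ultimately obtain x where x: "x \<le> K3 * b" "exec B ?flip ?\<sigma>' x (set_cell 0 (1 - r) ?\<sigma>')"
        by (auto simp: runs_in_def)
      have "exec B decide_positivity (initial_config w) (t + (bits (mem \<sigma> 8) + (u + (1 + x)))) (set_cell 0 (1 - r) ?\<sigma>')"
        unfolding decide_positivity_def
        by (intro exec.Seq[OF t(2)] exec.If_True exec.Seq[OF u(2)] exec.Seq[OF query] x(2)) (simp add: m(6))
      moreover have "t + (bits (mem \<sigma> 8) + (u + (1 + x))) \<le> (K1 + K2 + K3 + 2) * b ^ 2"
      proof -
        have "K3 * b \<le> K3 * b ^ 2"
          using bb(1) by (rule mult_le_mono2)
        with t(1) u(1) x(1) bit8 bb show ?thesis
          unfolding add_mult_distrib by linarith
      qed
      ultimately show "\<exists>\<tau>. runs_in B decide_positivity (initial_config w) ((K1 + K2 + K3 + 2) * b ^ 2) \<tau> \<and>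
         (mem \<tau> 0 = 1 \<longleftrightarrow> valid k v \<and> query_word (nat k) (bound_of v) v \<notin> B)"
        using True by (intro exI[of _ "set_cell 0 (1 - r) ?\<sigma>'"]) (auto simp: runs_in_def r_def k'_def)
    qed
  qed
qed

text \<open>An encoded instance is a valid word, and conversely the positive numbers at odd
  positions of a valid word serve as denominators of rationals, which split into coefficients and
  initial values. In both cases \<open>query_word_iff\<close> links the oracle to a negative
  term.\<close>

lemma positivity_iff:
  assumes k: "k = (case w of [] \<Rightarrow> 0 | x # _ \<Rightarrow> x)" and v: "v = tl w"
  shows "w \<in> positivity_problem \<longleftrightarrow> valid k v \<and> query_word (nat k) (bound_of v) v \<notin> partial_ssp_threshold_problem"
proof
  assume "w \<in> positivity_problem"
  then obtain k' \<alpha> \<beta> where w: "w = int k' # v" "k = int k'" and k': "k' \<ge> 2" "length \<alpha> = k'" "length \<beta> = k'"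
    and v': "encodes_rats v (\<alpha> @ \<beta>)" and pos: "\<forall>n. lrs \<alpha> \<beta> n \<ge> 0"
    using k v by (auto simp: positivity_problem_def)
  interpret instance_word k' "bound_of v" v \<alpha> \<beta>
    using k' v' bound_of by (rule instance_word.intro)
  have "v ! j > 0" if "j < length v" "odd j" for j
    using that v_nth[of "j div 2"] length_v by (auto elim!: oddE)
  then have "valid k v"
    using w k' length_v by (auto simp: valid_def)
  with query_word_iff pos w show "valid k v \<and> query_word (nat k) (bound_of v) v \<notin> partial_ssp_threshold_problem"
    by (auto simp: not_less)
next
  assume *: "valid k v \<and> query_word (nat k) (bound_of v) v \<notin> partial_ssp_threshold_problem"
  define k' where "k' = nat k"
  have k': "k = int k'" "k' \<ge> 2" "length v = 4 * k'" "\<forall>j<length v. odd j \<longrightarrow> v ! j > 0"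
    using * by (auto simp: valid_def k'_def)
  then have w: "w = int k' # v"
    using k v by (cases w) auto
  obtain rs where rs: "length rs = 2 * k'" "encodes_rats v rs"
    using encodes_rats_exists[of v "2 * k'"] k' by auto
  define \<alpha> \<beta> where "\<alpha> = take k' rs" and "\<beta> = drop k' rs"
  have \<alpha>\<beta>: "length \<alpha> = k'" "length \<beta> = k'" "encodes_rats v (\<alpha> @ \<beta>)"
    using rs by (simp_all add: \<alpha>_def \<beta>_def)
  interpret instance_word k' "bound_of v" v \<alpha> \<beta>
    using k'(2) \<alpha>\<beta> bound_of by (rule instance_word.intro)
  have "\<forall>n. lrs \<alpha> \<beta> n \<ge> 0"
    using query_word_iff * by (simp add: not_less flip: k'_def)
  with w k'(2) \<alpha>\<beta> show "w \<in> positivity_problem"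
    unfolding positivity_problem_def by blast
qed

theorem theorem2:
  shows "poly_time_turing_reducible positivity_problem partial_ssp_threshold_problem"
proof -
  obtain K where K: "\<exists>\<tau>. runs_in B decide_positivity (initial_config w) (K * (113 * (1 + word_size w) ^ 2) ^ 2) \<tau> \<and>
      (mem \<tau> 0 = 1 \<longleftrightarrow> valid (case w of [] \<Rightarrow> 0 | x # _ \<Rightarrow> x) (tl w) \<and>
        query_word (nat (case w of [] \<Rightarrow> 0 | x # _ \<Rightarrow> x)) (bound_of (tl w)) (tl w) \<notin> B)" for B w
    using decide_positivity by blast
  define p :: "nat poly" where "p = [:K:] * ([:113:] * [:1, 1:] ^ 2) ^ 2"
  have p: "poly p n = K * (113 * (1 + n) ^ 2) ^ 2" for n
    by (simp add: p_def)
  show ?thesis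
    unfolding poly_time_turing_reducible_def
  proof (intro exI[of _ decide_positivity] exI[of _ p] allI)
    fix w
    show "\<exists>t \<tau>. exec partial_ssp_threshold_problem decide_positivity (initial_config w) t \<tau> \<and>
        t \<le> poly p (word_size w) \<and> (mem \<tau> 0 = 1 \<longleftrightarrow> w \<in> positivity_problem)"
      using K[of partial_ssp_threshold_problem w] unfolding p positivity_iff[OF refl refl] runs_in_def
      by blast
  qed
qed

end
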